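(* Let $n\in\{1,2\}$ and let $\Gamma\subset\mathbb{R}^n$ be the attractor of an iterated function system of $M\geq 2$ contracting similarities satisfying the open set condition, with $d=\dim_{\mathrm H}(\Gamma)>n-1$. Suppose that the IFS is homogeneous with contraction factor $\rho\in(0,1)$ (all $M$ contraction factors equal $\rho$) and that $\Gamma$ is hull-disjoint, i.e. $R_{\Gamma,\mathrm{Hull}}:=\min_{m\ne m'}\mathrm{dist}\big(s_m(\mathrm{Hull}(\Gamma)),s_{m'}(\mathrm{Hull}(\Gamma))\big)>0$. Let $k>0$ and $c_{\rm osc}>0$. For the approximation of $I_{\Gamma,\Gamma}[\Phi]=\int_\Gamma\int_\Gamma\Phi(x,y)\,d\mathcal{H}^d(y)\,d\mathcal{H}^d(x)$, where $\Phi$ is the Helmholtz fundamental solution with wavenumber $k$ given in the context, let $Q^h_{\Gamma,\Gamma,\Phi}$ be the singularity-subtraction quadrature rule defined in the context, with $0<h\le\mathrm{diam}(\Gamma)$ if $k\,\mathrm{diam}(\Gamma)\le c_{\rm osc}$ and with $0<h\le c_{\rm osc}/k$ if $k\,\mathrm{diam}(\Gamma)>c_{\rm osc}$. Let $N:=|L_h(\Gamma)|$. Then there is a constant $C>0$ depending only on $c_{\rm osc}$ such that $$\big|I_{\Gamma,\Gamma}[\Phi]-Q^h_{\Gamma,\Gamma,\Phi}\big|\le C\,c'\,h^2\big(\mathcal{H}^d(\Gamma)\big)^2\le C\,c'\big(\mathrm{diam}(\Gamma)\mathcal{H}^d(\Gamma)\big)^2\Big(\frac NM\Big)^{-2/d},$$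 where, if $k\,\mathrm{diam}(\Gamma)\le c_{\rm osc}$, $$c'=\frac{\big(\frac{\rho M}{\rho M-1}\big)^{n-1}}{\rho^{n+1}R_{\Gamma,\mathrm{Hull}}^{n+1}}=\frac{M^{(n+1)/d}}{(1-M^{1/d-1})^{n-1}R_{\Gamma,\mathrm{Hull}}^{n+1}},$$ and, if $k\,\mathrm{diam}(\Gamma)>c_{\rm osc}$, $$c'=\Bigg(1+\frac{\big(\frac{\rho M}{\rho M-1}\big)^{n-1}}{\rho^{n+1}(k\,\mathrm{diam}(\Gamma))^d}\Bigg)\bigg(\frac{k\,\mathrm{diam}(\Gamma)}{R_{\Gamma,\mathrm{Hull}}}\bigg)^{n+1}=\Bigg(1+\frac{M^{(n+1)/d}}{(1-M^{1/d-1})^{n-1}(k\,\mathrm{diam}(\Gamma))^d}\Bigg)\bigg(\frac{k\,\mathrm{diam}(\Gamma)}{R_{\Gamma,\mathrm{Hull}}}\bigg)^{n+1}.$$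
   Context: IFS: a collection $\{s_1,\dots,s_M\}$, $M\ge2$, of maps $s_m:\mathbb{R}^n\to\mathbb{R}^n$, $s_m(x)=\rho_mA_mx+\delta_m$, with $\rho_m\in(0,1)$, $A_m$ orthogonal, $\delta_m\in\mathbb{R}^n$; here $\rho_m=\rho$ for all $m$. Its attractor $\Gamma$ is the unique non-empty compact set with $\Gamma=\bigcup_ms_m(\Gamma)$. Open set condition: there is a non-empty bounded open $O\subset\mathbb{R}^n$ with $\bigcup_ms_m(O)\subset O$ and $s_m(O)\cap s_{m'}(O)=\emptyset$ for $m\ne m'$. Then $d=\dim_{\mathrm H}(\Gamma)$ satisfies $M\rho^d=1$. $\mathcal{H}^d$ is the $d$-dimensional Hausdorff measure, $\mathcal{H}^d(E)=\lim_{\delta\to0}\inf\sum_i(\mathrm{diam}\,U_i)^d$ (infimum over countable covers of $E$ by sets of diameter at most $\delta$). $\mathrm{Hull}$ denotes convex hull. Vector indices: $I_\ell:=\{1,\dots,M\}^\ell$ for $\ell\in\mathbb{N}=\{1,2,\ldots\}$; for $\boldsymbol m=(m_1,\dots,m_\ell)\in I_\ell$, $\Gamma_{\boldsymbol m}:=s_{m_1}\circ\dots\circ s_{m_\ell}(\Gamma)$; $\Gamma_0:=\Gamma$. Concatenation $(\boldsymbol m,\boldsymbol n)$ is understood with $(\boldsymbol m,0)=\boldsymbol m$ and $(0,\boldsymbol n)=\boldsymbol n$. For $\boldsymbol k$ a vector index or $0$, and $0<h<\mathrm{diam}(\Gamma_{\boldsymbol k})$, $L_h(\Gamma_{\boldsymbol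 k})$ is the set of all $\boldsymbol n=(n_1,\dots,n_\ell)\in\bigcup_{\ell'\in\mathbb{N}}I_{\ell'}$ with $\mathrm{diam}(\Gamma_{(\boldsymbol k,\boldsymbol n)})\le h$ and $\mathrm{diam}(\Gamma_{(\boldsymbol k,n_1,\dots,n_{\ell-1})})>h$ (with $\Gamma_{(\boldsymbol k,n_1,\dots,n_{\ell-1})}$ replaced by $\Gamma_{\boldsymbol k}$ if $\ell=1$); $L_h(\Gamma_{\boldsymbol k}):=\{0\}$ for $h\ge\mathrm{diam}(\Gamma_{\boldsymbol k})$. Iterated barycentre rule: $$Q^h_{\Gamma_{\boldsymbol a},\Gamma_{\boldsymbol b}}[f]:=\sum_{\boldsymbol n\in L_h(\Gamma_{\boldsymbol a})}\sum_{\boldsymbol n'\in L_h(\Gamma_{\boldsymbol b})}\mathcal{H}^d(\Gamma_{(\boldsymbol a,\boldsymbol n)})\mathcal{H}^d(\Gamma_{(\boldsymbol b,\boldsymbol n')})f(x_{(\boldsymbol a,\boldsymbol n)},x_{(\boldsymbol b,\boldsymbol n')}),\quad x_{\boldsymbol k}:=\frac{\int_{\Gamma_{\boldsymbol k}}x\,d\mathcal{H}^d(x)}{\mathcal{H}^d(\Gamma_{\boldsymbol k})}.$$ Functions, for $x\ne y\in\mathbb{R}^n$: $\Phi(x,y)=\frac{\mathrm i}{4}H_0^{(1)}(k|x-y|)$ if $n=1$ ($H^{(1)}_0$ the Hankel function of the first kind of order $0$) and $\Phi(x,y)=\frac{e^{\mathrm ik|x-y|}}{4\pi|x-y|}$ if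 $n=2$; $\Phi_0(x,y)=\log|x-y|$, $\Phi_1(x,y)=|x-y|^{-1}$; $C_1=-\frac1{2\pi}$, $C_2=\frac1{4\pi}$; $\Phi_*:=\Phi-C_n\Phi_{n-1}$, extended continuously to $x=y$ (with diagonal value $\frac{-\log(k/2)-\gamma}{2\pi}+\frac{\mathrm i}4$ for $n=1$, $\gamma$ being Euler's constant, and $\frac{\mathrm ik}{4\pi}$ for $n=2$). Rule for $\Phi_{n-1}$ on $\Gamma_{\boldsymbol k}$ ($\boldsymbol k$ a vector index or $0$): $$Q^h_{\Gamma_{\boldsymbol k},\Gamma_{\boldsymbol k},0}:=\big(1-M\rho^{2d}\big)^{-1}\sum_{m=1}^M\Big(\rho^{2d}\big(\mathcal{H}^d(\Gamma_{\boldsymbol k})\big)^2\log\rho+\sum_{m'\ne m}Q^h_{\Gamma_{(\boldsymbol k,m)},\Gamma_{(\boldsymbol k,m')}}[\Phi_0]\Big),$$ $$Q^h_{\Gamma_{\boldsymbol k},\Gamma_{\boldsymbol k},1}:=\big(1-M\rho^{2d-1}\big)^{-1}\sum_{m=1}^M\sum_{m'\ne m}Q^h_{\Gamma_{(\boldsymbol k,m)},\Gamma_{(\boldsymbol k,m')}}[\Phi_1].$$ Singularity-subtraction rule: if $k\,\mathrm{diam}(\Gamma)\le c_{\rm osc}$, $$Q^h_{\Gamma,\Gamma,\Phi}:=C_nQ^h_{\Gamma,\Gamma,n-1}+Q^h_{\Gamma,\Gamma}[\Phi_*];$$ if $k\,\mathrm{diam}(\Gamma)>c_{\rm osc}$,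 with $h_*:=c_{\rm osc}/k$, $$Q^h_{\Gamma,\Gamma,\Phi}:=\sum_{\boldsymbol m\in L_{h_*}(\Gamma)}\Big(C_nQ^h_{\Gamma_{\boldsymbol m},\Gamma_{\boldsymbol m},n-1}+Q^h_{\Gamma_{\boldsymbol m},\Gamma_{\boldsymbol m}}[\Phi_*]\Big)+\sum_{\boldsymbol m\in L_{h_*}(\Gamma)}\ \sum_{\boldsymbol m'\in L_{h_*}(\Gamma),\,\boldsymbol m'\ne\boldsymbol m}Q^h_{\Gamma_{\boldsymbol m},\Gamma_{\boldsymbol m'}}[\Phi].$$ *)

theory Defs
  imports "HOL-Analysis.Analysis"
begin

section \<open>Hausdorff measure and dimension\<close>

text \<open>
  Only exponents \<open>s > 0\<close> are meaningful, because \<open>0 powr 0 = 0\<close>.  Boundedness of the covering sets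
  is stated explicitly since \<^const>\<open>diameter\<close> is unspecified on unbounded sets.  The covers are
  sequences; finite covers are included by padding with the empty set, which has diameter 0.
\<close>

definition hausdorff_delta :: "real \<Rightarrow> real \<Rightarrow> 'a::metric_space set \<Rightarrow> ennreal" where
  "hausdorff_delta s \<delta> E =
     (INF U \<in> {U :: nat \<Rightarrow> 'a set. E \<subseteq> (\<Union>i. U i) \<and> (\<forall>i. bounded (U i) \<and> diameter (U i) \<le> \<delta>)}.
        \<Sum>i. ennreal (diameter (U i) powr s))"

definition hausdorff_outer :: "real \<Rightarrow> 'a::metric_space set \<Rightarrow> ennreal" where
  "hausdorff_outer s E = Lim (at_right 0) (\<lambda>\<delta>. hausdorff_delta s \<delta> E)"

lemma hausdorff_delta_antimono: "\<delta> \<le> \<delta>' \<Longrightarrow> hausdorff_delta s \<delta>' E \<le> hausdorff_delta s \<delta> E"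
  unfolding hausdorff_delta_def by (rule INF_superset_mono) (auto intro: order_trans)

lemma hausdorff_outer_tendsto:
  "((\<lambda>\<delta>. hausdorff_delta s \<delta> E) \<longlongrightarrow> (SUP \<delta>\<in>{0<..}. hausdorff_delta s \<delta> E)) (at_right 0)"
proof (rule order_tendstoI)
  fix a assume "a < (SUP \<delta>\<in>{0<..}. hausdorff_delta s \<delta> E)"
  then obtain \<delta> where \<delta>: "\<delta> > 0" "a < hausdorff_delta s \<delta> E"
    unfolding less_SUP_iff by blast
  have "\<forall>\<^sub>F x in at_right 0. x < \<delta>"
    unfolding eventually_at_right_field using \<delta>(1) by blast
  then show "\<forall>\<^sub>F x in at_right 0. a < hausdorff_delta s x E"
  proof (rule eventually_mono)
    fix x assume "x < \<delta>"
    then show "a < hausdorff_delta s x E"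
      by (intro less_le_trans[OF \<delta>(2)] hausdorff_delta_antimono less_imp_le)
  qed
next
  fix a assume a: "(SUP \<delta>\<in>{0<..}. hausdorff_delta s \<delta> E) < a"
  show "\<forall>\<^sub>F x in at_right 0. hausdorff_delta s x E < a"
  proof (rule eventually_mono[OF eventually_at_right_less])
    fix x :: real assume "0 < x"
    then have "hausdorff_delta s x E \<le> (SUP \<delta>\<in>{0<..}. hausdorff_delta s \<delta> E)"
      by (intro SUP_upper) simp
    then show "hausdorff_delta s x E < a"
      using a by (rule le_less_trans)
  qed
qed

lemma hausdorff_outer_eq_SUP: "hausdorff_outer s E = (SUP \<delta>\<in>{0<..}. hausdorff_delta s \<delta> E)"
  unfolding hausdorff_outer_def by (rule tendsto_Lim[OF _ hausdorff_outer_tendsto]) simp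

text \<open>
  The outer measure is a metric outer measure, hence countably additive on the Borel sets, so that
  \<^const>\<open>measure_of\<close> does not fall back to its default here.
\<close>

definition hausdorff_measure :: "real \<Rightarrow> 'a::metric_space measure" where
  "hausdorff_measure s = measure_of UNIV (sets borel) (hausdorff_outer s)"

definition hausdorff_dim :: "'a::metric_space set \<Rightarrow> real" where
  "hausdorff_dim E = Inf {s. 0 < s \<and> hausdorff_outer s E = 0}"

section \<open>Iterated function systems\<close>

text \<open>The maps of an IFS are \<open>s m\<close> for \<open>m \<in> {1..M}\<close>; other indices are irrelevant.\<close>

definition similarity_ifs :: "nat \<Rightarrow> (nat \<Rightarrow> real) \<Rightarrow> (nat \<Rightarrow> real^'n \<Rightarrow> real^'n) \<Rightarrow> bool" where
  "similarity_ifs M r s \<longleftrightarrow> 2 \<le> M \<and>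
     (\<forall>m\<in>{1..M}. 0 < r m \<and> r m < 1 \<and>
        (\<exists>A \<delta>. orthogonal_matrix A \<and> (\<forall>x. s m x = r m *\<^sub>R (A *v x) + \<delta>)))"

definition homogeneous_ifs :: "nat \<Rightarrow> (nat \<Rightarrow> real) \<Rightarrow> real \<Rightarrow> bool" where
  "homogeneous_ifs M r \<rho> \<longleftrightarrow> (\<forall>m\<in>{1..M}. r m = \<rho>)"

definition is_attractor :: "nat \<Rightarrow> (nat \<Rightarrow> 'a \<Rightarrow> 'a) \<Rightarrow> 'a::topological_space set \<Rightarrow> bool" where
  "is_attractor M s \<Gamma> \<longleftrightarrow> \<Gamma> \<noteq> {} \<and> compact \<Gamma> \<and> \<Gamma> = (\<Union>m\<in>{1..M}. s m ` \<Gamma>)"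

definition open_set_condition :: "nat \<Rightarrow> (nat \<Rightarrow> 'a \<Rightarrow> 'a::metric_space) \<Rightarrow> bool" where
  "open_set_condition M s \<longleftrightarrow>
     (\<exists>O'. O' \<noteq> {} \<and> bounded O' \<and> open O' \<and> (\<Union>m\<in>{1..M}. s m ` O') \<subseteq> O' \<and>
       (\<forall>m\<in>{1..M}. \<forall>m'\<in>{1..M}. m \<noteq> m' \<longrightarrow> s m ` O' \<inter> s m' ` O' = {}))"

definition hull_separation :: "nat \<Rightarrow> (nat \<Rightarrow> 'a \<Rightarrow> 'a) \<Rightarrow> 'a::euclidean_space set \<Rightarrow> real" where
  "hull_separation M s \<Gamma> =
     Min {setdist (s m ` (convex hull \<Gamma>)) (s m' ` (convex hull \<Gamma>)) | m m'.
            m \<in> {1..M} \<and> m' \<in> {1..M} \<and> m \<noteq> m'}"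

text \<open>
  Vector indices are lists over \<open>{1..M}\<close>; the index 0 of the paper is the empty list and
  concatenation is \<open>@\<close>.
\<close>

definition sub_attractor :: "(nat \<Rightarrow> 'a \<Rightarrow> 'a) \<Rightarrow> 'a set \<Rightarrow> nat list \<Rightarrow> 'a set" where
  "sub_attractor s \<Gamma> ms = foldr (\<lambda>m g. s m \<circ> g) ms id ` \<Gamma>"

definition L_index :: "nat \<Rightarrow> (nat \<Rightarrow> 'a \<Rightarrow> 'a) \<Rightarrow> 'a::metric_space set \<Rightarrow> real \<Rightarrow> nat list \<Rightarrow> nat list set"
  where
  "L_index M s \<Gamma> h ks =
     (if h < diameter (sub_attractor s \<Gamma> ks) then
        {ns. ns \<noteq> [] \<and> set ns \<subseteq> {1..M} \<and>
             diameter (sub_attractor s \<Gamma> (ks @ ns)) \<le> h \<and>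
             diameter (sub_attractor s \<Gamma> (ks @ butlast ns)) > h}
      else {[]})"

section \<open>Kernels\<close>

text \<open>Ascending power series of the Bessel functions of order 0, for \<open>x > 0\<close>.\<close>

definition bessel_J0 :: "real \<Rightarrow> real" where
  "bessel_J0 x = (\<Sum>j. (-1) ^ j * (x\<^sup>2 / 4) ^ j / (fact j)\<^sup>2)"

definition bessel_Y0 :: "real \<Rightarrow> real" where
  "bessel_Y0 x = 2 / pi * ((ln (x / 2) + euler_mascheroni) * bessel_J0 x
                   - (\<Sum>j. (-1) ^ j * harm j * (x\<^sup>2 / 4) ^ j / (fact j)\<^sup>2))"

definition hankel1_0 :: "real \<Rightarrow> complex" where
  "hankel1_0 x = Complex (bessel_J0 x) (bessel_Y0 x)"

text \<open>
  The ambient dimension is read off from the type; only \<open>CARD('n) \<in> {1, 2}\<close> is intended.  The values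
  of \<open>Phi\<close> and \<open>Phi_log_pow\<close> on the diagonal are irrelevant.
\<close>

definition Phi :: "real \<Rightarrow> real^'n \<Rightarrow> real^'n \<Rightarrow> complex" where
  "Phi k x y =
     (if CARD('n) = 1 then \<i> / 4 * hankel1_0 (k * dist x y)
      else exp (\<i> * complex_of_real (k * dist x y)) / complex_of_real (4 * pi * dist x y))"

definition Phi_log_pow :: "nat \<Rightarrow> 'a::metric_space \<Rightarrow> 'a \<Rightarrow> real" where
  "Phi_log_pow j x y = (if j = 0 then ln (dist x y) else inverse (dist x y))"

definition C_coeff :: "nat \<Rightarrow> real" where
  "C_coeff n = (if n = 1 then - (1 / (2 * pi)) else 1 / (4 * pi))"

definition Phi_star :: "real \<Rightarrow> real^'n \<Rightarrow> real^'n \<Rightarrow> complex" where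
  "Phi_star k x y =
     (if x \<noteq> y then
        Phi k x y - complex_of_real (C_coeff CARD('n) * Phi_log_pow (CARD('n) - 1) x y)
      else if CARD('n) = 1 then
        complex_of_real ((- ln (k / 2) - euler_mascheroni) / (2 * pi)) + \<i> / 4
      else \<i> * complex_of_real k / complex_of_real (4 * pi))"

definition I_integral :: "real \<Rightarrow> 'a::metric_space set \<Rightarrow> ('a \<Rightarrow> 'a \<Rightarrow> complex) \<Rightarrow> complex" where
  "I_integral d \<Gamma> f =
     (LINT x:\<Gamma>|hausdorff_measure d. (LINT y:\<Gamma>|hausdorff_measure d. f x y))"

section \<open>Quadrature rules\<close>

text \<open>In all rules the arguments \<open>a\<close>, \<open>b\<close>, \<open>ks\<close> are the vector indices of the integration domains.\<close>

definition Hd :: "(nat \<Rightarrow> 'a \<Rightarrow> 'a) \<Rightarrow> 'a::metric_space set \<Rightarrow> real \<Rightarrow> nat list \<Rightarrow> real" where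
  "Hd s \<Gamma> d ks = measure (hausdorff_measure d) (sub_attractor s \<Gamma> ks)"

definition barycentre :: "(nat \<Rightarrow> 'a \<Rightarrow> 'a) \<Rightarrow> 'a::euclidean_space set \<Rightarrow> real \<Rightarrow> nat list \<Rightarrow> 'a" where
  "barycentre s \<Gamma> d ks =
     (LINT x:sub_attractor s \<Gamma> ks|hausdorff_measure d. x) /\<^sub>R Hd s \<Gamma> d ks"

definition Q_bary :: "nat \<Rightarrow> (nat \<Rightarrow> 'a \<Rightarrow> 'a) \<Rightarrow> 'a::euclidean_space set \<Rightarrow> real \<Rightarrow> real
    \<Rightarrow> nat list \<Rightarrow> nat list \<Rightarrow> ('a \<Rightarrow> 'a \<Rightarrow> 'b::real_vector) \<Rightarrow> 'b" where
  "Q_bary M s \<Gamma> d h a b f =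
     (\<Sum>ns\<in>L_index M s \<Gamma> h a. \<Sum>ns'\<in>L_index M s \<Gamma> h b.
        (Hd s \<Gamma> d (a @ ns) * Hd s \<Gamma> d (b @ ns')) *\<^sub>R
          f (barycentre s \<Gamma> d (a @ ns)) (barycentre s \<Gamma> d (b @ ns')))"

definition Q_sing :: "nat \<Rightarrow> real \<Rightarrow> (nat \<Rightarrow> 'a \<Rightarrow> 'a) \<Rightarrow> 'a::euclidean_space set \<Rightarrow> real \<Rightarrow> real
    \<Rightarrow> nat list \<Rightarrow> nat \<Rightarrow> real" where
  "Q_sing M \<rho> s \<Gamma> d h ks j =
     (if j = 0 then
        inverse (1 - real M * \<rho> powr (2 * d)) *
          (\<Sum>m\<in>{1..M}. \<rho> powr (2 * d) * (Hd s \<Gamma> d ks)\<^sup>2 * ln \<rho>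
             + (\<Sum>m'\<in>{1..M} - {m}. Q_bary M s \<Gamma> d h (ks @ [m]) (ks @ [m']) (Phi_log_pow 0)))
      else
        inverse (1 - real M * \<rho> powr (2 * d - 1)) *
          (\<Sum>m\<in>{1..M}. \<Sum>m'\<in>{1..M} - {m}.
             Q_bary M s \<Gamma> d h (ks @ [m]) (ks @ [m']) (Phi_log_pow 1)))"

definition Q_diag :: "nat \<Rightarrow> real \<Rightarrow> (nat \<Rightarrow> real^'n \<Rightarrow> real^'n) \<Rightarrow> (real^'n) set \<Rightarrow> real \<Rightarrow> real
    \<Rightarrow> real \<Rightarrow> nat list \<Rightarrow> complex" where
  "Q_diag M \<rho> s \<Gamma> d k h ks =
     complex_of_real (C_coeff CARD('n) * Q_sing M \<rho> s \<Gamma> d h ks (CARD('n) - 1))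
       + Q_bary M s \<Gamma> d h ks ks (Phi_star k)"

definition Q_subtraction :: "nat \<Rightarrow> real \<Rightarrow> (nat \<Rightarrow> real^'n \<Rightarrow> real^'n) \<Rightarrow> (real^'n) set \<Rightarrow> real \<Rightarrow> real
    \<Rightarrow> real \<Rightarrow> real \<Rightarrow> complex" where
  "Q_subtraction M \<rho> s \<Gamma> d k c_osc h =
     (if k * diameter \<Gamma> \<le> c_osc then Q_diag M \<rho> s \<Gamma> d k h []
      else (let L = L_index M s \<Gamma> (c_osc / k) [] in
        (\<Sum>m\<in>L. Q_diag M \<rho> s \<Gamma> d k h m)
          + (\<Sum>m\<in>L. \<Sum>m'\<in>L - {m}. Q_bary M s \<Gamma> d h m m' (Phi k))))"

section \<open>Constants of the error bound\<close>

text \<open>The two expressions for \<open>c'\<close>, in terms of \<open>\<rho>\<close> and of \<open>M\<close> and \<open>d\<close>; \<open>kD = k diam \<Gamma>\<close>.\<close>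

definition c_rho :: "nat \<Rightarrow> nat \<Rightarrow> real \<Rightarrow> real \<Rightarrow> real \<Rightarrow> real \<Rightarrow> real \<Rightarrow> real" where
  "c_rho n M \<rho> d R kD c_osc =
     (if kD \<le> c_osc then
        (\<rho> * M / (\<rho> * M - 1)) ^ (n - 1) / (\<rho> ^ (n + 1) * R ^ (n + 1))
      else
        (1 + (\<rho> * M / (\<rho> * M - 1)) ^ (n - 1) / (\<rho> ^ (n + 1) * kD powr d)) * (kD / R) ^ (n + 1))"

definition c_M :: "nat \<Rightarrow> nat \<Rightarrow> real \<Rightarrow> real \<Rightarrow> real \<Rightarrow> real \<Rightarrow> real" where
  "c_M n M d R kD c_osc =
     (if kD \<le> c_osc then
        real M powr ((real n + 1) / d) / ((1 - real M powr (1 / d - 1)) ^ (n - 1) * R ^ (n + 1))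
      else
        (1 + real M powr ((real n + 1) / d) / ((1 - real M powr (1 / d - 1)) ^ (n - 1) * kD powr d))
          * (kD / R) ^ (n + 1))"

end

theory Submission
  imports Defs
begin

text \<open>
  Write \<open>H\<close> for the Hausdorff measure of \<open>\<Gamma>\<close> and \<open>D\<close> for its diameter.  The words of length \<open>l\<close> cut
  \<open>\<Gamma>\<close> into \<open>M^l\<close> disjoint cells; each is a copy of \<open>\<Gamma>\<close> scaled by \<open>\<rho>^l\<close> and carries the mass \<open>H / M^l\<close>.
  Two cells whose words agree in exactly the first \<open>j\<close> letters have convex hulls at distance at
  least \<open>\<rho>^j R\<close>.  Because all contraction factors agree, the index set of a rule consists of all
  words of one length, so every rule is a plain double sum over equally deep cells.

  Separated cells: the linear Taylor term of the kernel integrates to zero when the expansion is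
  centred at the barycentres, and the barycentres lie in the convex hulls.  Sampling there costs a
  multiple of \<open>h^2\<close> times the masses times a bound for the second derivatives between the hulls
  (\<open>cell_pair_error\<close>).  For a radial kernel \<open>g(|z|)\<close> these are controlled by \<open>|g''| + |g'|/r\<close>
  (\<open>radial_taylor\<close>).

  Singular part: applying one map of the system to both arguments of \<open>log |x - y|\<close> or
  \<open>1/|x - y|\<close> changes the kernel affinely.  Hence the double integral over a cell equals an explicit
  affine function of itself plus integrals over pairs of different subcells.  The rule for this
  kernel solves the same linear equation with the pair integrals replaced by barycentre sums, so it
  inherits the error bound for separated cells (\<open>singular_rule_error\<close>).

  Regular part: the second derivatives of \<open>\<Phi> - C \<Phi>\<^sub>0\<close> and \<open>\<Phi> - C \<Phi>\<^sub>1\<close> still blow up on the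
  diagonal, like \<open>k^2 log\<close> and \<open>k^2/r\<close>.  Splitting the diagonal cells recursively
  (\<open>diagonal_error\<close>) gives the bound at distance \<open>\<rho>^j R\<close> the weight \<open>M^-j\<close>, and the resulting
  series converge; the last diagonal cells are handled by the modulus of continuity.

  If \<open>k D\<close> exceeds \<open>c_osc\<close>, these estimates are used on the cells of diameter about \<open>c_osc/k\<close>, whose
  squared masses add up to \<open>M^-l H^2\<close> with \<open>M^-l\<close> of order \<open>(k D)^-d\<close>.  Different such cells are at
  distance at least a constant times \<open>R/(k D)\<close>, where the Helmholtz kernel has second derivatives
  of order \<open>(k D/R)^(n+1)\<close> (\<open>total_error\<close>).  In dimension one this needs a bound for the second
  derivative of the Hankel function at all arguments; it comes from the energy \<open>y^2 + y'^2\<close>, which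
  decreases along solutions of Bessel's equation (\<open>bessel_energy_bound\<close>).

  The two forms of the constant \<open>c'\<close> agree because the dimension \<open>d\<close> satisfies \<open>M \<rho>^d = 1\<close>, which
  is the mass distribution argument of \<open>hausdorff_dim_attractor\<close>.
\<close>

section \<open>Hausdorff measure under similarities\<close>

lemma diameter_similarity_image:
  fixes f :: "'a::metric_space \<Rightarrow> 'b::metric_space"
  assumes f: "\<And>x y. dist (f x) (f y) = c * dist x y" and c: "c > 0" and "bounded U"
  shows "diameter (f ` U) = c * diameter U" "bounded (f ` U)"
proof -
  show b: "bounded (f ` U)"
  proof -
    obtain x e where "\<forall>y\<in>U. dist x y \<le> e" using \<open>bounded U\<close> unfolding bounded_def by blast
    then have "\<forall>y\<in>f ` U. dist (f x) y \<le> c * e" using c f by auto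
    then show ?thesis unfolding bounded_def by blast
  qed
  show "diameter (f ` U) = c * diameter U"
  proof (cases "U = {}")
    case False
    show ?thesis
    proof (rule antisym)
      show "diameter (f ` U) \<le> c * diameter U"
        unfolding diameter_def using False
        apply (simp add: case_prod_unfold)
        apply (rule cSUP_least)
        using f c diameter_bounded_bound[OF \<open>bounded U\<close>] diameter_def[of U] apply (auto simp: case_prod_unfold)
        done
      have "diameter U \<le> diameter (f ` U) / c"
      proof -
        have "dist x y \<le> diameter (f ` U) / c" if "x \<in> U" "y \<in> U" for x y
          using diameter_bounded_bound[OF b, of "f x" "f y"] that f[of x y] c by (simp add: field_simps)
        then show ?thesis
          unfolding diameter_def[of U] using False
          by (simp add: case_prod_unfold) (rule cSUP_least, auto)
      qed
      then show "c * diameter U \<le> diameter (f ` U)" using c by (simp add: field_simps)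
    qed
  qed simp
qed

text \<open>
  Images of the sets of a cover form a cover of the image, and their diameters scale by the
  factor of the similarity.
\<close>

lemma hausdorff_outer_similarity_image_le:
  fixes f :: "'a::metric_space \<Rightarrow> 'b::metric_space"
  assumes f: "\<And>x y. dist (f x) (f y) = c * dist x y" and c: "c > 0"
  shows "hausdorff_outer s (f ` E) \<le> ennreal (c powr s) * hausdorff_outer s E"
proof -
  have step: "hausdorff_delta s (c * \<delta>) (f ` E) \<le> ennreal (c powr s) * hausdorff_delta s \<delta> E" for \<delta>
  proof -
    have "ennreal (c powr - s) * hausdorff_delta s (c * \<delta>) (f ` E) \<le> hausdorff_delta s \<delta> E"
      unfolding hausdorff_delta_def[of s \<delta>]
    proof (rule INF_greatest)
      fix U :: "nat \<Rightarrow> 'a set"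
      assume "U \<in> {U. E \<subseteq> (\<Union>i. U i) \<and> (\<forall>i. bounded (U i) \<and> diameter (U i) \<le> \<delta>)}"
      then have U: "E \<subseteq> (\<Union>i. U i)" "\<And>i. bounded (U i)" "\<And>i. diameter (U i) \<le> \<delta>" by auto
      note d = diameter_similarity_image[OF f c U(2)]
      have "hausdorff_delta s (c * \<delta>) (f ` E) \<le> (\<Sum>i. ennreal (diameter (f ` U i) powr s))"
        unfolding hausdorff_delta_def by (rule INF_lower) (use U d c in \<open>fastforce\<close>)
      also have "\<dots> = ennreal (c powr s) * (\<Sum>i. ennreal (diameter (U i) powr s))"
        using c U(2) by (simp add: d powr_mult diameter_ge_0 ennreal_mult)
      finally have "ennreal (c powr - s) * hausdorff_delta s (c * \<delta>) (f ` E)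
          \<le> ennreal (c powr - s) * (ennreal (c powr s) * (\<Sum>i. ennreal (diameter (U i) powr s)))"
        by (rule mult_left_mono) simp
      also have "\<dots> = (\<Sum>i. ennreal (diameter (U i) powr s))"
        using c by (simp add: mult.assoc[symmetric] ennreal_mult[symmetric] powr_minus)
      finally show "ennreal (c powr - s) * hausdorff_delta s (c * \<delta>) (f ` E)
          \<le> (\<Sum>i. ennreal (diameter (U i) powr s))" .
    qed
    then have "ennreal (c powr s) * (ennreal (c powr - s) * hausdorff_delta s (c * \<delta>) (f ` E))
        \<le> ennreal (c powr s) * hausdorff_delta s \<delta> E"
      by (rule mult_left_mono) simp
    then show ?thesis
      using c by (simp add: mult.assoc[symmetric] ennreal_mult[symmetric] powr_minus)
  qed
  show ?thesis
    unfolding hausdorff_outer_eq_SUP[of s "f ` E"]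
  proof (rule SUP_least)
    fix \<delta> :: real assume "\<delta> \<in> {0<..}"
    then have "0 < \<delta> / c" using c by simp
    have "hausdorff_delta s \<delta> (f ` E) \<le> ennreal (c powr s) * hausdorff_delta s (\<delta> / c) E"
      using step[of "\<delta> / c"] c by simp
    also have "\<dots> \<le> ennreal (c powr s) * hausdorff_outer s E"
      unfolding hausdorff_outer_eq_SUP using \<open>0 < \<delta> / c\<close>
      by (intro mult_left_mono SUP_upper) auto
    finally show "hausdorff_delta s \<delta> (f ` E) \<le> ennreal (c powr s) * hausdorff_outer s E" .
  qed
qed

lemma hausdorff_outer_similarity_image:
  fixes f :: "'a::metric_space \<Rightarrow> 'a"
  assumes f: "\<And>x y. dist (f x) (f y) = c * dist x y" and c: "c > 0" and "bij f"
  shows "hausdorff_outer s (f ` E) = ennreal (c powr s) * hausdorff_outer s E"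
proof (rule antisym)
  show "hausdorff_outer s (f ` E) \<le> ennreal (c powr s) * hausdorff_outer s E"
    by (rule hausdorff_outer_similarity_image_le[OF f c])
  have i: "dist (inv f x) (inv f y) = (1 / c) * dist x y" for x y
    using f[of "inv f x" "inv f y"] \<open>bij f\<close> c by (simp add: bij_is_surj surj_f_inv_f)
  have "inv f ` f ` E = E" using \<open>bij f\<close> by (simp add: bij_is_inj image_comp)
  then have "hausdorff_outer s E \<le> ennreal ((1 / c) powr s) * hausdorff_outer s (f ` E)"
    using hausdorff_outer_similarity_image_le[of "inv f" "1 / c" s "f ` E"] i c by simp
  then have "ennreal (c powr s) * hausdorff_outer s E
      \<le> ennreal (c powr s) * (ennreal ((1 / c) powr s) * hausdorff_outer s (f ` E))"
    by (rule mult_left_mono) simp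
  also have "\<dots> = hausdorff_outer s (f ` E)"
    using c by (simp add: mult.assoc[symmetric] ennreal_mult[symmetric] powr_divide)
  finally show "ennreal (c powr s) * hausdorff_outer s E \<le> hausdorff_outer s (f ` E)" .
qed

text \<open>
  A finite cover becomes a sequence by padding with empty sets, which contribute \<open>0 powr s
  = 0\<close>.
\<close>

lemma hausdorff_delta_le_finite_cover:
  fixes V :: "'i \<Rightarrow> 'a::metric_space set"
  assumes "finite I" "E \<subseteq> (\<Union>i\<in>I. V i)" "\<And>i. i \<in> I \<Longrightarrow> bounded (V i)"
    "\<And>i. i \<in> I \<Longrightarrow> diameter (V i) \<le> \<delta>" "0 \<le> \<delta>"
  shows "hausdorff_delta s \<delta> E \<le> (\<Sum>i\<in>I. ennreal (diameter (V i) powr s))"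
proof -
  obtain e where e: "bij_betw e {0..<card I} I"
    using ex_bij_betw_nat_finite[OF \<open>finite I\<close>] by blast
  define U where "U n = (if n < card I then V (e n) else {})" for n
  have "hausdorff_delta s \<delta> E \<le> (\<Sum>n. ennreal (diameter (U n) powr s))"
    unfolding hausdorff_delta_def
  proof (rule INF_lower, safe)
    fix x assume "x \<in> E"
    then obtain i where "i \<in> I" "x \<in> V i" using assms(2) by blast
    moreover have "i \<in> e ` {0..<card I}" using e \<open>i \<in> I\<close> unfolding bij_betw_def by simp
    ultimately obtain n where "n < card I" "e n = i" by auto
    then have "x \<in> U n" using \<open>x \<in> V i\<close> by (simp add: U_def)
    then show "x \<in> (\<Union>n. U n)" by blast
  next
    fix n
    have "n < card I \<Longrightarrow> e n \<in> I" using e unfolding bij_betw_def by auto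
    then show "bounded (U n)" "diameter (U n) \<le> \<delta>" using assms by (auto simp: U_def)
  qed
  also have "\<dots> = (\<Sum>n\<in>{0..<card I}. ennreal (diameter (U n) powr s))"
    by (rule suminf_finite) (auto simp: U_def)
  also have "\<dots> = (\<Sum>n\<in>{0..<card I}. ennreal (diameter (V (e n)) powr s))"
    by (rule sum.cong) (auto simp: U_def)
  also have "\<dots> = (\<Sum>i\<in>I. ennreal (diameter (V i) powr s))"
    by (rule sum.reindex_bij_betw[OF e])
  finally show ?thesis .
qed

lemma hausdorff_outer_singleton: "hausdorff_outer s {x} = 0"
proof -
  have "hausdorff_delta s \<delta> {x} = 0" if "\<delta> > 0" for \<delta>
    using hausdorff_delta_le_finite_cover[of "{()}" "{x}" "\<lambda>_. {x}" \<delta> s] that by simp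
  then show ?thesis unfolding hausdorff_outer_eq_SUP by (simp add: SUP_eq_iff)
qed

lemma sets_hausdorff_measure [simp, measurable_cong]: "sets (hausdorff_measure s) = sets borel"
  and space_hausdorff_measure [simp]: "space (hausdorff_measure s) = UNIV"
  using sets.sigma_sets_eq[of "borel :: 'a::metric_space measure"]
  by (simp_all add: hausdorff_measure_def sets_measure_of_conv space_measure_of_conv)

text \<open>
  The measure is read off from the definition of \<^const>\<open>measure_of\<close>, which is
  the null measure unless the outer measure is countably additive on the Borel sets.  Scaling,
  finiteness on the attractor and vanishing on points pass from the outer measure to both
  alternatives, and these three properties carry all later integrals.
\<close>

lemma emeasure_hausdorff_measure:
  fixes A :: "'a::metric_space set"
  assumes "A \<in> sets borel"
  shows "emeasure (hausdorff_measure s) A =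
    (if measure_space UNIV (sets (borel :: 'a measure)) (hausdorff_outer s)
     then hausdorff_outer s A else 0)"
  using sets.sigma_sets_eq[of "borel :: 'a measure"] assms
  by (simp add: hausdorff_measure_def emeasure_measure_of_conv)

section \<open>Words and cells of a hull-disjoint attractor\<close>

lemma bij_scaled_isometry:
  fixes f :: "'a::euclidean_space \<Rightarrow> 'a"
  assumes "linear f" "\<And>x. norm (f x) = c * norm x" "c > 0"
  shows "bij (\<lambda>x. f x + b)"
proof -
  have "inj f" using assms by (intro linear_injective_0[THEN iffD2]) (auto, metis mult_eq_0_iff norm_eq_zero norm_zero order_less_irrefl)
  then have "bij f" using assms(1) linear_inj_imp_surj by (auto simp: bij_def)
  then have "bij ((\<lambda>x. x + b) \<circ> f)" by (rule bij_comp) (rule bij_betw_byWitness[where f' = "\<lambda>x. x - b"], auto)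
  then show ?thesis by (simp add: o_def)
qed

text \<open>
  Homogeneous systems, with the affine structure of the maps kept (it makes them commute with
  convex hulls) and hull-disjointness stated pointwise.
\<close>

locale hull_disjoint_ifs =
  fixes M :: nat and s :: "nat \<Rightarrow> 'a::euclidean_space \<Rightarrow> 'a" and \<Gamma> :: "'a set" and \<rho> R :: real
  assumes M_ge_2: "2 \<le> M" and rho_pos: "0 < \<rho>" and rho_less_1: "\<rho> < 1"
    and similarity: "m \<in> {1..M} \<Longrightarrow>
      \<exists>f b. linear f \<and> (\<forall>x. norm (f x) = \<rho> * norm x) \<and> s m = (\<lambda>x. f x + b)"
    and attractor: "is_attractor M s \<Gamma>"
    and R_pos: "R > 0"
    and separated: "\<lbrakk>m \<in> {1..M}; m' \<in> {1..M}; m \<noteq> m'; x \<in> convex hull \<Gamma>; y \<in> convex hull \<Gamma>\<rbrakk>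
      \<Longrightarrow> R \<le> dist (s m x) (s m' y)"
begin

definition words :: "nat \<Rightarrow> nat list set" where
  "words l = {w. set w \<subseteq> {1..M} \<and> length w = l}"

text \<open>
  Words are read from the left, so the first letter is the outermost map.
\<close>

definition word_map :: "nat list \<Rightarrow> 'a \<Rightarrow> 'a" where
  "word_map w = foldr (\<lambda>m g. s m \<circ> g) w id"

abbreviation D :: real where "D \<equiv> diameter \<Gamma>"

lemma M_pos: "0 < M" "1 \<le> M" and real_M: "2 \<le> real M" "0 < real M" "1 < real M"
  using M_ge_2 by auto

lemma compact_attractor: "compact \<Gamma>" "\<Gamma> \<noteq> {}" "bounded \<Gamma>" "closed \<Gamma>"
  and attractor_eq: "\<Gamma> = (\<Union>m\<in>{1..M}. s m ` \<Gamma>)"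
  using attractor by (auto simp: is_attractor_def compact_imp_bounded compact_imp_closed)

lemma word_map_Nil [simp]: "word_map [] = id"
  and word_map_Cons: "word_map (m # w) = s m \<circ> word_map w"
  by (simp_all add: word_map_def)

lemma word_map_append: "word_map (v @ w) = word_map v \<circ> word_map w"
  by (induction v) (simp_all add: word_map_Cons o_assoc)

lemma word_map_single: "word_map [m] = s m"
  by (simp add: word_map_Cons)

lemma sub_attractor_eq: "sub_attractor s \<Gamma> w = word_map w ` \<Gamma>"
  by (simp add: sub_attractor_def word_map_def)

lemma word_map_affine:
  assumes "set w \<subseteq> {1..M}"
  shows "\<exists>f b. linear f \<and> (\<forall>x. norm (f x) = \<rho> ^ length w * norm x) \<and> word_map w = (\<lambda>x. f x + b)"
  using assms
proof (induction w)
  case Nil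
  show ?case by (rule exI[of _ id], rule exI[of _ 0]) (auto simp: id_def linear_id[unfolded id_def])
next
  case (Cons m w)
  then obtain f b where f: "linear f" "\<And>x. norm (f x) = \<rho> ^ length w * norm x"
    "word_map w = (\<lambda>x. f x + b)" by auto
  obtain g c where g: "linear g" "\<And>x. norm (g x) = \<rho> * norm x" "s m = (\<lambda>x. g x + c)"
    using similarity[of m] Cons.prems by auto
  have "word_map (m # w) = (\<lambda>x. (g \<circ> f) x + (g b + c))"
    using g(1) by (simp add: word_map_Cons f(3) g(3) o_def linear_add add.assoc)
  moreover have "linear (g \<circ> f)" using f(1) g(1) by (rule linear_compose)
  ultimately show ?case using f(2) g(2) by (intro exI[of _ "g \<circ> f"] exI[of _ "g b + c"]) (simp add: o_def)
qed

lemma dist_word_map: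
  assumes "set w \<subseteq> {1..M}"
  shows "dist (word_map w x) (word_map w y) = \<rho> ^ length w * dist x y"
proof -
  obtain f b where f: "linear f" "\<And>x. norm (f x) = \<rho> ^ length w * norm x"
    "word_map w = (\<lambda>x. f x + b)" using word_map_affine[OF assms] by blast
  have "f x - f y = f (x - y)" using f(1) by (simp add: linear_diff)
  then show ?thesis using f(2) by (simp add: f(3) dist_norm)
qed

lemma bij_word_map: assumes "set w \<subseteq> {1..M}" shows "bij (word_map w)"
proof -
  obtain f b where f: "linear f" "\<And>x. norm (f x) = \<rho> ^ length w * norm x"
    "word_map w = (\<lambda>x. f x + b)" using word_map_affine[OF assms] by blast
  show ?thesis unfolding f(3) using f rho_pos
    by (intro bij_scaled_isometry[where c = "\<rho> ^ length w"]) auto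
qed

lemma continuous_word_map: assumes "set w \<subseteq> {1..M}" shows "continuous_on A (word_map w)"
proof -
  obtain f b where f: "linear f" "word_map w = (\<lambda>x. f x + b)"
    using word_map_affine[OF assms] by blast
  show ?thesis unfolding f(2)
    by (intro continuous_intros linear_continuous_on linear_linear[THEN iffD2] f(1))
qed

lemma convex_hull_word_map:
  assumes "set w \<subseteq> {1..M}"
  shows "convex hull (word_map w ` A) = word_map w ` (convex hull A)"
proof -
  obtain f b where f: "linear f" "word_map w = (\<lambda>x. f x + b)"
    using word_map_affine[OF assms] by blast
  have *: "(\<lambda>x. f x + b) ` B = (\<lambda>x. b + x) ` f ` B" for B by (auto simp: add.commute)
  show ?thesis
    unfolding f(2) * convex_hull_translation by (simp add: convex_hull_linear_image f(1))
qed

lemma finite_words [simp]: "finite (words l)" and card_words: "card (words l) = M ^ l"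
  using finite_lists_length_eq[of "{1..M}" l] card_lists_length_eq[of "{1..M}" l]
  by (auto simp: words_def)

lemma words_0 [simp]: "words 0 = {[]}" by (auto simp: words_def)

lemma word_map_image_Suc:
  assumes "set w \<subseteq> {1..M}"
  shows "word_map w ` \<Gamma> = (\<Union>m\<in>{1..M}. word_map (w @ [m]) ` \<Gamma>)"
proof -
  have "word_map w ` \<Gamma> = word_map w ` (\<Union>m\<in>{1..M}. s m ` \<Gamma>)" using attractor_eq by simp
  also have "\<dots> = (\<Union>m\<in>{1..M}. word_map (w @ [m]) ` \<Gamma>)"
    by (simp add: image_UN image_image word_map_append word_map_single)
  finally show ?thesis .
qed

lemma attractor_words:
  shows "\<Gamma> = (\<Union>u\<in>words l. word_map u ` \<Gamma>)"
proof (induction l)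
  case (Suc l)
  have "(\<Union>u\<in>words (Suc l). word_map u ` \<Gamma>) = (\<Union>u\<in>words l. \<Union>m\<in>{1..M}. word_map (u @ [m]) ` \<Gamma>)"
  proof -
    have "words (Suc l) = (\<Union>u\<in>words l. \<Union>m\<in>{1..M}. {u @ [m]})"
      unfolding words_def 
      by (auto simp: length_Suc_conv_rev)
    then show ?thesis by simp
  qed
  also have "\<dots> = (\<Union>u\<in>words l. word_map u ` \<Gamma>)"
    by (intro SUP_cong refl) (auto simp: words_def word_map_image_Suc simp del: UN_simps)
  finally show ?case using Suc by simp
qed simp

lemma word_map_attractor_subset:
  assumes "set u \<subseteq> {1..M}" shows "word_map u ` \<Gamma> \<subseteq> \<Gamma>"
  using attractor_words[of "length u"] assms by (auto simp: words_def)

lemma word_map_image_words: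
  "word_map w ` \<Gamma> = (\<Union>u\<in>words l. word_map (w @ u) ` \<Gamma>)"
proof -
  have "word_map w ` \<Gamma> = word_map w ` (\<Union>u\<in>words l. word_map u ` \<Gamma>)" using attractor_words[of l] by simp
  also have "\<dots> = (\<Union>u\<in>words l. word_map (w @ u) ` \<Gamma>)"
    by (simp add: image_UN image_image word_map_append)
  finally show ?thesis .
qed

lemma word_map_append_hull_subset:
  assumes "set w \<subseteq> {1..M}" "set u \<subseteq> {1..M}"
  shows "word_map (w @ u) ` (convex hull \<Gamma>) \<subseteq> word_map w ` (convex hull \<Gamma>)"
proof -
  have "word_map u ` (convex hull \<Gamma>) \<subseteq> convex hull \<Gamma>"
    using convex_hull_word_map[OF assms(2)] word_map_attractor_subset[OF assms(2)] hull_mono by metis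
  then show ?thesis by (auto simp: word_map_append)
qed

text \<open>
  Both points lie in the images, under the map of the common prefix, of two hulls with different
  first letters; that map scales distances by \<open>\<rho> ^ length w\<close>.
\<close>

lemma hull_dist_ge:
  assumes w: "set w \<subseteq> {1..M}" and m: "m \<in> {1..M}" "m' \<in> {1..M}" "m \<noteq> m'"
    and u: "set u \<subseteq> {1..M}" "set u' \<subseteq> {1..M}"
    and x: "x \<in> word_map (w @ m # u) ` (convex hull \<Gamma>)"
    and y: "y \<in> word_map (w @ m' # u') ` (convex hull \<Gamma>)"
  shows "\<rho> ^ length w * R \<le> dist x y"
proof -
  have "x \<in> word_map (w @ [m]) ` (convex hull \<Gamma>)"
    using x word_map_append_hull_subset[of "w @ [m]" u] w m u by auto
  then obtain x' where x': "x = word_map w (s m x')" "x' \<in> convex hull \<Gamma>"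
    by (auto simp: word_map_append word_map_single)
  have "y \<in> word_map (w @ [m']) ` (convex hull \<Gamma>)"
    using y word_map_append_hull_subset[of "w @ [m']" u'] w m u by auto
  then obtain y' where y': "y = word_map w (s m' y')" "y' \<in> convex hull \<Gamma>"
    by (auto simp: word_map_append word_map_single)
  show ?thesis unfolding x'(1) y'(1) dist_word_map[OF w]
    using separated[OF m x'(2) y'(2)] rho_pos by (intro mult_left_mono) auto
qed

lemma hull_dist_ge_same_length:
  assumes u: "u \<in> words l" "v \<in> words l" "u \<noteq> v"
    and x: "x \<in> word_map u ` (convex hull \<Gamma>)" and y: "y \<in> word_map v ` (convex hull \<Gamma>)"
  shows "\<rho> ^ (l - 1) * R \<le> dist x y"
proof -
  obtain w m u' m' v' where *: "m \<noteq> m'" "u = w @ m # u'" "v = w @ m' # v'"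
    using same_length_different[of u v] u unfolding words_def by fastforce
  have "\<rho> ^ length w * R \<le> dist x y"
    using hull_dist_ge[of w m m' u' v' x y] * u x y by (auto simp: words_def)
  moreover have "\<rho> ^ (l - 1) * R \<le> \<rho> ^ length w * R"
    using * u rho_pos rho_less_1 R_pos by (intro mult_right_mono power_decreasing) (auto simp: words_def)
  ultimately show ?thesis by simp
qed

lemma word_map_hull_superset: "x \<in> word_map w ` \<Gamma> \<Longrightarrow> x \<in> word_map w ` (convex hull \<Gamma>)"
  using hull_subset[of \<Gamma> convex] by auto

lemma diameter_word_map:
  assumes "set w \<subseteq> {1..M}"
  shows "diameter (word_map w ` \<Gamma>) = \<rho> ^ length w * D"
  using diameter_similarity_image(1)[of "word_map w" "\<rho> ^ length w" \<Gamma>] dist_word_map[OF assms]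
    compact_attractor rho_pos by auto

lemma R_le_D: "R \<le> D" and D_pos: "D > 0"
proof -
  obtain x where x: "x \<in> \<Gamma>" using compact_attractor by auto
  have "R \<le> dist (s 1 x) (s 2 x)"
    using M_ge_2 x hull_subset[of \<Gamma> convex] by (intro separated) auto
  also have "\<dots> \<le> D"
    using word_map_attractor_subset[of "[1]"] word_map_attractor_subset[of "[2]"] x M_ge_2
    by (intro diameter_bounded_bound compact_attractor) (auto simp: word_map_single)
  finally show "R \<le> D" .
  then show "D > 0" using R_pos by simp
qed

text \<open>
  The depth at which cells first have diameter at most \<open>h\<close>.
\<close>

definition level :: "real \<Rightarrow> nat" where
  "level h = (LEAST N. \<rho> ^ N * D \<le> h)"

lemma level: assumes "h > 0" shows "\<rho> ^ level h * D \<le> h"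
proof -
  obtain N where "\<rho> ^ N < h / D"
    using real_arch_pow_inv[of "h / D" \<rho>] assms D_pos rho_less_1 by auto
  then have "\<rho> ^ N * D \<le> h" using D_pos by (simp add: field_simps)
  then show ?thesis unfolding level_def by (rule LeastI)
qed

lemma level_le_iff: assumes "h > 0" shows "level h \<le> N \<longleftrightarrow> \<rho> ^ N * D \<le> h"
proof
  assume "level h \<le> N"
  then have "\<rho> ^ N * D \<le> \<rho> ^ level h * D"
    using rho_pos rho_less_1 D_pos by (intro mult_right_mono power_decreasing) auto
  then show "\<rho> ^ N * D \<le> h" using level[OF assms] by simp
next
  show "\<rho> ^ N * D \<le> h \<Longrightarrow> level h \<le> N" unfolding level_def by (rule Least_le)
qed

text \<open>
  The diameter of a cell depends only on the length of its word, so the stopping rule stops all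
  words at the same length.  Natural subtraction yields length 0, hence the empty word, for a
  cell that is already small enough.
\<close>

lemma L_index_eq_words:
  assumes h: "h > 0" and w: "set w \<subseteq> {1..M}"
  shows "L_index M s \<Gamma> h w = words (level h - length w)"
proof (cases "h < diameter (sub_attractor s \<Gamma> w)")
  case False
  then have "level h \<le> length w"
    using level_le_iff[OF h] w by (simp add: sub_attractor_eq diameter_word_map)
  then show ?thesis using False by (simp add: L_index_def)
next
  case True
  then have lt: "length w < level h"
    using level_le_iff[OF h, of "length w"] w by (simp add: sub_attractor_eq diameter_word_map)
  have "ns \<noteq> [] \<and> set ns \<subseteq> {1..M} \<and> diameter (sub_attractor s \<Gamma> (w @ ns)) \<le> h \<and>
      diameter (sub_attractor s \<Gamma> (w @ butlast ns)) > h \<longleftrightarrow> ns \<in> words (level h - length w)" for ns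
  proof (cases "set ns \<subseteq> {1..M} \<and> ns \<noteq> []")
    case T: True
    have b: "set (butlast ns) \<subseteq> {1..M}" using T in_set_butlastD by fastforce
    have "diameter (sub_attractor s \<Gamma> (w @ ns)) \<le> h \<longleftrightarrow> level h \<le> length w + length ns"
      using T w by (simp add: sub_attractor_eq diameter_word_map level_le_iff[OF h])
    moreover have "diameter (sub_attractor s \<Gamma> (w @ butlast ns)) > h \<longleftrightarrow>
        \<not> level h \<le> length w + (length ns - 1)"
      using b w by (simp add: sub_attractor_eq diameter_word_map level_le_iff[OF h] not_le)
    moreover have "length ns > 0" using T by simp
    ultimately show ?thesis using T lt by (auto simp: words_def)
  qed (use lt in \<open>auto simp: words_def\<close>)
  then show ?thesis using True unfolding L_index_def by simp
qed

end

section \<open>Dimension of the attractor\<close>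

lemma power_powr:
  fixes x :: real assumes "x > 0" shows "(x ^ n) powr t = (x powr t) ^ n"
  using assms by (induction n) (simp_all add: powr_mult)

context hull_disjoint_ifs
begin

text \<open>
  The solution of \<open>M \<rho>^s = 1\<close>.
\<close>

definition sim_dim :: real where
  "sim_dim = ln (real M) / ln (1 / \<rho>)"

lemma sim_dim_pos: "sim_dim > 0" and M_rho_sim_dim: "real M * \<rho> powr sim_dim = 1"
proof -
  have l: "ln (1 / \<rho>) > 0" "ln (real M) > 0" using rho_pos rho_less_1 real_M by auto
  then show "sim_dim > 0" by (simp add: sim_dim_def)
  have "ln \<rho> \<noteq> 0" "ln (1 / \<rho>) = - ln \<rho>" using rho_pos rho_less_1 by (simp_all add: ln_div)
  then have "sim_dim * ln \<rho> = - ln (real M)" by (simp add: sim_dim_def)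
  then have "\<rho> powr sim_dim = exp (- ln (real M))"
    unfolding powr_def using rho_pos by simp
  then show "real M * \<rho> powr sim_dim = 1" using M_pos by (simp add: exp_minus)
qed

lemma rho_powr_sim_dim: "\<rho> powr sim_dim = 1 / real M"
  using M_rho_sim_dim M_pos by (simp add: eq_divide_eq mult.commute)

lemma rho_power_sim_dim: "(\<rho> ^ j) powr sim_dim = 1 / real M ^ j"
  unfolding power_powr[OF rho_pos] rho_powr_sim_dim by (simp add: power_divide)

text \<open>
  Cover by the cells of level \<open>l\<close>.
\<close>

lemma hausdorff_delta_attractor_le:
  assumes "\<rho> ^ l * D \<le> \<delta>"
  shows "hausdorff_delta t \<delta> \<Gamma> \<le> ennreal ((real M * \<rho> powr t) ^ l * D powr t)"
proof -
  have "hausdorff_delta t \<delta> \<Gamma> \<le> (\<Sum>w\<in>words l. ennreal (diameter (word_map w ` \<Gamma>) powr t))"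
  proof (rule hausdorff_delta_le_finite_cover)
    show "\<Gamma> \<subseteq> (\<Union>w\<in>words l. word_map w ` \<Gamma>)" using attractor_words[of l] by auto
    have "0 \<le> \<rho> ^ l * D" using rho_pos D_pos by simp
    then show "0 \<le> \<delta>" using assms by linarith
    fix w assume w: "w \<in> words l"
    then show "diameter (word_map w ` \<Gamma>) \<le> \<delta>"
      using diameter_word_map[of w] assms by (auto simp: words_def)
    show "bounded (word_map w ` \<Gamma>)"
      using w compact_attractor word_map_attractor_subset[of w] bounded_subset by (auto simp: words_def)
  qed simp
  also have "\<dots> = (\<Sum>w\<in>words l. ennreal ((\<rho> ^ l * D) powr t))"
    by (rule sum.cong) (auto simp: words_def diameter_word_map)
  also have "\<dots> = ennreal (real M ^ l * (\<rho> ^ l * D) powr t)"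
    by (simp add: card_words ennreal_mult ennreal_of_nat_eq_real_of_nat)
  also have "real M ^ l * (\<rho> ^ l * D) powr t = (real M * \<rho> powr t) ^ l * D powr t"
    using rho_pos D_pos
    by (simp add: powr_mult power_mult_distrib power_powr)
  finally show ?thesis .
qed

lemma ex_small_cell: assumes "\<delta> > 0" shows "\<exists>l0. \<forall>l\<ge>l0. \<rho> ^ l * D \<le> \<delta>"
  using level_le_iff[OF assms] by blast

lemma hausdorff_outer_attractor_finite: "hausdorff_outer sim_dim \<Gamma> < \<infinity>"
proof -
  have "hausdorff_outer sim_dim \<Gamma> \<le> ennreal (D powr sim_dim)"
    unfolding hausdorff_outer_eq_SUP
  proof (rule SUP_least)
    fix \<delta> :: real assume "\<delta> \<in> {0<..}"
    then obtain l where "\<rho> ^ l * D \<le> \<delta>" using ex_small_cell[of \<delta>] by auto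
    from hausdorff_delta_attractor_le[OF this, of sim_dim]
    show "hausdorff_delta sim_dim \<delta> \<Gamma> \<le> ennreal (D powr sim_dim)" by (simp add: M_rho_sim_dim)
  qed
  then show ?thesis by (rule order.strict_trans1) simp
qed

lemma hausdorff_outer_attractor_zero:
  assumes "t > sim_dim" shows "hausdorff_outer t \<Gamma> = 0"
proof -
  have q: "0 < real M * \<rho> powr t" "real M * \<rho> powr t < 1"
  proof -
    have "\<rho> powr t < \<rho> powr sim_dim" using assms rho_pos rho_less_1
      by (auto simp: powr_def intro!: mult_strict_right_mono_neg)
    then have "real M * \<rho> powr t < real M * \<rho> powr sim_dim"
      using M_pos by (intro mult_strict_left_mono) auto
    then show "real M * \<rho> powr t < 1" by (simp add: M_rho_sim_dim)
  qed (use M_pos rho_pos in auto)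
  have "hausdorff_delta t \<delta> \<Gamma> = 0" if \<delta>: "\<delta> > 0" for \<delta>
  proof -
    obtain l0 where l0: "\<And>l. l \<ge> l0 \<Longrightarrow> \<rho> ^ l * D \<le> \<delta>" using ex_small_cell[OF \<delta>] by auto
    have "(\<lambda>l. ennreal ((real M * \<rho> powr t) ^ l * D powr t)) \<longlonglongrightarrow> ennreal (0 * D powr t)"
      using q by (intro tendsto_ennrealI tendsto_mult tendsto_const LIMSEQ_power_zero) auto
    then have "hausdorff_delta t \<delta> \<Gamma> \<le> ennreal (0 * D powr t)"
      by (rule LIMSEQ_le_const) (use hausdorff_delta_attractor_le l0 in blast)
    then show ?thesis by simp
  qed
  then show ?thesis unfolding hausdorff_outer_eq_SUP by (simp add: SUP_eq_iff)
qed

text \<open>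
  A set of diameter at most \<open>t\<close> meets at most one cell of the first level
  \<open>j\<close> with \<open>\<rho>^j R \<le> t\<close>, because distinct cells of that level
  are more than \<open>t\<close> apart; minimality of \<open>j\<close> gives \<open>\<rho>^(j-1)
  R > t\<close>.
\<close>

lemma small_set_in_cell:
  assumes V: "\<And>x y. x \<in> V \<Longrightarrow> y \<in> V \<Longrightarrow> dist x y \<le> t" and t: "t > 0"
  shows "\<exists>j u. 1 / real M ^ j \<le> (t / R) powr sim_dim \<and>
    (\<forall>w\<in>words j. word_map w ` \<Gamma> \<inter> V \<noteq> {} \<longrightarrow> w = u)"
proof -
  obtain N where "\<rho> ^ N < t / R"
    using real_arch_pow_inv[of "t / R" \<rho>] t R_pos rho_less_1 by auto
  then have N: "\<rho> ^ N * R \<le> t" using R_pos by (simp add: field_simps)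
  define j where "j = (LEAST j. \<rho> ^ j * R \<le> t)"
  have j: "\<rho> ^ j * R \<le> t" unfolding j_def using N by (rule LeastI)
  have "1 / real M ^ j \<le> (t / R) powr sim_dim"
    unfolding rho_power_sim_dim[symmetric]
    using j R_pos rho_pos sim_dim_pos by (intro powr_mono2) (auto simp: field_simps)
  moreover have "w = w'" if w: "w \<in> words j" "w' \<in> words j"
    "word_map w ` \<Gamma> \<inter> V \<noteq> {}" "word_map w' ` \<Gamma> \<inter> V \<noteq> {}" for w w'
  proof (rule ccontr)
    assume ne: "w \<noteq> w'"
    then have "j \<noteq> 0" using w by (auto intro!: notI)
    obtain x y where xy: "x \<in> word_map w ` \<Gamma>" "x \<in> V" "y \<in> word_map w' ` \<Gamma>" "y \<in> V" using w by blast
    have "\<rho> ^ (j - 1) * R \<le> dist x y"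
      by (rule hull_dist_ge_same_length[OF w(1,2) ne word_map_hull_superset word_map_hull_superset])
        (use xy in auto)
    also have "\<dots> \<le> t" using V xy by blast
    finally have "j \<le> j - 1" unfolding j_def by (rule Least_le)
    then show False using \<open>j \<noteq> 0\<close> by simp
  qed
  ultimately show ?thesis by blast
qed

text \<open>
  Counting form of the mass distribution principle: at a level \<open>l\<close> below all
  \<open>j i\<close>, every cell meets some \<open>V i\<close> and then its word extends the
  word of the one cell of level \<open>j i\<close> met by \<open>V i\<close>, so at most
  \<open>M^(l - j i)\<close> words are charged to \<open>V i\<close>.
\<close>

lemma finite_cover_bound:
  fixes V :: "'i \<Rightarrow> 'a set"
  assumes I: "finite I" and cover: "\<Gamma> \<subseteq> (\<Union>i\<in>I. V i)"
    and V: "\<And>i x y. \<lbrakk>i \<in> I; x \<in> V i; y \<in> V i\<rbrakk> \<Longrightarrow> dist x y \<le> t i" and t: "\<And>i. i \<in> I \<Longrightarrow> t i > 0"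
  shows "1 \<le> (\<Sum>i\<in>I. (t i / R) powr sim_dim)"
proof -
  have "\<forall>i\<in>I. \<exists>j u. 1 / real M ^ j \<le> (t i / R) powr sim_dim \<and>
    (\<forall>w\<in>words j. word_map w ` \<Gamma> \<inter> V i \<noteq> {} \<longrightarrow> w = u)"
    (is "\<forall>i\<in>I. \<exists>j u. ?P i j u")
  proof
    fix i assume i: "i \<in> I"
    show "\<exists>j u. ?P i j u" by (rule small_set_in_cell[OF V[OF i] t[OF i]])
  qed
  from bchoice[OF this] obtain j where "\<forall>i\<in>I. \<exists>u. ?P i (j i) u" ..
  from bchoice[OF this] obtain u where "\<forall>i\<in>I. ?P i (j i) (u i)" ..
  then have ju: "\<And>i. i \<in> I \<Longrightarrow> 1 / real M ^ j i \<le> (t i / R) powr sim_dim"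
    "\<And>i w. \<lbrakk>i \<in> I; w \<in> words (j i); word_map w ` \<Gamma> \<inter> V i \<noteq> {}\<rbrakk> \<Longrightarrow> w = u i"
    by simp_all
  \<comment> \<open>The inserted 0 only keeps the maximum defined for an empty family.\<close>
  define l where "l = Max (insert 0 (j ` I))"
  have l: "j i \<le> l" if "i \<in> I" for i unfolding l_def using that I by (intro Max_ge) auto
  define X where "X i = (\<lambda>v. u i @ v) ` words (l - j i)" for i
  have "words l \<subseteq> (\<Union>i\<in>I. X i)"
  proof
    fix w assume w: "w \<in> words l"
    then have ws: "set w \<subseteq> {1..M}" by (simp add: words_def)
    obtain x where x: "x \<in> word_map w ` \<Gamma>" using compact_attractor(2) by blast
    then have "x \<in> \<Gamma>" using word_map_attractor_subset[OF ws] by auto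
    then obtain i where i: "i \<in> I" "x \<in> V i" using cover by blast
    have tk: "take (j i) w \<in> words (j i)" "drop (j i) w \<in> words (l - j i)"
      using w l[OF i(1)] set_take_subset[of "j i" w] set_drop_subset[of "j i" w] by (auto simp: words_def)
    have "word_map w ` \<Gamma> = word_map (take (j i) w) ` word_map (drop (j i) w) ` \<Gamma>"
      using word_map_append[of "take (j i) w" "drop (j i) w"] by (simp add: image_comp)
    also have "\<dots> \<subseteq> word_map (take (j i) w) ` \<Gamma>"
      using tk by (intro image_mono word_map_attractor_subset) (simp add: words_def)
    finally have "x \<in> word_map (take (j i) w) ` \<Gamma>" using x by (rule subsetD)
    then have "take (j i) w = u i" using i(2) by (intro ju(2)[OF i(1) tk(1)]) (metis IntI emptyE)
    then have "w = u i @ drop (j i) w" using append_take_drop_id[of "j i" w] by simp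
    then show "w \<in> (\<Union>i\<in>I. X i)" using i(1) tk(2) unfolding X_def by blast
  qed
  then have "card (words l) \<le> card (\<Union>i\<in>I. X i)"
    using I by (intro card_mono) (auto simp: X_def)
  also have "\<dots> \<le> (\<Sum>i\<in>I. card (X i))" by (rule card_UN_le[OF I])
  also have "\<dots> \<le> (\<Sum>i\<in>I. M ^ (l - j i))"
  proof (rule sum_mono)
    fix i
    show "card (X i) \<le> M ^ (l - j i)"
      using card_image_le[OF finite_words, of "\<lambda>v. u i @ v" "l - j i"] by (simp add: X_def card_words)
  qed
  finally have "M ^ l \<le> (\<Sum>i\<in>I. M ^ (l - j i))" by (simp only: card_words)
  then have "real (M ^ l) \<le> real (\<Sum>i\<in>I. M ^ (l - j i))" by (simp only: of_nat_le_iff)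
  also have "\<dots> = real M ^ l * (\<Sum>i\<in>I. 1 / real M ^ j i)"
  proof -
    have "real (M ^ (l - j i)) = real M ^ l * (1 / real M ^ j i)" if "i \<in> I" for i
    proof -
      have "real M ^ l = real M ^ (l - j i) * real M ^ j i"
        using l[OF that] by (simp flip: power_add)
      then show ?thesis using M_pos by simp
    qed
    then have "(\<Sum>i\<in>I. real (M ^ (l - j i))) = (\<Sum>i\<in>I. real M ^ l * (1 / real M ^ j i))"
      by (intro sum.cong refl)
    then show ?thesis by (simp only: of_nat_sum sum_distrib_left)
  qed
  finally have "real M ^ l * 1 \<le> real M ^ l * (\<Sum>i\<in>I. 1 / real M ^ j i)" by simp
  then have "1 \<le> (\<Sum>i\<in>I. 1 / real M ^ j i)"
    using M_pos by (simp only: mult_le_cancel_left_pos zero_less_power of_nat_0_less_iff)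
  also have "\<dots> \<le> (\<Sum>i\<in>I. (t i / R) powr sim_dim)" by (intro sum_mono ju)
  finally show ?thesis .
qed

text \<open>
  Compactness reduces a countable cover to a finite one once its sets are enlarged to open sets.
  The enlarged diameters \<open>t i\<close> are chosen so that the sum of their powers grows by
  \<open>\<eta>\<close> only.
\<close>

lemma hausdorff_delta_attractor_ge: "ennreal (R powr sim_dim) \<le> hausdorff_delta sim_dim \<delta> \<Gamma>"
  unfolding hausdorff_delta_def
proof (rule INF_greatest, rule ennreal_le_epsilon)
  fix U :: "nat \<Rightarrow> 'a set" and \<eta> :: real
  assume "U \<in> {U. \<Gamma> \<subseteq> (\<Union>i. U i) \<and> (\<forall>i. bounded (U i) \<and> diameter (U i) \<le> \<delta>)}" and \<eta>: "0 < \<eta>"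
  then have U: "\<Gamma> \<subseteq> (\<Union>i. U i)" "\<And>i. bounded (U i)" by auto
  let ?d = sim_dim
  \<comment> \<open>The powers of \<open>t i\<close> exceed those of the diameters by a summable family of total \<open>\<eta>\<close>, also for sets of diameter 0.\<close>
  define t where "t i = (diameter (U i) powr ?d + \<eta> * (1/2) ^ Suc i) powr (1 / ?d)" for i
  have t_powr: "t i powr ?d = diameter (U i) powr ?d + \<eta> * (1/2) ^ Suc i" for i
    unfolding t_def using \<eta> sim_dim_pos by (simp add: powr_powr add_nonneg_pos)
  have t_gt: "diameter (U i) < t i" for i
  proof -
    have "(diameter (U i) powr ?d) powr (1 / ?d) < t i"
      unfolding t_def using \<eta> sim_dim_pos by (intro powr_less_mono2) auto
    then show ?thesis using sim_dim_pos diameter_ge_0[OF U(2)] by (simp add: powr_powr)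
  qed
  then have t_pos: "t i > 0" for i using diameter_ge_0[OF U(2)] order.strict_trans1 by blast
  define e where "e i = (t i - diameter (U i)) / 2" for i
  have e_pos: "e i > 0" for i using t_gt by (simp add: e_def)
  define V where "V i = (\<Union>x\<in>U i. ball x (e i))" for i
  have V_dist: "dist x y \<le> t i" if xy: "x \<in> V i" "y \<in> V i" for i x y
  proof -
    obtain x' y' where *: "x' \<in> U i" "y' \<in> U i" "dist x' x < e i" "dist y' y < e i"
      using xy by (auto simp: V_def)
    have "dist x y \<le> dist x' x + dist x' y' + dist y' y"
      using dist_triangle[of x y x'] dist_triangle[of x' y y'] by (simp add: dist_commute)
    also have "\<dots> \<le> e i + diameter (U i) + e i"
      using * diameter_bounded_bound[OF U(2) *(1,2)] by simp
    finally show ?thesis by (simp add: e_def)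
  qed
  have "\<Gamma> \<subseteq> (\<Union>i\<in>UNIV. V i)"
  proof
    fix x assume "x \<in> \<Gamma>"
    then obtain i where "x \<in> U i" using U(1) by blast
    then have "x \<in> V i" using e_pos by (auto simp: V_def intro!: bexI[of _ x])
    then show "x \<in> (\<Union>i\<in>UNIV. V i)" by blast
  qed
  moreover have "open (V i)" for i unfolding V_def by (intro open_UN ballI open_ball)
  ultimately obtain I where I: "I \<subseteq> UNIV" "finite I" "\<Gamma> \<subseteq> (\<Union>i\<in>I. V i)"
    by - (rule compactE_image[OF compact_attractor(1), of UNIV V], auto)
  have "1 \<le> (\<Sum>i\<in>I. (t i / R) powr ?d)"
    by (rule finite_cover_bound[OF I(2,3)]) (use V_dist t_pos in auto)
  also have "\<dots> = (\<Sum>i\<in>I. t i powr ?d) / R powr ?d"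
    using t_pos R_pos by (simp add: powr_divide less_imp_le sum_divide_distrib)
  finally have "R powr ?d \<le> (\<Sum>i\<in>I. t i powr ?d)" using R_pos by (simp add: field_simps)
  then have "ennreal (R powr ?d) \<le> ennreal (\<Sum>i\<in>I. t i powr ?d)" by (rule ennreal_leI)
  also have "\<dots> = (\<Sum>i\<in>I. ennreal (t i powr ?d))" by simp
  also have "\<dots> \<le> (\<Sum>i. ennreal (t i powr ?d))"
    by (rule sum_le_suminf) (use I in auto)
  also have "\<dots> = (\<Sum>i. ennreal (diameter (U i) powr ?d) + ennreal (\<eta> * (1/2) ^ Suc i))"
    unfolding t_powr using \<eta> by simp
  also have "\<dots> = (\<Sum>i. ennreal (diameter (U i) powr ?d)) + (\<Sum>i. ennreal (\<eta> * (1/2) ^ Suc i))"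
    by (rule suminf_add[symmetric]) auto
  also have "(\<Sum>i. ennreal (\<eta> * (1/2) ^ Suc i)) = ennreal \<eta>"
    using sums_mult[OF power_half_series, of \<eta>] \<eta> by (intro suminf_ennreal_eq) auto
  finally show "ennreal (R powr ?d) \<le> (\<Sum>i. ennreal (diameter (U i) powr ?d)) + ennreal \<eta>" .
qed

text \<open>
  Above \<open>sim_dim\<close> the outer measure vanishes by the covers with cells.  Up to
  \<open>sim_dim\<close> it is positive, because powers of diameters at most 1 increase when the
  exponent decreases.
\<close>

lemma hausdorff_dim_attractor: "hausdorff_dim \<Gamma> = sim_dim"
proof -
  have pos: "hausdorff_outer t \<Gamma> > 0" if "0 < t" "t \<le> sim_dim" for t
  proof -
    have "ennreal (R powr sim_dim) \<le> hausdorff_delta sim_dim 1 \<Gamma>"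
      by (rule hausdorff_delta_attractor_ge)
    also have "\<dots> \<le> hausdorff_delta t 1 \<Gamma>"
      unfolding hausdorff_delta_def
    proof (rule INF_mono)
      fix U :: "nat \<Rightarrow> 'a set"
      assume U: "U \<in> {U. \<Gamma> \<subseteq> \<Union> (range U) \<and> (\<forall>i. bounded (U i) \<and> diameter (U i) \<le> 1)}"
      have "(\<Sum>i. ennreal (diameter (U i) powr sim_dim)) \<le> (\<Sum>i. ennreal (diameter (U i) powr t))"
        using U that diameter_ge_0 by (intro suminf_le summableI ennreal_leI powr_mono') auto
      then show "\<exists>V\<in>{U. \<Gamma> \<subseteq> \<Union> (range U) \<and> (\<forall>i. bounded (U i) \<and> diameter (U i) \<le> 1)}.
          (\<Sum>i. ennreal (diameter (V i) powr sim_dim)) \<le> (\<Sum>i. ennreal (diameter (U i) powr t))"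
        by (intro bexI[OF _ U])
    qed
    also have "\<dots> \<le> hausdorff_outer t \<Gamma>"
      unfolding hausdorff_outer_eq_SUP by (rule SUP_upper) simp
    finally have "ennreal (R powr sim_dim) \<le> hausdorff_outer t \<Gamma>" .
    moreover have "0 < ennreal (R powr sim_dim)" using R_pos by simp
    ultimately show ?thesis by (rule order.strict_trans2[rotated])
  qed
  have "0 < t \<and> hausdorff_outer t \<Gamma> = 0 \<longleftrightarrow> sim_dim < t" for t
  proof (cases "sim_dim < t")
    case True
    then show ?thesis using hausdorff_outer_attractor_zero[OF True] sim_dim_pos by simp
  next
    case False
    have "\<not> (0 < t \<and> hausdorff_outer t \<Gamma> = 0)"
    proof
      assume *: "0 < t \<and> hausdorff_outer t \<Gamma> = 0"
      have "0 < hausdorff_outer t \<Gamma>" by (rule pos) (use * False in linarith)+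
      with * show False by simp
    qed
    then show ?thesis using False by blast
  qed
  then have "{t. 0 < t \<and> hausdorff_outer t \<Gamma> = 0} = {sim_dim<..}" by auto
  then show ?thesis unfolding hausdorff_dim_def by (simp only: cInf_greaterThan)
qed

end

section \<open>The measure on the attractor and its product\<close>

context hull_disjoint_ifs
begin

abbreviation mu :: "'a measure" where "mu \<equiv> hausdorff_measure sim_dim"

abbreviation H :: real where "H \<equiv> measure mu \<Gamma>"

abbreviation cell :: "nat list \<Rightarrow> 'a set" where "cell w \<equiv> word_map w ` \<Gamma>"

text \<open>
  The Hausdorff measure cut down to the attractor, as a finite measure on the whole space.
\<close>

definition nu :: "'a measure" where "nu = density mu (indicator \<Gamma>)"

abbreviation P :: "('a \<times> 'a) measure" where "P \<equiv> nu \<Otimes>\<^sub>M nu"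

lemma word_map_measurable [measurable]:
  "set w \<subseteq> {1..M} \<Longrightarrow> word_map w \<in> borel_measurable borel"
  by (intro borel_measurable_continuous_onI continuous_word_map)

lemma word_map_image_borel:
  assumes w: "set w \<subseteq> {1..M}" and A: "A \<in> sets borel"
  shows "word_map w ` A \<in> sets borel"
proof -
  let ?g = "inv (word_map w)"
  have d: "dist (?g x) (?g y) = dist x y / \<rho> ^ length w" for x y
    using dist_word_map[OF w, of "?g x" "?g y"] bij_word_map[OF w] rho_pos
    by (simp add: bij_is_surj surj_f_inv_f)
  have "continuous_on UNIV ?g"
    unfolding continuous_on_iff
  proof (intro ballI allI impI)
    fix x :: 'a and e :: real assume "0 < e"
    show "\<exists>\<delta>>0. \<forall>y\<in>UNIV. dist y x < \<delta> \<longrightarrow> dist (?g y) (?g x) < e"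
      using \<open>0 < e\<close> rho_pos
      by (intro exI[of _ "\<rho> ^ length w * e"]) (simp add: d pos_divide_less_eq mult.commute)
  qed
  then have "?g \<in> borel_measurable borel" by (rule borel_measurable_continuous_onI)
  then have "?g -` A \<in> sets borel" using A by (simp add: measurable_def)
  moreover have "?g -` A = word_map w ` A"
    using bij_vimage_eq_inv_image[of ?g A] bij_word_map[OF w] by (simp add: bij_imp_bij_inv inv_inv_eq)
  ultimately show ?thesis by simp
qed

lemma attractor_borel [measurable]: "\<Gamma> \<in> sets borel"
  using compact_attractor(4) by (rule borel_closed)

lemma cell_borel [measurable]: "set w \<subseteq> {1..M} \<Longrightarrow> cell w \<in> sets borel"
  by (intro word_map_image_borel attractor_borel)

lemma emeasure_mu_word_map:
  assumes w: "set w \<subseteq> {1..M}" and A: "A \<in> sets borel"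
  shows "emeasure mu (word_map w ` A) = ennreal (1 / real M ^ length w) * emeasure mu A"
  using hausdorff_outer_similarity_image[OF dist_word_map[OF w] _ bij_word_map[OF w], of sim_dim A]
    rho_pos word_map_image_borel[OF w A] A
  by (simp add: emeasure_hausdorff_measure rho_power_sim_dim)

lemma emeasure_mu_attractor_finite: "emeasure mu \<Gamma> < \<infinity>"
  using hausdorff_outer_attractor_finite by (simp add: emeasure_hausdorff_measure)

lemma emeasure_mu_singleton: "emeasure mu {x} = 0"
  by (simp add: emeasure_hausdorff_measure hausdorff_outer_singleton)

lemma sets_nu [simp, measurable_cong]: "sets nu = sets borel" and space_nu [simp]: "space nu = UNIV"
  by (simp_all add: nu_def)

lemma emeasure_nu: "A \<in> sets borel \<Longrightarrow> emeasure nu A = emeasure mu (\<Gamma> \<inter> A)"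
  unfolding nu_def by (rule emeasure_restricted) auto

lemma finite_measure_nu: "finite_measure nu"
  by (rule finite_measureI) (use emeasure_mu_attractor_finite in \<open>simp add: emeasure_nu\<close>)

sublocale nu: finite_measure nu by (rule finite_measure_nu)
sublocale nuP: pair_sigma_finite nu nu ..
sublocale P: finite_measure P
  by (intro finite_measure_pair_measure finite_measure_nu)

lemma integral_nu:
  fixes f :: "'a \<Rightarrow> 'b::{banach, second_countable_topology}"
  assumes "f \<in> borel_measurable borel"
  shows "(\<integral>x. f x \<partial>nu) = (\<integral>x. indicator \<Gamma> x *\<^sub>R f x \<partial>mu)"
proof -
  have "nu = density mu (\<lambda>x. ennreal (indicator \<Gamma> x))" by (simp add: nu_def ennreal_indicator)
  then show ?thesis using assms by (simp add: integral_density)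
qed

lemma emeasure_nu_cell:
  assumes "set w \<subseteq> {1..M}" shows "emeasure nu (cell w) = emeasure mu (cell w)"
proof -
  have "\<Gamma> \<inter> cell w = cell w" using word_map_attractor_subset[OF assms] by auto
  then show ?thesis using assms by (simp add: emeasure_nu)
qed

lemma measure_mu_cell:
  assumes "set w \<subseteq> {1..M}" shows "measure mu (cell w) = H / real M ^ length w"
  using emeasure_mu_word_map[OF assms attractor_borel]
  by (simp add: measure_def enn2real_mult)

lemma measure_nu_cell:
  assumes "set w \<subseteq> {1..M}" shows "measure nu (cell w) = H / real M ^ length w"
  using measure_mu_cell[OF assms] emeasure_nu_cell[OF assms] by (simp add: measure_def)

lemma Hd_eq: "set w \<subseteq> {1..M} \<Longrightarrow> Hd s \<Gamma> sim_dim w = H / real M ^ length w"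
  by (simp add: Hd_def sub_attractor_eq measure_mu_cell)

lemma nu_singleton: "emeasure nu {x} = 0"
proof -
  have "emeasure mu (\<Gamma> \<inter> {x}) \<le> emeasure mu {x}" by (intro emeasure_mono) auto
  then show ?thesis by (simp add: emeasure_nu emeasure_mu_singleton)
qed

text \<open>
  Points are null sets, hence so is the diagonal of the product.
\<close>

lemma AE_P_off_diagonal: "AE z in P. fst z \<noteq> snd z"
proof -
  have "AE x in nu. AE y in nu. x \<noteq> y"
  proof (rule AE_I2)
    fix x
    show "AE y in nu. x \<noteq> y"
      by (rule AE_I'[of "{x}"]) (auto simp: null_sets_def nu_singleton)
  qed
  moreover have "{z \<in> space P. dist (fst z) (snd z) \<noteq> 0} \<in> sets P"
    by measurable
  then have "{z \<in> space P. fst z \<noteq> snd z} \<in> sets P" by simp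
  ultimately show ?thesis by (intro nuP.AE_pair_measure) simp_all
qed

text \<open>
  The restriction of the measure to a cell is the image of the measure under the map of the
  cell, up to the factor \<open>M^-l\<close>.
\<close>

lemma density_nu_cell:
  assumes w: "set w \<subseteq> {1..M}"
  shows "density nu (indicator (cell w)) =
    density (distr nu borel (word_map w)) (\<lambda>_. ennreal (1 / real M ^ length w))"
proof (rule measure_eqI)
  fix A assume "A \<in> sets (density nu (indicator (cell w)))"
  then have A: "A \<in> sets borel" by simp
  have V: "word_map w -` A \<in> sets borel"
    using word_map_measurable[OF w] A by (simp add: measurable_def)
  have eq: "\<Gamma> \<inter> (cell w \<inter> A) = word_map w ` (\<Gamma> \<inter> word_map w -` A)"
    using word_map_attractor_subset[OF w] by auto
  have "emeasure (density nu (indicator (cell w))) A = emeasure nu (cell w \<inter> A)"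
    using w A by (intro emeasure_restricted) auto
  also have "\<dots> = ennreal (1 / real M ^ length w) * emeasure mu (\<Gamma> \<inter> word_map w -` A)"
    using w A V by (simp add: emeasure_nu eq emeasure_mu_word_map)
  also have "\<dots> = ennreal (1 / real M ^ length w) * emeasure nu (word_map w -` A)"
    using V by (simp add: emeasure_nu)
  finally show "emeasure (density nu (indicator (cell w))) A =
      emeasure (density (distr nu borel (word_map w)) (\<lambda>_. ennreal (1 / real M ^ length w))) A"
    using w A by (simp add: emeasure_density_const emeasure_distr)
qed simp

lemma nn_integral_nu_cell:
  assumes w: "set w \<subseteq> {1..M}" and [measurable]: "g \<in> borel_measurable borel"
  shows "(\<integral>\<^sup>+x. indicator (cell w) x * g x \<partial>nu) =
    ennreal (1 / real M ^ length w) * (\<integral>\<^sup>+x. g (word_map w x) \<partial>nu)"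
proof -
  note [measurable] = word_map_measurable[OF w] cell_borel[OF w]
  have "(\<integral>\<^sup>+x. indicator (cell w) x * g x \<partial>nu) = (\<integral>\<^sup>+x. g x \<partial>density nu (indicator (cell w)))"
    by (subst nn_integral_density) auto
  also have "\<dots> = (\<integral>\<^sup>+x. ennreal (1 / real M ^ length w) * g x \<partial>distr nu borel (word_map w))"
    unfolding density_nu_cell[OF w] by (subst nn_integral_density) auto
  also have "\<dots> = (\<integral>\<^sup>+x. ennreal (1 / real M ^ length w) * g (word_map w x) \<partial>nu)"
    by (subst nn_integral_distr) auto
  also have "\<dots> = ennreal (1 / real M ^ length w) * (\<integral>\<^sup>+x. g (word_map w x) \<partial>nu)"
    by (rule nn_integral_cmult) measurable
  finally show ?thesis .
qed

definition pair_map :: "nat list \<Rightarrow> 'a \<times> 'a \<Rightarrow> 'a \<times> 'a" where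
  "pair_map w z = (word_map w (fst z), word_map w (snd z))"

lemma pair_map_measurable [measurable]: "set w \<subseteq> {1..M} \<Longrightarrow> pair_map w \<in> measurable P P"
  unfolding pair_map_def by measurable

lemma nn_integral_P_cell:
  assumes w: "set w \<subseteq> {1..M}" and g[measurable]: "g \<in> borel_measurable P"
  shows "(\<integral>\<^sup>+z. indicator (cell w \<times> cell w) z * g z \<partial>P) =
    ennreal (1 / real M ^ (2 * length w)) * (\<integral>\<^sup>+z. g (pair_map w z) \<partial>P)"
proof -
  note [measurable] = word_map_measurable[OF w] cell_borel[OF w] pair_map_measurable[OF w]
  let ?c = "ennreal (1 / real M ^ length w)"
  have "(\<integral>\<^sup>+z. indicator (cell w \<times> cell w) z * g z \<partial>P) =
      (\<integral>\<^sup>+x. \<integral>\<^sup>+y. indicator (cell w \<times> cell w) (x, y) * g (x, y) \<partial>nu \<partial>nu)"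
    by (rule nu.nn_integral_fst[symmetric]) measurable
  also have "\<dots> = (\<integral>\<^sup>+x. indicator (cell w) x * (\<integral>\<^sup>+y. indicator (cell w) y * g (x, y) \<partial>nu) \<partial>nu)"
    by (intro nn_integral_cong) (simp add: indicator_times mult.assoc nn_integral_cmult)
  also have "\<dots> = (\<integral>\<^sup>+x. indicator (cell w) x * (?c * (\<integral>\<^sup>+y. g (x, word_map w y) \<partial>nu)) \<partial>nu)"
    by (intro nn_integral_cong) (subst nn_integral_nu_cell[OF w], auto)
  also have "\<dots> = ?c * (\<integral>\<^sup>+x. ?c * (\<integral>\<^sup>+y. g (word_map w x, word_map w y) \<partial>nu) \<partial>nu)"
    by (rule nn_integral_nu_cell[OF w]) measurable
  also have "\<dots> = ?c * (?c * (\<integral>\<^sup>+x. (\<integral>\<^sup>+y. g (word_map w x, word_map w y) \<partial>nu) \<partial>nu))"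
    by (subst nn_integral_cmult) auto
  also have "(\<integral>\<^sup>+x. (\<integral>\<^sup>+y. g (word_map w x, word_map w y) \<partial>nu) \<partial>nu) = (\<integral>\<^sup>+z. g (pair_map w z) \<partial>P)"
    using nu.nn_integral_fst[of "\<lambda>z. g (pair_map w z)" nu] by (simp add: pair_map_def)
  also have "?c * (?c * X) = ennreal (1 / real M ^ (2 * length w)) * X" for X
    by (simp add: mult.assoc[symmetric] ennreal_mult[symmetric] mult_2 power_add)
  finally show ?thesis .
qed

text \<open>
  Two-variable form of \<open>density_nu_cell\<close>, obtained from Tonelli's theorem; it is
  the change of variables for double integrals over a diagonal block.
\<close>

lemma density_P_cell:
  assumes w: "set w \<subseteq> {1..M}"
  shows "density P (\<lambda>z. ennreal (indicator (cell w \<times> cell w) z)) =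
    density (distr P P (pair_map w)) (\<lambda>_. ennreal (1 / real M ^ (2 * length w)))"
proof (rule measure_eqI)
  note [measurable] = cell_borel[OF w] pair_map_measurable[OF w]
  fix A assume "A \<in> sets (density P (\<lambda>z. ennreal (indicator (cell w \<times> cell w) z)))"
  then have A: "A \<in> sets P" by (simp only: sets_density)
  have "emeasure (density P (\<lambda>z. ennreal (indicator (cell w \<times> cell w) z))) A
      = (\<integral>\<^sup>+z. indicator (cell w \<times> cell w) z * indicator A z \<partial>P)"
    by (subst emeasure_density[OF _ A]) (measurable, simp add: ennreal_indicator)
  also have "\<dots> = ennreal (1 / real M ^ (2 * length w)) * (\<integral>\<^sup>+z. indicator A (pair_map w z) \<partial>P)"
    by (rule nn_integral_P_cell[OF w borel_measurable_indicator[OF A]])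
  also have "(\<integral>\<^sup>+z. indicator A (pair_map w z) \<partial>P) = emeasure (distr P P (pair_map w)) A"
  proof -
    have "(\<integral>\<^sup>+z. indicator A (pair_map w z) \<partial>P) = (\<integral>\<^sup>+z. indicator A z \<partial>distr P P (pair_map w))"
      by (rule nn_integral_distr[OF pair_map_measurable[OF w], symmetric])
        (simp only: measurable_distr_eq1 borel_measurable_indicator[OF A])
    then show ?thesis using A by (simp only: nn_integral_indicator sets_distr)
  qed
  finally show "emeasure (density P (\<lambda>z. ennreal (indicator (cell w \<times> cell w) z))) A =
      emeasure (density (distr P P (pair_map w)) (\<lambda>_. ennreal (1 / real M ^ (2 * length w)))) A"
    by (subst emeasure_density_const) (simp_all only: sets_distr A)
qed simp

lemma integral_P_cell:
  fixes F :: "'a \<times> 'a \<Rightarrow> 'b::{banach, second_countable_topology}"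
  assumes w: "set w \<subseteq> {1..M}" and F[measurable]: "F \<in> borel_measurable P"
  shows "(\<integral>z. indicator (cell w \<times> cell w) z *\<^sub>R F z \<partial>P) =
    (1 / real M ^ (2 * length w)) *\<^sub>R (\<integral>z. F (pair_map w z) \<partial>P)"
proof -
  note [measurable] = cell_borel[OF w] pair_map_measurable[OF w]
  have "(\<integral>z. indicator (cell w \<times> cell w) z *\<^sub>R F z \<partial>P)
      = (\<integral>z. F z \<partial>density P (\<lambda>z. ennreal (indicator (cell w \<times> cell w) z)))"
    by (subst integral_density) auto
  also have "\<dots> = (\<integral>z. (1 / real M ^ (2 * length w)) *\<^sub>R F z \<partial>distr P P (pair_map w))"
    unfolding density_P_cell[OF w] by (subst integral_density) auto
  also have "\<dots> = (\<integral>z. (1 / real M ^ (2 * length w)) *\<^sub>R F (pair_map w z) \<partial>P)"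
    by (subst integral_distr) auto
  finally show ?thesis by simp
qed

lemma measure_P_cells:
  assumes "set a \<subseteq> {1..M}" "set b \<subseteq> {1..M}"
  shows "measure P (cell a \<times> cell b) = (H / real M ^ length a) * (H / real M ^ length b)"
proof -
  have "emeasure P (cell a \<times> cell b) = emeasure nu (cell a) * emeasure nu (cell b)"
    using assms by (intro nu.emeasure_pair_measure_Times) auto
  then have "measure P (cell a \<times> cell b) = measure nu (cell a) * measure nu (cell b)"
    by (simp add: measure_def enn2real_mult)
  then show ?thesis using assms by (simp add: measure_nu_cell)
qed

definition pair_integral :: "nat list \<Rightarrow> nat list \<Rightarrow> ('a \<times> 'a \<Rightarrow> 'b) \<Rightarrow> 'b::{banach, second_countable_topology}"
  where "pair_integral a b F = (\<integral>z. indicator (cell a \<times> cell b) z *\<^sub>R F z \<partial>P)"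

lemma disjoint_cells:
  assumes "u \<in> words l" "v \<in> words l" "u \<noteq> v" and w: "set w \<subseteq> {1..M}"
  shows "cell (w @ u) \<inter> cell (w @ v) = {}"
proof -
  have "cell u \<inter> cell v = {}"
  proof (rule ccontr)
    assume "cell u \<inter> cell v \<noteq> {}"
    then obtain x where x: "x \<in> cell u" "x \<in> cell v" by blast
    have "\<rho> ^ (l - 1) * R \<le> dist x x"
      by (rule hull_dist_ge_same_length[OF assms(1-3)]) (use x word_map_hull_superset in auto)
    moreover have "0 < \<rho> ^ (l - 1) * R" using rho_pos R_pos by simp
    ultimately show False by simp
  qed
  moreover have "inj (word_map w)" using bij_word_map[OF w] by (rule bij_is_inj)
  ultimately show ?thesis
    unfolding word_map_append image_comp[symmetric] by (metis image_Int image_empty)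
qed

text \<open>
  Cells of one level are disjoint, so the indicator of a cell is the sum of those of its
  descendants.
\<close>

lemma indicator_cell_sum:
  assumes w: "set w \<subseteq> {1..M}"
  shows "indicator (cell w) x = (\<Sum>u\<in>words l. indicator (cell (w @ u)) x :: real)"
proof -
  have "disjoint_family_on (\<lambda>u. cell (w @ u)) (words l)"
    unfolding disjoint_family_on_def using disjoint_cells w by blast
  then show ?thesis
    unfolding word_map_image_words[of w l] by (intro indicator_UN_disjoint) auto
qed

lemma integrable_cells:
  fixes F :: "'a \<times> 'a \<Rightarrow> 'b::{banach, second_countable_topology}"
  assumes "set a \<subseteq> {1..M}" "set b \<subseteq> {1..M}" "integrable P F"
  shows "integrable P (\<lambda>z. indicator (cell a \<times> cell b) z *\<^sub>R F z)"
  using assms by (intro integrable_mult_indicator) (auto intro!: pair_measureI)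

lemma pair_integral_split:
  assumes ab: "set a \<subseteq> {1..M}" "set b \<subseteq> {1..M}" and F: "integrable P F"
  shows "pair_integral a b F = (\<Sum>u\<in>words k. \<Sum>v\<in>words l. pair_integral (a @ u) (b @ v) F)"
proof -
  have "indicator (cell a \<times> cell b) z *\<^sub>R F z =
      (\<Sum>u\<in>words k. \<Sum>v\<in>words l. indicator (cell (a @ u) \<times> cell (b @ v)) z *\<^sub>R F z)" for z
  proof -
    obtain x y where z: "z = (x, y)" by (cases z)
    show ?thesis
    proof -
      have "indicator (cell a \<times> cell b) z = (\<Sum>u\<in>words k. \<Sum>v\<in>words l. indicator (cell (a @ u) \<times> cell (b @ v)) z :: real)"
        unfolding z indicator_times fst_conv snd_conv
        by (subst indicator_cell_sum[OF ab(1), of x k], subst indicator_cell_sum[OF ab(2), of y l],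
            rule sum_product)
      then show ?thesis by (simp add: scaleR_sum_left)
    qed
  qed
  then have "pair_integral a b F =
      (\<integral>z. (\<Sum>u\<in>words k. \<Sum>v\<in>words l. indicator (cell (a @ u) \<times> cell (b @ v)) z *\<^sub>R F z) \<partial>P)"
    unfolding pair_integral_def by simp
  also have "\<dots> = (\<Sum>u\<in>words k. (\<integral>z. (\<Sum>v\<in>words l. indicator (cell (a @ u) \<times> cell (b @ v)) z *\<^sub>R F z) \<partial>P))"
    using ab F by (intro Bochner_Integration.integral_sum Bochner_Integration.integrable_sum integrable_cells) (auto simp: words_def)
  also have "\<dots> = (\<Sum>u\<in>words k. \<Sum>v\<in>words l. pair_integral (a @ u) (b @ v) F)"
    unfolding pair_integral_def using ab F
    by (intro sum.cong refl Bochner_Integration.integral_sum integrable_cells) (auto simp: words_def)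
  finally show ?thesis .
qed

lemma pair_integral_bound:
  fixes F :: "'a \<times> 'a \<Rightarrow> 'b::{banach, second_countable_topology}"
  assumes ab: "set a \<subseteq> {1..M}" "set b \<subseteq> {1..M}" and F: "integrable P F"
    and B: "\<And>x y. x \<in> cell a \<Longrightarrow> y \<in> cell b \<Longrightarrow> norm (F (x, y)) \<le> B"
  shows "norm (pair_integral a b F) \<le> B * (H / real M ^ length a) * (H / real M ^ length b)"
proof -
  have m: "cell a \<times> cell b \<in> sets P" using ab by (intro pair_measureI) auto
  have "norm (pair_integral a b F) \<le> (\<integral>z. norm (indicator (cell a \<times> cell b) z *\<^sub>R F z) \<partial>P)"
    unfolding pair_integral_def by (rule integral_norm_bound)
  also have "\<dots> \<le> (\<integral>z. indicator (cell a \<times> cell b) z *\<^sub>R B \<partial>P)"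
  proof (rule integral_mono)
    show "integrable P (\<lambda>z. norm (indicator (cell a \<times> cell b) z *\<^sub>R F z))"
      using integrable_cells[OF ab F] by (rule integrable_norm)
    show "integrable P (\<lambda>z. indicator (cell a \<times> cell b) z *\<^sub>R B)"
      using integrable_cells[OF ab, of "\<lambda>_. B"] by simp
    show "norm (indicator (cell a \<times> cell b) z *\<^sub>R F z) \<le> indicator (cell a \<times> cell b) z *\<^sub>R B" for z
      using B by (cases z) (auto simp: indicator_def)
  qed
  also have "\<dots> = measure P (cell a \<times> cell b) * B"
    using m by simp
  finally show ?thesis using measure_P_cells[OF ab] by (simp add: mult_ac)
qed

end

section \<open>Radial kernels and the barycentre rule on separated cells\<close>

text \<open>
  For \<open>z \<mapsto> g |z|\<close> the eigenvalues of the Hessian are \<open>g'' r\<close>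
  and \<open>g' r / r\<close>, so \<open>B\<close> bounds the second derivatives of the radial
  function at distances in \<open>{r0..r1}\<close>.
\<close>

definition radial_C2_bound :: "(real \<Rightarrow> 'b::real_normed_vector) \<Rightarrow> real \<Rightarrow> real \<Rightarrow> real \<Rightarrow> bool" where
  "radial_C2_bound g r0 r1 B \<longleftrightarrow> (\<exists>g' g''. \<forall>r\<in>{r0..r1}.
     (g has_vector_derivative g' r) (at r) \<and> (g' has_vector_derivative g'' r) (at r) \<and>
     norm (g'' r) + norm (g' r) / r \<le> B)"

lemma onorm_scaleR_id_le: "onorm (\<lambda>h. h *\<^sub>R (a :: 'b::real_normed_vector)) \<le> norm a"
  by (rule onorm_le) (simp add: mult.commute)

text \<open>
  The function \<open>\<phi> t = g |z + t v|\<close> has \<open>|\<phi>''| \<le> B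
  |v|^2\<close>; integrating twice by the mean value inequality bounds the remainder.  The
  factor 1/2 of the sharp estimate is not recovered, which only affects constants.
\<close>

lemma radial_taylor:
  fixes g :: "real \<Rightarrow> 'b::real_normed_vector" and z v :: "'a::real_inner"
  assumes d: "\<And>r. r \<in> {r0..r1} \<Longrightarrow> (g has_vector_derivative g' r) (at r)"
    "\<And>r. r \<in> {r0..r1} \<Longrightarrow> (g' has_vector_derivative g'' r) (at r)"
    "\<And>r. r \<in> {r0..r1} \<Longrightarrow> norm (g'' r) + norm (g' r) / r \<le> B"
    and r0: "0 < r0" and seg: "\<And>t. t \<in> {0..1} \<Longrightarrow> norm (z + t *\<^sub>R v) \<in> {r0..r1}"
  shows "norm (g (norm (z + v)) - g (norm z) - (inner z v / norm z) *\<^sub>R g' (norm z)) \<le> B * (norm v)\<^sup>2"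
proof -
  \<comment> \<open>\<open>m\<close> is the derivative of the distance \<open>q\<close> along the segment.\<close>
  define q where "q t = norm (z + t *\<^sub>R v)" for t
  define m where "m t = inner (z + t *\<^sub>R v) v / q t" for t
  have q_in: "q t \<in> {r0..r1}" and q_pos: "q t > 0" if "t \<in> {0..1}" for t
    using seg[OF that] r0 by (auto simp: q_def)
  have dq: "(q has_real_derivative m t) (at t)" if "t \<in> {0..1}" for t
  proof -
    have "z + t *\<^sub>R v \<noteq> 0" using q_pos[OF that] by (auto simp: q_def)
    moreover have "((\<lambda>t. z + t *\<^sub>R v) has_derivative (\<lambda>h. h *\<^sub>R v)) (at t)"
      by (auto intro!: derivative_eq_intros)
    ultimately have "(q has_derivative (\<lambda>h. inner (h *\<^sub>R v) (sgn (z + t *\<^sub>R v)))) (at t)"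
      unfolding q_def[abs_def] by (rule has_derivative_compose[OF _ has_derivative_norm, rotated])
    moreover have "inner v (sgn (z + t *\<^sub>R v)) = m t"
      by (simp add: m_def q_def sgn_div_norm inner_commute divide_inverse)
    then have "(\<lambda>h. inner (h *\<^sub>R v) (sgn (z + t *\<^sub>R v))) = (*) (m t)"
      by (auto simp: fun_eq_iff)
    ultimately show ?thesis unfolding has_field_derivative_def by (simp only:)
  qed
  have dm: "(m has_real_derivative ((norm v)\<^sup>2 - (m t)\<^sup>2) / q t) (at t)" if t: "t \<in> {0..1}" for t
  proof -
    have "((\<lambda>t. inner (z + t *\<^sub>R v) v) has_real_derivative (norm v)\<^sup>2) (at t)"
      unfolding inner_add_left inner_scaleR_left
      by (auto intro!: derivative_eq_intros simp: power2_norm_eq_inner)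
    from DERIV_divide[OF this dq[OF t]] q_pos[OF t] show ?thesis
      unfolding m_def[abs_def] by (simp add: field_simps power2_eq_square)
  qed
  have m_le: "\<bar>m t\<bar> \<le> norm v" if "t \<in> {0..1}" for t
  proof -
    have "\<bar>inner (z + t *\<^sub>R v) v\<bar> \<le> q t * norm v"
      unfolding q_def by (rule Cauchy_Schwarz_ineq2)
    then show ?thesis using q_pos[OF that] by (simp add: m_def field_simps)
  qed
  define \<phi> where "\<phi> t = g (q t)" for t
  define \<phi>1 where "\<phi>1 t = m t *\<^sub>R g' (q t)" for t
  define \<phi>2 where "\<phi>2 t = (((norm v)\<^sup>2 - (m t)\<^sup>2) / q t) *\<^sub>R g' (q t) + (m t * m t) *\<^sub>R g'' (q t)" for t
  have d1: "(\<phi> has_vector_derivative \<phi>1 t) (at t)" if t: "t \<in> {0..1}" for t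
    unfolding \<phi>_def \<phi>1_def
    using vector_diff_chain_at[of q "m t" t g "g' (q t)"] dq[OF t] d(1)[OF q_in[OF t]]
    by (simp add: o_def has_real_derivative_iff_has_vector_derivative)
  have d2: "(\<phi>1 has_vector_derivative \<phi>2 t) (at t)" if t: "t \<in> {0..1}" for t
  proof -
    have "((\<lambda>t. g' (q t)) has_vector_derivative m t *\<^sub>R g'' (q t)) (at t)"
      using vector_diff_chain_at[of q "m t" t g' "g'' (q t)"] dq[OF t] d(2)[OF q_in[OF t]]
      by (simp add: o_def has_real_derivative_iff_has_vector_derivative)
    from has_vector_derivative_scaleR[OF dm[OF t] this] show ?thesis
      unfolding \<phi>1_def[abs_def] \<phi>2_def by (simp add: add.commute)
  qed
  have n2: "norm (\<phi>2 t) \<le> B * (norm v)\<^sup>2" if t: "t \<in> {0..1}" for t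
  proof -
    have mm: "(m t)\<^sup>2 \<le> (norm v)\<^sup>2" using m_le[OF t] by (simp add: abs_le_square_iff[symmetric])
    have "norm (\<phi>2 t) \<le> ((norm v)\<^sup>2 - (m t)\<^sup>2) / q t * norm (g' (q t)) + (m t)\<^sup>2 * norm (g'' (q t))"
      unfolding \<phi>2_def using mm q_pos[OF t]
      by (intro order.trans[OF norm_triangle_ineq]) (simp add: power2_eq_square)
    also have "\<dots> \<le> (norm v)\<^sup>2 / q t * norm (g' (q t)) + (norm v)\<^sup>2 * norm (g'' (q t))"
      using mm q_pos[OF t] by (intro add_mono mult_right_mono divide_right_mono) auto
    also have "\<dots> = (norm v)\<^sup>2 * (norm (g'' (q t)) + norm (g' (q t)) / q t)" by (simp add: algebra_simps)
    also have "\<dots> \<le> (norm v)\<^sup>2 * B" by (intro mult_left_mono d(3) q_in t) simp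
    finally show ?thesis by (simp add: mult.commute)
  qed
  have B0: "0 \<le> B * (norm v)\<^sup>2" by (rule order.trans[OF norm_ge_zero n2[of 0]]) simp
  have "norm (\<phi>1 t - \<phi>1 0) \<le> B * (norm v)\<^sup>2" if t: "t \<in> {0..1}" for t
  proof -
    have "norm (\<phi>1 t - \<phi>1 0) \<le> B * (norm v)\<^sup>2 * norm (t - 0)"
    proof (rule differentiable_bound[of "{0..1}"])
      show "(\<phi>1 has_derivative (\<lambda>h. h *\<^sub>R \<phi>2 x)) (at x within {0..1})" if "x \<in> {0..1}" for x
        using d2[OF that] by (simp add: has_vector_derivative_def has_derivative_at_withinI)
      show "onorm (\<lambda>h. h *\<^sub>R \<phi>2 x) \<le> B * (norm v)\<^sup>2" if "x \<in> {0..1}" for x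
        by (rule order.trans[OF onorm_scaleR_id_le n2[OF that]])
    qed (use t in auto)
    also have "\<dots> \<le> B * (norm v)\<^sup>2 * 1" using t B0 by (intro mult_left_mono) auto
    finally show ?thesis by simp
  qed
  then have "norm (\<phi> 1 - \<phi> 0 - (1 - 0) *\<^sub>R \<phi>1 0) \<le> norm (1 - 0 :: real) * (B * (norm v)\<^sup>2)"
    by (intro vector_differentiable_bound_linearization[of "{0..1}"])
      (use d1 in \<open>auto intro: has_vector_derivative_at_within simp: closed_segment_eq_real_ivl\<close>)
  then show ?thesis by (simp add: \<phi>_def \<phi>1_def q_def m_def)
qed

context hull_disjoint_ifs
begin

abbreviation bary :: "nat list \<Rightarrow> 'a" where "bary w \<equiv> barycentre s \<Gamma> sim_dim w"

abbreviation hull_cell :: "nat list \<Rightarrow> 'a set" where "hull_cell w \<equiv> word_map w ` (convex hull \<Gamma>)"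

lemma integral_nu_cell_id:
  assumes w: "set w \<subseteq> {1..M}" and H: "H > 0"
  shows "integrable nu (\<lambda>x. indicator (cell w) x *\<^sub>R x)" (is ?i)
    and "(\<integral>x. indicator (cell w) x *\<^sub>R x \<partial>nu) = (H / real M ^ length w) *\<^sub>R bary w" (is ?e)
proof -
  note [measurable] = cell_borel[OF w]
  obtain K where K: "\<And>x. x \<in> \<Gamma> \<Longrightarrow> norm x \<le> K" using compact_attractor(3) by (auto simp: bounded_iff)
  have "0 \<le> K" using order.trans[OF norm_ge_zero K] compact_attractor(2) by blast
  have "norm (indicator (cell w) x *\<^sub>R x) \<le> K" for x
  proof (cases "x \<in> cell w")
    case True
    then have "x \<in> \<Gamma>" using word_map_attractor_subset[OF w] by blast
    then show ?thesis using K[of x] \<open>0 \<le> K\<close> by (simp add: indicator_def)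
  qed (use \<open>0 \<le> K\<close> in simp)
  then show ?i by (intro nu.integrable_const_bound[where B = K]) auto
  have "(\<integral>x. indicator (cell w) x *\<^sub>R x \<partial>nu) = (\<integral>x. indicator (cell w) x *\<^sub>R x \<partial>mu)"
  proof -
    have "indicator \<Gamma> x *\<^sub>R (indicator (cell w) x *\<^sub>R x) = indicator (cell w) x *\<^sub>R x" for x
    proof (cases "x \<in> \<Gamma>")
      case False
      then have "x \<notin> cell w" using word_map_attractor_subset[OF w] by blast
      then have "indicator (cell w) x = (0 :: real)" by (rule indicator_simps(2))
      then show ?thesis by (simp only: scaleR_zero_left scaleR_zero_right)
    qed simp
    then show ?thesis using integral_nu[of "\<lambda>x. indicator (cell w) x *\<^sub>R x"] by (simp only:) measurable
  qed
  then show ?e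
    using H M_pos w by (simp add: barycentre_def Hd_eq set_lebesgue_integral_def sub_attractor_eq)
qed

lemma integral_nu_cell_const:
  fixes c :: "'b::{banach, second_countable_topology}"
  assumes w: "set w \<subseteq> {1..M}"
  shows "integrable nu (\<lambda>x. indicator (cell w) x *\<^sub>R c)"
    and "(\<integral>x. indicator (cell w) x *\<^sub>R c \<partial>nu) = (H / real M ^ length w) *\<^sub>R c"
proof -
  have i: "integrable nu (indicator (cell w) :: _ \<Rightarrow> real)"
    using w by (intro integrable_real_indicator) (auto simp: less_top[symmetric])
  show "integrable nu (\<lambda>x. indicator (cell w) x *\<^sub>R c)"
    using i by (intro integrable_scaleR_left) auto
  have "(\<integral>x. indicator (cell w) x *\<^sub>R c \<partial>nu) = (\<integral>x. indicator (cell w) x \<partial>nu) *\<^sub>R c"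
    by (rule integral_scaleR_left) (rule i)
  then show "(\<integral>x. indicator (cell w) x *\<^sub>R c \<partial>nu) = (H / real M ^ length w) *\<^sub>R c"
    using w by (simp add: measure_nu_cell)
qed

lemma integral_nu_cell_centred:
  assumes w: "set w \<subseteq> {1..M}" and H: "H > 0"
  shows "integrable nu (\<lambda>x. indicator (cell w) x *\<^sub>R (x - bary w))"
    and "(\<integral>x. indicator (cell w) x *\<^sub>R (x - bary w) \<partial>nu) = 0"
proof -
  note i = integral_nu_cell_const[OF w, of "bary w"]
  show "integrable nu (\<lambda>x. indicator (cell w) x *\<^sub>R (x - bary w))"
    unfolding scaleR_diff_right using i(1) integral_nu_cell_id[OF w H] by auto
  show "(\<integral>x. indicator (cell w) x *\<^sub>R (x - bary w) \<partial>nu) = 0"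
    unfolding scaleR_diff_right using i integral_nu_cell_id[OF w H] by simp
qed

lemma hull_cell_closed_convex:
  assumes w: "set w \<subseteq> {1..M}"
  shows "closed (hull_cell w)" "convex (hull_cell w)"
proof -
  have "compact (word_map w ` \<Gamma>)"
    using compact_attractor(1) by (intro compact_continuous_image continuous_word_map w)
  then show "closed (hull_cell w)" "convex (hull_cell w)"
    unfolding convex_hull_word_map[OF w, symmetric]
    by (auto intro: compact_imp_closed compact_convex_hull)
qed

text \<open>
  Otherwise a hyperplane strictly separates the barycentre from the hull, and integrating the
  separating functional over the cell contradicts the definition of the barycentre.
\<close>

lemma barycentre_in_hull:
  assumes w: "set w \<subseteq> {1..M}" and H: "H > 0"
  shows "bary w \<in> hull_cell w"
proof (rule ccontr)
  assume "bary w \<notin> hull_cell w"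
  then obtain a b where ab: "inner a (bary w) < b" "\<And>x. x \<in> hull_cell w \<Longrightarrow> inner a x > b"
    using separating_hyperplane_closed_point[of "hull_cell w" "bary w"] hull_cell_closed_convex[OF w] by blast
  note [measurable] = cell_borel[OF w]
  let ?f = "\<lambda>x. indicator (cell w) x *\<^sub>R inner a (x - bary w)"
  have f: "?f = (\<lambda>x. inner a (indicator (cell w) x *\<^sub>R (x - bary w)))" by (simp add: fun_eq_iff)
  have "(\<integral>x. ?f x \<partial>nu) = 0"
    unfolding f integral_bounded_linear[OF bounded_linear_inner_right integral_nu_cell_centred(1)[OF w H]]
    by (simp add: integral_nu_cell_centred(2)[OF w H])
  moreover have "(b - inner a (bary w)) * (H / real M ^ length w) \<le> (\<integral>x. ?f x \<partial>nu)"
  proof -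
    have "(\<integral>x. indicator (cell w) x *\<^sub>R (b - inner a (bary w)) \<partial>nu) \<le> (\<integral>x. ?f x \<partial>nu)"
    proof (rule integral_mono)
      show "integrable nu (\<lambda>x. indicator (cell w) x *\<^sub>R (b - inner a (bary w)))"
        by (rule integral_nu_cell_const[OF w])
      show "integrable nu ?f" unfolding f using integral_nu_cell_centred(1)[OF w H] by (rule integrable_inner_right)
      show "indicator (cell w) x *\<^sub>R (b - inner a (bary w)) \<le> ?f x" for x
        using ab(2)[OF word_map_hull_superset, of x] by (auto simp: indicator_def inner_diff_right)
    qed
    also have "(\<integral>x. indicator (cell w) x *\<^sub>R (b - inner a (bary w)) \<partial>nu) = (b - inner a (bary w)) * (H / real M ^ length w)"
      unfolding integral_nu_cell_const(2)[OF w] by simp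
    finally show ?thesis .
  qed
  moreover have "0 < (b - inner a (bary w)) * (H / real M ^ length w)"
    using ab(1) H M_pos by simp
  ultimately show False by simp
qed

lemma dist_hull_le: assumes "x \<in> convex hull \<Gamma>" "y \<in> convex hull \<Gamma>" shows "dist x y \<le> D"
proof -
  have "convex hull \<Gamma> \<subseteq> cball u D" if "u \<in> \<Gamma>" for u
    using that diameter_bounded_bound[OF compact_attractor(3)] by (intro hull_minimal) auto
  then have "x \<in> cball u D" if "u \<in> \<Gamma>" for u using assms(1) that by blast
  then have "\<Gamma> \<subseteq> cball x D" by (auto simp only: mem_cball dist_commute)
  then have "convex hull \<Gamma> \<subseteq> cball x D" by (intro hull_minimal) auto
  then show ?thesis using assms(2) by auto
qed

lemma dist_hull_cell_le:
  assumes "set w \<subseteq> {1..M}" "x \<in> hull_cell w" "y \<in> hull_cell w"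
  shows "dist x y \<le> \<rho> ^ length w * D"
  using assms dist_hull_le rho_pos by (auto simp: dist_word_map)

lemma pair_integral_const:
  fixes c :: "'b::{banach, second_countable_topology}"
  assumes pq: "set p \<subseteq> {1..M}" "set q \<subseteq> {1..M}"
  shows "pair_integral p q (\<lambda>_. c) = ((H / real M ^ length p) * (H / real M ^ length q)) *\<^sub>R c"
proof -
  have "cell p \<times> cell q \<in> sets P" using pq by (intro pair_measureI) auto
  then show ?thesis unfolding pair_integral_def
    by (simp add: P.emeasure_finite measure_P_cells[OF pq] less_top[symmetric])
qed

lemma pair_integral_centred:
  assumes pq: "set p \<subseteq> {1..M}" "set q \<subseteq> {1..M}" and H: "H > 0"
  defines "V \<equiv> \<lambda>z. indicator (cell p \<times> cell q) z *\<^sub>R ((fst z - bary p) - (snd z - bary q))"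
  shows "integrable P V" "(\<integral>z. V z \<partial>P) = 0"
proof -
  note [measurable] = cell_borel[OF pq(1)] cell_borel[OF pq(2)]
  let ?K = "\<rho> ^ length p * D + \<rho> ^ length q * D"
  have K: "0 \<le> ?K" using rho_pos D_pos by simp
  show i: "integrable P V"
  proof (rule P.integrable_const_bound[where B = ?K])
    show "AE z in P. norm (V z) \<le> ?K"
    proof (rule AE_I2)
      fix z
      show "norm (V z) \<le> ?K"
      proof (cases "z \<in> cell p \<times> cell q")
        case True
        then have "dist (fst z) (bary p) \<le> \<rho> ^ length p * D" "dist (snd z) (bary q) \<le> \<rho> ^ length q * D"
          using dist_hull_cell_le[OF pq(1) word_map_hull_superset barycentre_in_hull[OF pq(1) H]]
            dist_hull_cell_le[OF pq(2) word_map_hull_superset barycentre_in_hull[OF pq(2) H]] by auto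
        then show ?thesis using True norm_triangle_ineq4[of "fst z - bary p" "snd z - bary q"]
          by (simp add: V_def dist_norm)
      qed (use K in \<open>simp add: V_def\<close>)
    qed
  qed (simp add: V_def, measurable)
  have "(\<integral>y. V (x, y) \<partial>nu) = (H / real M ^ length q) *\<^sub>R (indicator (cell p) x *\<^sub>R (x - bary p))" for x
  proof -
    have "(\<integral>y. V (x, y) \<partial>nu) = (\<integral>y. indicator (cell q) y *\<^sub>R (indicator (cell p) x *\<^sub>R (x - bary p))
        - indicator (cell p) x *\<^sub>R (indicator (cell q) y *\<^sub>R (y - bary q)) \<partial>nu)"
      by (rule Bochner_Integration.integral_cong) (auto simp: V_def indicator_times algebra_simps)
    also have "\<dots> = (\<integral>y. indicator (cell q) y *\<^sub>R (indicator (cell p) x *\<^sub>R (x - bary p)) \<partial>nu)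
        - (\<integral>y. indicator (cell p) x *\<^sub>R (indicator (cell q) y *\<^sub>R (y - bary q)) \<partial>nu)"
    proof (rule Bochner_Integration.integral_diff)
      show "integrable nu (\<lambda>y. indicator (cell q) y *\<^sub>R (indicator (cell p) x *\<^sub>R (x - bary p)))"
        by (rule integral_nu_cell_const[OF pq(2)])
      show "integrable nu (\<lambda>y. indicator (cell p) x *\<^sub>R (indicator (cell q) y *\<^sub>R (y - bary q)))"
        using integral_nu_cell_centred(1)[OF pq(2) H] by (rule integrable_scaleR_right)
    qed
    also have "\<dots> = (H / real M ^ length q) *\<^sub>R (indicator (cell p) x *\<^sub>R (x - bary p))"
      unfolding integral_nu_cell_const[OF pq(2)] integral_scaleR_right integral_nu_cell_centred(2)[OF pq(2) H]
      by simp
    finally show ?thesis .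
  qed
  then have "(\<integral>x. (\<integral>y. V (x, y) \<partial>nu) \<partial>nu)
      = (\<integral>x. (H / real M ^ length q) *\<^sub>R (indicator (cell p) x *\<^sub>R (x - bary p)) \<partial>nu)" by (simp only:)
  also have "\<dots> = 0"
    by (simp only: integral_scaleR_right integral_nu_cell_centred(2)[OF pq(1) H] scaleR_zero_right)
  finally have "(\<integral>x. (\<integral>y. V (x, y) \<partial>nu) \<partial>nu) = 0" .
  then show "(\<integral>z. V z \<partial>P) = 0" using nuP.integral_fst'[OF i] by simp
qed

text \<open>
  Covers \<open>H = 0\<close>, where the barycentres are quotients by zero but all masses
  vanish.
\<close>

lemma pair_integral_null:
  fixes F :: "'a \<times> 'a \<Rightarrow> 'b::{banach, second_countable_topology}"
  assumes H: "H = 0" and pq: "set p \<subseteq> {1..M}" "set q \<subseteq> {1..M}"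
  shows "pair_integral p q F = 0"
proof -
  have m: "cell p \<times> cell q \<in> sets P" using pq by (intro pair_measureI) auto
  have "emeasure P (cell p \<times> cell q) = 0"
    using measure_P_cells[OF pq] H by (simp add: P.emeasure_eq_measure)
  then have "AE z in P. z \<notin> cell p \<times> cell q"
    using m by (intro AE_not_in) (simp add: null_sets_def)
  then have "AE z in P. indicator (cell p \<times> cell q) z *\<^sub>R F z = 0" by eventually_elim simp
  then show ?thesis unfolding pair_integral_def by (rule integral_eq_zero_AE)
qed

text \<open>
  The Taylor expansion of \<open>g |x - y|\<close> at the two barycentres has a linear term that
  integrates to zero; its remainder is at most \<open>B (2 h)^2\<close>, since both hulls have
  diameter at most \<open>h\<close>.
\<close>

lemma cell_pair_error:
  fixes F :: "'a \<Rightarrow> 'a \<Rightarrow> 'b::{banach, second_countable_topology}"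
  assumes pq: "set p \<subseteq> {1..M}" "set q \<subseteq> {1..M}"
    and F: "integrable P (\<lambda>z. F (fst z) (snd z))" and g: "\<And>x y. x \<noteq> y \<Longrightarrow> F x y = g (dist x y)"
    and bd: "radial_C2_bound g r0 r1 B" and r0: "0 < r0"
    and sep: "\<And>x y. x \<in> hull_cell p \<Longrightarrow> y \<in> hull_cell q \<Longrightarrow> dist x y \<in> {r0..r1}"
    and h: "\<rho> ^ length p * D \<le> h" "\<rho> ^ length q * D \<le> h"
  shows "norm (pair_integral p q (\<lambda>z. F (fst z) (snd z))
      - ((H / real M ^ length p) * (H / real M ^ length q)) *\<^sub>R F (bary p) (bary q))
    \<le> 4 * B * h\<^sup>2 * (H / real M ^ length p) * (H / real M ^ length q)"
proof (cases "H > 0")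
  case False
  then have "H = 0" by (simp add: not_less measure_le_0_iff)
  then show ?thesis by (simp add: pair_integral_null[OF _ pq])
next
  case H: True
  obtain g' g'' where d: "\<And>r. r \<in> {r0..r1} \<Longrightarrow> (g has_vector_derivative g' r) (at r)"
    "\<And>r. r \<in> {r0..r1} \<Longrightarrow> (g' has_vector_derivative g'' r) (at r)"
    "\<And>r. r \<in> {r0..r1} \<Longrightarrow> norm (g'' r) + norm (g' r) / r \<le> B"
    using bd unfolding radial_C2_bound_def by blast
  define z0 where "z0 = bary p - bary q"
  define L where "L v = (inner z0 v / norm z0) *\<^sub>R g' (norm z0)" for v
  have L: "bounded_linear L"
    unfolding L_def divide_inverse
    by (intro bounded_linear_scaleR_const bounded_linear_mult_const bounded_linear_inner_right)
  define V where "V z = (fst z - bary p) - (snd z - bary q)" for z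
  note cen = pair_integral_centred[OF pq H, folded V_def]
  have Lc: "pair_integral p q (\<lambda>z. L (V z)) = 0"
  proof -
    have "pair_integral p q (\<lambda>z. L (V z)) = (\<integral>z. L (indicator (cell p \<times> cell q) z *\<^sub>R V z) \<partial>P)"
      unfolding pair_integral_def by (simp add: linear_simps(5)[OF L])
    also have "\<dots> = L (\<integral>z. indicator (cell p \<times> cell q) z *\<^sub>R V z \<partial>P)"
      by (rule integral_bounded_linear[OF L cen(1)])
    finally show ?thesis using cen(2) by (simp add: linear_simps(3)[OF L])
  qed
  have bp: "bary p \<in> hull_cell p" "bary q \<in> hull_cell q"
    using barycentre_in_hull pq H by auto
  have ne: "bary p \<noteq> bary q" using sep[OF bp] r0 by auto
  have pt: "norm (F x y - F (bary p) (bary q) - L (V (x, y))) \<le> B * (2 * h)\<^sup>2"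
    if xy: "x \<in> cell p" "y \<in> cell q" for x y
  proof -
    have xy': "x \<in> hull_cell p" "y \<in> hull_cell q" using xy word_map_hull_superset by auto
    have "x \<noteq> y" using sep[OF xy'] r0 by auto
    have seg: "norm (z0 + t *\<^sub>R V (x, y)) \<in> {r0..r1}" if t: "t \<in> {0..1}" for t
    proof -
      have "z0 + t *\<^sub>R V (x, y) = ((1 - t) *\<^sub>R bary p + t *\<^sub>R x) - ((1 - t) *\<^sub>R bary q + t *\<^sub>R y)"
        by (simp add: z0_def V_def algebra_simps)
      moreover have "(1 - t) *\<^sub>R bary p + t *\<^sub>R x \<in> hull_cell p"
        using t bp xy' hull_cell_closed_convex(2)[OF pq(1)] by (intro convexD) auto
      moreover have "(1 - t) *\<^sub>R bary q + t *\<^sub>R y \<in> hull_cell q"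
        using t bp xy' hull_cell_closed_convex(2)[OF pq(2)] by (intro convexD) auto
      ultimately show ?thesis using sep by (simp add: dist_norm)
    qed
    have "norm (g (norm (z0 + V (x, y))) - g (norm z0) - (inner z0 (V (x, y)) / norm z0) *\<^sub>R g' (norm z0))
        \<le> B * (norm (V (x, y)))\<^sup>2"
      by (rule radial_taylor[OF d r0 seg])
    moreover have "g (norm (z0 + V (x, y))) = F x y" "g (norm z0) = F (bary p) (bary q)"
      using g[OF \<open>x \<noteq> y\<close>] g[OF ne] by (simp_all add: z0_def V_def dist_norm)
    moreover have "B * (norm (V (x, y)))\<^sup>2 \<le> B * (2 * h)\<^sup>2"
    proof (rule mult_left_mono)
      have "norm (V (x, y)) \<le> dist x (bary p) + dist y (bary q)"
        unfolding V_def dist_norm fst_conv snd_conv by (rule norm_triangle_ineq4)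
      also have "\<dots> \<le> 2 * h"
        using dist_hull_cell_le[OF pq(1) xy'(1) bp(1)] dist_hull_cell_le[OF pq(2) xy'(2) bp(2)] h by simp
      finally show "(norm (V (x, y)))\<^sup>2 \<le> (2 * h)\<^sup>2" by (intro power_mono) auto
      have "norm (g'' r) + norm (g' r) / r \<ge> 0" if "r \<in> {r0..r1}" for r
        using that r0 by auto
      from order.trans[OF this d(3)] show "0 \<le> B" using sep[OF bp] by blast
    qed
    ultimately show ?thesis unfolding L_def by simp
  qed
  let ?c = "F (bary p) (bary q)"
  let ?F = "\<lambda>z. F (fst z) (snd z)"
  let ?I = "indicator (cell p \<times> cell q)"
  have i1: "integrable P (\<lambda>z. ?I z *\<^sub>R ?F z)" by (rule integrable_cells[OF pq F])
  have i2: "integrable P (\<lambda>z. ?I z *\<^sub>R ?c)" by (rule integrable_cells[OF pq]) simp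
  have i3: "integrable P (\<lambda>z. ?I z *\<^sub>R L (V z))"
    using integrable_bounded_linear[OF L cen(1)] by (simp add: linear_simps(5)[OF L])
  define G where "G z = ?I z *\<^sub>R (?F z - ?c - L (V z))" for z
  have G: "integrable P G" unfolding G_def scaleR_diff_right
    by (intro Bochner_Integration.integrable_diff i1 i2 i3)
  have "pair_integral p q G = (\<integral>z. ?I z *\<^sub>R ?F z - ?I z *\<^sub>R ?c - ?I z *\<^sub>R L (V z) \<partial>P)"
    unfolding pair_integral_def G_def
    by (rule Bochner_Integration.integral_cong) (auto simp: indicator_def)
  also have "\<dots> = pair_integral p q ?F - pair_integral p q (\<lambda>_. ?c) - pair_integral p q (\<lambda>z. L (V z))"
    unfolding pair_integral_def using i1 i2 i3
    by (subst Bochner_Integration.integral_diff Bochner_Integration.integrable_diff, assumption?)+ (auto intro: Bochner_Integration.integrable_diff)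
  finally have "pair_integral p q ?F - ((H / real M ^ length p) * (H / real M ^ length q)) *\<^sub>R ?c = pair_integral p q G"
    by (simp add: Lc pair_integral_const[OF pq])
  also have "norm \<dots> \<le> B * (2 * h)\<^sup>2 * (H / real M ^ length p) * (H / real M ^ length q)"
    by (rule pair_integral_bound[OF pq G]) (use pt in \<open>simp add: G_def\<close>)
  also have "B * (2 * h)\<^sup>2 = 4 * B * h\<^sup>2" by (simp add: power_mult_distrib)
  finally show ?thesis .
qed

end

section \<open>Summation over cells and singular kernels\<close>

context hull_disjoint_ifs
begin

definition weight :: "nat list \<Rightarrow> real" where "weight w = H / real M ^ length w"

lemma weight_nonneg: "0 \<le> weight w" by (simp add: weight_def)

lemma weight_append: "weight (w @ u) = weight w / real M ^ length u"
  by (simp add: weight_def power_add)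

lemma sum_weight_words: "(\<Sum>u\<in>words l. weight (w @ u)) = weight w"
proof -
  have "(\<Sum>u\<in>words l. weight (w @ u)) = (\<Sum>u\<in>words l. weight w / real M ^ l)"
    by (rule sum.cong) (auto simp: weight_append words_def)
  then show ?thesis using M_pos by (simp add: card_words)
qed

abbreviation Q :: "real \<Rightarrow> nat list \<Rightarrow> nat list \<Rightarrow> ('a \<Rightarrow> 'a \<Rightarrow> 'b::{banach, second_countable_topology}) \<Rightarrow> 'b"
  where "Q h a b f \<equiv> Q_bary M s \<Gamma> sim_dim h a b f"

abbreviation kernel :: "('a \<Rightarrow> 'a \<Rightarrow> 'b) \<Rightarrow> 'a \<times> 'a \<Rightarrow> 'b" where
  "kernel F \<equiv> (\<lambda>z. F (fst z) (snd z))"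

lemma Q_eq:
  assumes h: "h > 0" and ab: "set a \<subseteq> {1..M}" "set b \<subseteq> {1..M}"
  shows "Q h a b f = (\<Sum>u\<in>words (level h - length a). \<Sum>v\<in>words (level h - length b).
    (weight (a @ u) * weight (b @ v)) *\<^sub>R f (bary (a @ u)) (bary (b @ v)))"
  unfolding Q_bary_def L_index_eq_words[OF h ab(1)] L_index_eq_words[OF h ab(2)]
  using ab by (intro sum.cong refl) (auto simp: words_def Hd_eq weight_def)

text \<open>
  Every pair of descendants is at least as far apart as the two ancestors, so the pairwise
  bounds add up.
\<close>

lemma off_diagonal_error:
  fixes F :: "'a \<Rightarrow> 'a \<Rightarrow> 'b::{banach, second_countable_topology}"
  assumes ab: "set a \<subseteq> {1..M}" "set b \<subseteq> {1..M}" and h: "h > 0"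
    and F: "integrable P (kernel F)" and g: "\<And>x y. x \<noteq> y \<Longrightarrow> F x y = g (dist x y)"
    and bd: "radial_C2_bound g r0 r1 B" and r0: "0 < r0"
    and sep: "\<And>x y. x \<in> hull_cell a \<Longrightarrow> y \<in> hull_cell b \<Longrightarrow> dist x y \<in> {r0..r1}"
  shows "norm (pair_integral a b (kernel F) - Q h a b F) \<le> 4 * B * h\<^sup>2 * (weight a * weight b)"
proof -
  let ?U = "words (level h - length a)" and ?V = "words (level h - length b)"
  let ?e = "\<lambda>u v. pair_integral (a @ u) (b @ v) (kernel F)
      - (weight (a @ u) * weight (b @ v)) *\<^sub>R F (bary (a @ u)) (bary (b @ v))"
  have e: "norm (?e u v) \<le> 4 * B * h\<^sup>2 * (weight (a @ u) * weight (b @ v))"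
    if uv: "u \<in> ?U" "v \<in> ?V" for u v
  proof -
    have au: "set (a @ u) \<subseteq> {1..M}" "set (b @ v) \<subseteq> {1..M}" using uv ab by (auto simp: words_def)
    have sep': "dist x y \<in> {r0..r1}" if "x \<in> hull_cell (a @ u)" "y \<in> hull_cell (b @ v)" for x y
      using that word_map_append_hull_subset[OF ab(1), of u] word_map_append_hull_subset[OF ab(2), of v] au
      by (intro sep) auto
    have "\<rho> ^ length (a @ u) * D \<le> h" "\<rho> ^ length (b @ v) * D \<le> h"
      using uv by (auto simp: level_le_iff[OF h, symmetric] words_def)
    from cell_pair_error[OF au F g bd r0 sep' this] show ?thesis
      by (simp add: weight_def mult.assoc)
  qed
  have eq: "pair_integral a b (kernel F) - Q h a b F = (\<Sum>u\<in>?U. \<Sum>v\<in>?V. ?e u v)"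
    unfolding pair_integral_split[OF ab F, where k = "level h - length a" and l = "level h - length b"] Q_eq[OF h ab]
    by (simp add: sum_subtractf)
  have "norm (pair_integral a b (kernel F) - Q h a b F) \<le> (\<Sum>u\<in>?U. \<Sum>v\<in>?V. 4 * B * h\<^sup>2 * (weight (a @ u) * weight (b @ v)))"
    unfolding eq by (intro order.trans[OF norm_sum] sum_mono e)
  also have "\<dots> = 4 * B * h\<^sup>2 * ((\<Sum>u\<in>?U. weight (a @ u)) * (\<Sum>v\<in>?V. weight (b @ v)))"
    unfolding sum_product by (simp add: sum_distrib_left)
  finally show ?thesis by (simp add: sum_weight_words)
qed

lemma sum_words_Suc: "(\<Sum>w\<in>words (Suc n). f w) = (\<Sum>m\<in>{1..M}. \<Sum>u\<in>words n. f (m # u))"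
proof -
  have "words (Suc n) = (\<lambda>(m, u). m # u) ` ({1..M} \<times> words n)"
    unfolding words_def by (auto simp: length_Suc_conv image_iff)
  moreover have "inj_on (\<lambda>(m, u). m # u) ({1..M} \<times> words n)" by (auto simp: inj_on_def)
  ultimately show ?thesis by (simp add: sum.reindex sum.cartesian_product split_def)
qed

lemma Q_split:
  assumes h: "h > 0" and ab: "set a \<subseteq> {1..M}" "set b \<subseteq> {1..M}"
    and l: "length a < level h" "length b < level h"
  shows "Q h a b f = (\<Sum>m\<in>{1..M}. \<Sum>m'\<in>{1..M}. Q h (a @ [m]) (b @ [m']) f)"
proof -
  obtain k k' where k: "level h - length a = Suc k" "level h - length b = Suc k'"
    using l by (metis Suc_diff_Suc)
  then have k': "level h - length (a @ [m]) = k" "level h - length (b @ [m]) = k'" for m by auto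
  have "Q h a b f = (\<Sum>m\<in>{1..M}. \<Sum>u\<in>words k. \<Sum>m'\<in>{1..M}. \<Sum>v\<in>words k'.
    (weight (a @ m # u) * weight (b @ m' # v)) *\<^sub>R f (bary (a @ m # u)) (bary (b @ m' # v)))"
    unfolding Q_eq[OF h ab] k sum_words_Suc ..
  also have "\<dots> = (\<Sum>m\<in>{1..M}. \<Sum>m'\<in>{1..M}. \<Sum>u\<in>words k. \<Sum>v\<in>words k'.
    (weight (a @ m # u) * weight (b @ m' # v)) *\<^sub>R f (bary (a @ m # u)) (bary (b @ m' # v)))"
    by (intro sum.cong refl sum.swap)
  also have "\<dots> = (\<Sum>m\<in>{1..M}. \<Sum>m'\<in>{1..M}. Q h (a @ [m]) (b @ [m']) f)"
  proof (intro sum.cong refl)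
    fix m m' assume m: "m \<in> {1..M}" "m' \<in> {1..M}"
    have am: "set (a @ [m]) \<subseteq> {1..M}" "set (b @ [m']) \<subseteq> {1..M}" using ab m by auto
    show "(\<Sum>u\<in>words k. \<Sum>v\<in>words k'.
        (weight (a @ m # u) * weight (b @ m' # v)) *\<^sub>R f (bary (a @ m # u)) (bary (b @ m' # v)))
        = Q h (a @ [m]) (b @ [m']) f"
      unfolding Q_eq[OF h am] k' by simp
  qed
  finally show ?thesis .
qed

lemma pair_integral_split1:
  fixes F :: "'a \<times> 'a \<Rightarrow> 'b::{banach, second_countable_topology}"
  assumes ab: "set a \<subseteq> {1..M}" "set b \<subseteq> {1..M}" and F: "integrable P F"
  shows "pair_integral a b F = (\<Sum>m\<in>{1..M}. \<Sum>m'\<in>{1..M}. pair_integral (a @ [m]) (b @ [m']) F)"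
  unfolding pair_integral_split[OF ab F, of 1 1] One_nat_def sum_words_Suc by simp

lemma sum_diag_off_diag:
  "(\<Sum>m\<in>{1..M}. \<Sum>m'\<in>{1..M}. f m m') = (\<Sum>m\<in>{1..M}. f m m) + (\<Sum>m\<in>{1..M}. \<Sum>m'\<in>{1..M} - {m}. f m m' :: 'c::comm_monoid_add)"
  unfolding sum.distrib[symmetric] by (rule sum.cong) (auto intro: sum.remove)

lemma sum_off_diag_le:
  assumes "\<And>m m'. m \<in> {1..M} \<Longrightarrow> m' \<in> {1..M} \<Longrightarrow> m \<noteq> m' \<Longrightarrow> f m m' \<le> (c::real)"
  shows "(\<Sum>m\<in>{1..M}. \<Sum>m'\<in>{1..M} - {m}. f m m') \<le> real M * (real M - 1) * c"
proof -
  have "(\<Sum>m\<in>{1..M}. \<Sum>m'\<in>{1..M} - {m}. f m m') \<le> (\<Sum>m\<in>{1..M}. \<Sum>m'\<in>{1..M} - {m}. c)"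
    using assms by (intro sum_mono) auto
  also have "\<dots> = real M * (real M - 1) * c"
    using M_pos by (simp add: of_nat_diff)
  finally show ?thesis .
qed

text \<open>
  Recursion over the levels: the pair of a cell with itself splits into \<open>M\<close> pairs
  of the same kind and \<open>M (M - 1)\<close> pairs of siblings.  Each of the former carries
  the mass squared divided by \<open>M^2\<close>, so a descent by one level multiplies the error
  by \<open>1/M\<close>.
\<close>

lemma diagonal_error:
  fixes F :: "'a \<Rightarrow> 'a \<Rightarrow> 'b::{banach, second_countable_topology}"
  assumes h: "h > 0" and F: "integrable P (kernel F)"
    and off: "\<And>v m m'. \<lbrakk>set v \<subseteq> {1..M}; length w \<le> length v; m \<in> {1..M}; m' \<in> {1..M}; m \<noteq> m'\<rbrakk> \<Longrightarrow>
      norm (pair_integral (v @ [m]) (v @ [m']) (kernel F) - Q h (v @ [m]) (v @ [m']) F)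
        \<le> b (length v) * (weight (v @ [m]) * weight (v @ [m']))"
    and b: "\<And>j. 0 \<le> b j"
    and diag: "\<And>v. \<lbrakk>set v \<subseteq> {1..M}; length v = length w + (level h - length w)\<rbrakk> \<Longrightarrow>
      norm (pair_integral v v (kernel F) - (weight v)\<^sup>2 *\<^sub>R F (bary v) (bary v)) \<le> \<beta> * (weight v)\<^sup>2"
    and w: "set w \<subseteq> {1..M}"
  shows "norm (pair_integral w w (kernel F) - Q h w w F) \<le>
    (weight w)\<^sup>2 * ((\<Sum>j<level h - length w. b (length w + j) / real M ^ j)
      + \<beta> / real M ^ (level h - length w))"
  using off diag w
proof (induction "level h - length w" arbitrary: w)
  case 0
  then have l: "level h - length w = 0" by simp
  have "Q h w w F = (weight w)\<^sup>2 *\<^sub>R F (bary w) (bary w)"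
    unfolding Q_eq[OF h 0(4) 0(4)] l by (simp add: power2_eq_square)
  then show ?case using 0(3)[OF 0(4)] l by (simp add: mult.commute)
next
  case (Suc n)
  note off = Suc.prems(1) and diag = Suc.prems(2) and w = Suc.prems(3)
  have n: "level h - length w = Suc n" using Suc.hyps by simp
  define X where "X = (\<Sum>j<n. b (Suc (length w) + j) / real M ^ j) + \<beta> / real M ^ n"
  let ?e = "\<lambda>m m'. pair_integral (w @ [m]) (w @ [m']) (kernel F) - Q h (w @ [m]) (w @ [m']) F"
  let ?W = "(weight w)\<^sup>2"
  have wm: "weight (w @ [m]) = weight w / real M" for m by (simp add: weight_append)
  have d: "norm (?e m m) \<le> ?W / (real M)\<^sup>2 * X" if m: "m \<in> {1..M}" for m
  proof -
    have wm': "level h - length (w @ [m]) = n" using n by simp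
    have "norm (?e m m) \<le> (weight (w @ [m]))\<^sup>2 *
      ((\<Sum>j<level h - length (w @ [m]). b (length (w @ [m]) + j) / real M ^ j)
      + \<beta> / real M ^ (level h - length (w @ [m])))"
    proof (rule Suc.hyps(1))
      show "n = level h - length (w @ [m])" using wm' by simp
      show "set (w @ [m]) \<subseteq> {1..M}" using w m by simp
    next
      fix v m1 m2 assume "set v \<subseteq> {1..M}" "length (w @ [m]) \<le> length v" "m1 \<in> {1..M}" "m2 \<in> {1..M}" "m1 \<noteq> m2"
      then show "norm (pair_integral (v @ [m1]) (v @ [m2]) (kernel F) - Q h (v @ [m1]) (v @ [m2]) F)
        \<le> b (length v) * (weight (v @ [m1]) * weight (v @ [m2]))" by (intro off) auto
    next
      fix v assume "set v \<subseteq> {1..M}" "length v = length (w @ [m]) + (level h - length (w @ [m]))"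
      then show "norm (pair_integral v v (kernel F) - (weight v)\<^sup>2 *\<^sub>R F (bary v) (bary v)) \<le> \<beta> * (weight v)\<^sup>2"
        using n by (intro diag) auto
    qed
    then show ?thesis unfolding wm' wm X_def by (simp add: power_divide)
  qed
  have o: "norm (?e m m') \<le> ?W / (real M)\<^sup>2 * b (length w)" if m: "m \<in> {1..M}" "m' \<in> {1..M}" "m \<noteq> m'" for m m'
    using off[OF w _ m] unfolding wm by (simp add: power2_eq_square mult.commute)
  have "pair_integral w w (kernel F) - Q h w w F = (\<Sum>m\<in>{1..M}. \<Sum>m'\<in>{1..M}. ?e m m')"
    using n unfolding pair_integral_split1[OF w w F]
    by (subst Q_split[OF h w w]) (auto simp: sum_subtractf)
  also have "\<dots> = (\<Sum>m\<in>{1..M}. ?e m m) + (\<Sum>m\<in>{1..M}. \<Sum>m'\<in>{1..M} - {m}. ?e m m')"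
    by (rule sum_diag_off_diag)
  finally have eq: "pair_integral w w (kernel F) - Q h w w F
      = (\<Sum>m\<in>{1..M}. ?e m m) + (\<Sum>m\<in>{1..M}. \<Sum>m'\<in>{1..M} - {m}. ?e m m')" .
  have "norm (pair_integral w w (kernel F) - Q h w w F) \<le> (\<Sum>m\<in>{1..M}. norm (?e m m)) + (\<Sum>m\<in>{1..M}. \<Sum>m'\<in>{1..M} - {m}. norm (?e m m'))"
    unfolding eq
    by (intro order.trans[OF norm_triangle_ineq] add_mono order.trans[OF norm_sum] sum_mono order.refl)
  also have "\<dots> \<le> real M * (?W / (real M)\<^sup>2 * X) + real M * (real M - 1) * (?W / (real M)\<^sup>2 * b (length w))"
  proof (intro add_mono sum_off_diag_le o)
    have "(\<Sum>m\<in>{1..M}. norm (?e m m)) \<le> (\<Sum>m\<in>{1..M}. ?W / (real M)\<^sup>2 * X)" by (intro sum_mono d)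
    then show "(\<Sum>m\<in>{1..M}. norm (?e m m)) \<le> real M * (?W / (real M)\<^sup>2 * X)" by simp
  qed auto
  also have "\<dots> = ?W * (X / real M + (1 - 1 / real M) * b (length w))"
    using M_pos by (simp add: field_simps power2_eq_square)
  also have "\<dots> \<le> ?W * (X / real M + 1 * b (length w))"
    using M_pos b by (intro mult_left_mono add_mono mult_right_mono) auto
  also have "X / real M + 1 * b (length w) =
      (\<Sum>j<level h - length w. b (length w + j) / real M ^ j) + \<beta> / real M ^ (level h - length w)"
    unfolding n X_def sum.lessThan_Suc_shift
    by (simp add: add_divide_distrib sum_divide_distrib mult.commute)
  finally show ?case .
qed

lemma AE_P_attractor: "AE z in P. z \<in> \<Gamma> \<times> \<Gamma>"
proof -
  have 1: "AE x in nu. x \<in> \<Gamma>"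
    unfolding nu_def by (simp add: AE_density indicator_def)
  have "AE x in nu. AE y in nu. (x, y) \<in> \<Gamma> \<times> \<Gamma>" using 1 by eventually_elim (use 1 in auto)
  moreover have "{z \<in> space P. z \<in> \<Gamma> \<times> \<Gamma>} \<in> sets P"
  proof -
    have "\<Gamma> \<times> \<Gamma> \<in> sets P" by (intro pair_measureI) auto
    moreover have "{z \<in> space P. z \<in> \<Gamma> \<times> \<Gamma>} = \<Gamma> \<times> \<Gamma>" by (auto simp: space_pair_measure)
    ultimately show ?thesis by simp
  qed
  ultimately show ?thesis by (intro nuP.AE_pair_measure) auto
qed

lemma pair_integral_Nil:
  fixes F :: "'a \<times> 'a \<Rightarrow> 'b::{banach, second_countable_topology}"
  assumes "F \<in> borel_measurable P"
  shows "pair_integral [] [] F = (\<integral>z. F z \<partial>P)"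
  unfolding pair_integral_def
proof (rule integral_cong_AE)
  have "\<Gamma> \<times> \<Gamma> \<in> sets P" by (intro pair_measureI) auto
  then show "(\<lambda>z. indicator (cell [] \<times> cell []) z *\<^sub>R F z) \<in> borel_measurable P"
    using assms by (intro borel_measurable_scaleR borel_measurable_indicator) auto
  show "AE z in P. indicator (cell [] \<times> cell []) z *\<^sub>R F z = F z"
    using AE_P_attractor by eventually_elim (simp add: indicator_def)
qed fact

lemma integral_P_const:
  fixes c :: "'b::{banach, second_countable_topology}"
  shows "(\<integral>z. c \<partial>P) = H\<^sup>2 *\<^sub>R c"
  using pair_integral_const[of "[]" "[]" c] pair_integral_Nil[of "\<lambda>_. c"] by (simp add: power2_eq_square)

text \<open>
  Truncating the kernel at height \<open>n\<close> makes the double integral \<open>J n\<close>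
  finite.  Self-similarity of the diagonal blocks gives \<open>J n \<le> (\<alpha>/M) J n +
  const\<close>, which can be solved because \<open>\<alpha> < M\<close>; the bound is uniform
  in \<open>n\<close> and monotone convergence finishes the argument.
\<close>

lemma singular_kernel_integrable:
  fixes K :: "'a \<Rightarrow> 'a \<Rightarrow> real"
  assumes meas: "kernel K \<in> borel_measurable P" and K0: "\<And>x y. 0 \<le> K x y"
    and \<alpha>: "1 \<le> \<alpha>" "\<alpha> < real M" and \<beta>: "0 \<le> \<beta>"
    and contr: "\<And>m x y. \<lbrakk>m \<in> {1..M}; x \<noteq> y\<rbrakk> \<Longrightarrow> K (s m x) (s m y) \<le> \<alpha> * K x y + \<beta>"
    and off: "\<And>m m' x y. \<lbrakk>m \<in> {1..M}; m' \<in> {1..M}; m \<noteq> m'; x \<in> cell [m]; y \<in> cell [m']\<rbrakk> \<Longrightarrow> K x y \<le> c"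
  shows "integrable P (kernel K)"
proof -
  \<comment> \<open>The truncation satisfies the same contraction inequality because \<open>\<alpha> \<ge> 1\<close>.\<close>
  define G where "G n z = min (kernel K z) (real n)" for n z
  have G_meas: "G n \<in> borel_measurable P" for n
    unfolding G_def using meas by measurable
  have G_int: "integrable P (G n)" for n
    by (rule P.integrable_const_bound[where B = "real n"]) (use G_meas K0 in \<open>auto simp: G_def\<close>)
  define J where "J n = (\<integral>z. G n z \<partial>P)" for n
  have bound: "J n \<le> (\<beta> / real M + \<bar>c\<bar>) * H\<^sup>2 / (1 - \<alpha> / real M)" for n
  proof -
    have diag: "pair_integral [m] [m] (G n) \<le> (\<alpha> * J n + \<beta> * H\<^sup>2) / (real M)\<^sup>2" if m: "m \<in> {1..M}" for m
    proof -
      have m': "set [m] \<subseteq> {1..M}" using m by simp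
      have "(\<integral>z. G n (pair_map [m] z) \<partial>P) \<le> (\<integral>z. \<alpha> * G n z + \<beta> \<partial>P)"
      proof (rule integral_mono_AE)
        show "integrable P (\<lambda>z. G n (pair_map [m] z))"
          using measurable_compose[OF pair_map_measurable[OF m'] G_meas]
          by (intro P.integrable_const_bound[where B = "real n"]) (use K0 in \<open>auto simp: G_def\<close>)
        show "integrable P (\<lambda>z. \<alpha> * G n z + \<beta>)" using G_int by auto
        show "AE z in P. G n (pair_map [m] z) \<le> \<alpha> * G n z + \<beta>"
          using AE_P_off_diagonal
        proof eventually_elim
          case (elim z)
          have "K (s m (fst z)) (s m (snd z)) \<le> \<alpha> * kernel K z + \<beta>" using contr[OF m elim] by simp
          moreover have "real n \<le> \<alpha> * real n + \<beta>" using \<alpha> \<beta> mult_right_mono[of 1 \<alpha> "real n"] by simp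
          ultimately show ?case
            using \<alpha> by (auto simp: G_def pair_map_def word_map_single min_def)
        qed
      qed
      also have "\<dots> = \<alpha> * J n + \<beta> * H\<^sup>2"
      proof -
        have "(\<integral>z. \<alpha> * G n z + \<beta> \<partial>P) = (\<integral>z. \<alpha> * G n z \<partial>P) + (\<integral>z. \<beta> \<partial>P)"
          using G_int by (intro Bochner_Integration.integral_add) auto
        then show ?thesis unfolding integral_P_const by (simp add: J_def)
      qed
      finally show ?thesis
        unfolding pair_integral_def integral_P_cell[OF m' G_meas] using M_pos
        by (simp add: power2_eq_square divide_right_mono)
    qed
    have od: "pair_integral [m] [m'] (G n) \<le> \<bar>c\<bar> * (H / real M)\<^sup>2"
      if m: "m \<in> {1..M}" "m' \<in> {1..M}" "m \<noteq> m'" for m m'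
    proof -
      have "norm (pair_integral [m] [m'] (G n)) \<le> \<bar>c\<bar> * (H / real M ^ length [m]) * (H / real M ^ length [m'])"
      proof (rule pair_integral_bound[OF _ _ G_int])
        fix x y assume "x \<in> cell [m]" "y \<in> cell [m']"
        from off[OF m this] K0[of x y] show "norm (G n (x, y)) \<le> \<bar>c\<bar>" by (auto simp: G_def)
      qed (use m in auto)
      then show ?thesis by (simp add: power2_eq_square)
    qed
    have "J n = (\<Sum>m\<in>{1..M}. \<Sum>m'\<in>{1..M}. pair_integral [m] [m'] (G n))"
      using pair_integral_split1[of "[]" "[]", OF _ _ G_int] pair_integral_Nil[OF G_meas] by (simp add: J_def)
    also have "\<dots> = (\<Sum>m\<in>{1..M}. pair_integral [m] [m] (G n))
        + (\<Sum>m\<in>{1..M}. \<Sum>m'\<in>{1..M} - {m}. pair_integral [m] [m'] (G n))"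
      by (rule sum_diag_off_diag)
    also have "\<dots> \<le> (\<Sum>m\<in>{1..M}. (\<alpha> * J n + \<beta> * H\<^sup>2) / (real M)\<^sup>2)
        + real M * (real M - 1) * (\<bar>c\<bar> * (H / real M)\<^sup>2)"
      by (intro add_mono sum_mono diag sum_off_diag_le od)
    also have "\<dots> = \<alpha> / real M * J n + (\<beta> / real M + (1 - 1 / real M) * \<bar>c\<bar>) * H\<^sup>2"
      using M_pos by (simp add: field_simps power2_eq_square)
    also have "\<dots> \<le> \<alpha> / real M * J n + (\<beta> / real M + 1 * \<bar>c\<bar>) * H\<^sup>2"
      using M_pos by (intro add_left_mono mult_right_mono) auto
    finally have "J n * (1 - \<alpha> / real M) \<le> (\<beta> / real M + \<bar>c\<bar>) * H\<^sup>2" by (simp add: algebra_simps)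
    moreover have "0 < 1 - \<alpha> / real M" using \<alpha> M_pos by simp
    ultimately show ?thesis by (simp add: pos_le_divide_eq)
  qed
  have "incseq J"
    unfolding J_def incseq_def by (intro allI impI integral_mono G_int) (auto simp: G_def)
  then obtain L where L: "J \<longlonglongrightarrow> L" using incseq_convergent[of J] bound by blast
  show ?thesis
  proof (rule integrable_monotone_convergence[where f = G])
    show "AE z in P. mono (\<lambda>n. G n z)" by (auto simp: G_def mono_def)
    show "AE z in P. (\<lambda>n. G n z) \<longlonglongrightarrow> kernel K z"
    proof (rule AE_I2)
      fix z
      obtain N where "kernel K z \<le> real N" using real_arch_simple by blast
      then have "\<forall>\<^sub>F n in sequentially. G n z = kernel K z"
        unfolding eventually_sequentially G_def by (intro exI[of _ N]) (auto simp: min_def)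
      then show "(\<lambda>n. G n z) \<longlonglongrightarrow> kernel K z" by (rule tendsto_eventually)
    qed
    show "(\<lambda>n. integral\<^sup>L P (G n)) \<longlonglongrightarrow> L" using L by (simp add: J_def[abs_def])
  qed (use G_int meas in auto)
qed

text \<open>
  Exact integral \<open>I\<close> and rule \<open>Q\<close> both solve \<open>X = \<theta> X + Z
  + (sum over pairs of siblings)\<close>, so their difference is the error on the sibling pairs
  divided by \<open>1 - \<theta>\<close>.  There are \<open>M (M - 1)\<close> such pairs of mass
  squared over \<open>M^2\<close>, whence the factor \<open>1 - 1/M\<close>.
\<close>

lemma singular_rule_error:
  fixes F :: "'a \<Rightarrow> 'a \<Rightarrow> real"
  assumes w: "set w \<subseteq> {1..M}" and h: "h > 0"
    and F: "integrable P (kernel F)" and g: "\<And>x y. x \<noteq> y \<Longrightarrow> F x y = g (dist x y)"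
    and bd: "radial_C2_bound g (\<rho> ^ length w * R) (\<rho> ^ length w * D) B"
    and self: "(\<Sum>m\<in>{1..M}. pair_integral (w @ [m]) (w @ [m]) (kernel F)) = \<theta> * pair_integral w w (kernel F) + Z"
    and \<theta>: "\<theta> < 1" and B0: "0 \<le> B"
  shows "\<bar>pair_integral w w (kernel F)
      - (Z + (\<Sum>m\<in>{1..M}. \<Sum>m'\<in>{1..M} - {m}. Q h (w @ [m]) (w @ [m']) F)) / (1 - \<theta>)\<bar>
    \<le> (1 - 1 / real M) / (1 - \<theta>) * (4 * B * h\<^sup>2 * (weight w)\<^sup>2)"
proof -
  let ?I = "pair_integral w w (kernel F)"
  let ?e = "\<lambda>m m'. pair_integral (w @ [m]) (w @ [m']) (kernel F) - Q h (w @ [m]) (w @ [m']) F"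
  have e: "\<bar>?e m m'\<bar> \<le> 4 * B * h\<^sup>2 * (weight w / real M)\<^sup>2"
    if m: "m \<in> {1..M}" "m' \<in> {1..M}" "m \<noteq> m'" for m m'
  proof -
    have sep: "dist x y \<in> {\<rho> ^ length w * R..\<rho> ^ length w * D}"
      if xy: "x \<in> hull_cell (w @ [m])" "y \<in> hull_cell (w @ [m'])" for x y
    proof -
      have "x \<in> hull_cell w" "y \<in> hull_cell w"
        using xy word_map_append_hull_subset[OF w, of "[m]"] word_map_append_hull_subset[OF w, of "[m']"] m by auto
      then show ?thesis
        using dist_hull_cell_le[OF w] hull_dist_ge[OF w m, of "[]" "[]" x y] xy by simp
    qed
    have "norm (?e m m') \<le> 4 * B * h\<^sup>2 * (weight (w @ [m]) * weight (w @ [m']))"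
      by (rule off_diagonal_error[OF _ _ h F g bd _ sep]) (use w m rho_pos R_pos in auto)
    then show ?thesis by (simp add: weight_append power2_eq_square)
  qed
  have "?I = (\<theta> * ?I + Z) + (\<Sum>m\<in>{1..M}. \<Sum>m'\<in>{1..M} - {m}. pair_integral (w @ [m]) (w @ [m']) (kernel F))"
    unfolding self[symmetric]
    using pair_integral_split1[OF w w F]
      sum_diag_off_diag[of "\<lambda>m m'. pair_integral (w @ [m]) (w @ [m']) (kernel F)"] by (simp only:)
  then have "?I * (1 - \<theta>) - (Z + (\<Sum>m\<in>{1..M}. \<Sum>m'\<in>{1..M} - {m}. Q h (w @ [m]) (w @ [m']) F))
      = (\<Sum>m\<in>{1..M}. \<Sum>m'\<in>{1..M} - {m}. ?e m m')"
    by (simp add: sum_subtractf algebra_simps)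
  then have eq: "?I - (Z + (\<Sum>m\<in>{1..M}. \<Sum>m'\<in>{1..M} - {m}. Q h (w @ [m]) (w @ [m']) F)) / (1 - \<theta>)
      = (\<Sum>m\<in>{1..M}. \<Sum>m'\<in>{1..M} - {m}. ?e m m') / (1 - \<theta>)"
    using \<theta> by (simp add: field_simps)
  have "\<bar>\<Sum>m\<in>{1..M}. \<Sum>m'\<in>{1..M} - {m}. ?e m m'\<bar> \<le> (\<Sum>m\<in>{1..M}. \<Sum>m'\<in>{1..M} - {m}. \<bar>?e m m'\<bar>)"
    by (intro order.trans[OF sum_abs] sum_mono order.refl)
  also have "\<dots> \<le> real M * (real M - 1) * (4 * B * h\<^sup>2 * (weight w / real M)\<^sup>2)"
    by (intro sum_off_diag_le e)
  also have "\<dots> = (1 - 1 / real M) * (4 * B * h\<^sup>2 * (weight w)\<^sup>2)"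
    using M_pos by (simp add: field_simps power2_eq_square)
  finally show ?thesis
    unfolding eq using \<theta> by (simp add: abs_divide divide_right_mono)
qed

end

section \<open>Bessel functions of order zero\<close>

definition entire_series :: "(nat \<Rightarrow> real) \<Rightarrow> bool" where
  "entire_series c \<longleftrightarrow> (\<forall>z. summable (\<lambda>n. c n * z ^ n))"

definition pseries :: "(nat \<Rightarrow> real) \<Rightarrow> real \<Rightarrow> real" where
  "pseries c z = (\<Sum>n. c n * z ^ n)"

lemma entire_series_diffs: "entire_series c \<Longrightarrow> entire_series (diffs c)"
  unfolding entire_series_def using termdiff_converges_all[of c] by blast

lemma DERIV_pseries: "entire_series c \<Longrightarrow> (pseries c has_real_derivative pseries (diffs c) z) (at z)"
  unfolding entire_series_def pseries_def[abs_def] by (rule termdiffs_strong_converges_everywhere) blast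

lemma pseries_0: "pseries c 0 = c 0"
  unfolding pseries_def by (subst powser_zero) simp

lemma DERIV_pseries_square:
  assumes "entire_series c"
  shows "((\<lambda>x. pseries c (x\<^sup>2)) has_real_derivative 2 * x * pseries (diffs c) (x\<^sup>2)) (at x)"
proof -
  have "((\<lambda>x. x\<^sup>2) has_real_derivative 2 * x) (at x)" by (auto intro!: derivative_eq_intros)
  from DERIV_chain2[OF DERIV_pseries[OF assms] this] show ?thesis by (simp only: mult.commute)
qed

lemma DERIV_pseries_square2:
  assumes "entire_series c"
  shows "((\<lambda>x. 2 * x * pseries (diffs c) (x\<^sup>2)) has_real_derivative
    2 * pseries (diffs c) (x\<^sup>2) + 4 * x\<^sup>2 * pseries (diffs (diffs c)) (x\<^sup>2)) (at x)"
  by (rule derivative_eq_intros DERIV_pseries_square[OF entire_series_diffs[OF assms]] refl)+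
    (simp add: power2_eq_square)

text \<open>
  For \<open>y x = f (x^2)\<close> the Bessel operator \<open>y'' + y'/x + y\<close> becomes
  \<open>4 z f'' + 4 f' + f\<close> at \<open>z = x^2\<close>; this is its action on
  coefficients.
\<close>

lemma pseries_bessel_operator:
  assumes c: "entire_series c"
  shows "4 * z * pseries (diffs (diffs c)) z + 4 * pseries (diffs c) z + pseries c z
    = (\<Sum>n. (4 * (real n + 1)\<^sup>2 * c (Suc n) + c n) * z ^ n)"
proof -
  note s = c[unfolded entire_series_def, rule_format]
    entire_series_diffs[OF c, unfolded entire_series_def, rule_format]
    entire_series_diffs[OF entire_series_diffs[OF c], unfolded entire_series_def, rule_format]
  have "(\<lambda>n. diffs (diffs c) n * z ^ n * z) sums (pseries (diffs (diffs c)) z * z)"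
    unfolding pseries_def by (intro sums_mult2 summable_sums s)
  then have "(\<lambda>n. real (Suc n) * diffs c (Suc n) * z ^ Suc n) sums (pseries (diffs (diffs c)) z * z)"
    by (simp add: diffs_def mult_ac)
  then have a: "(\<lambda>n. real n * diffs c n * z ^ n) sums (pseries (diffs (diffs c)) z * z)"
    using sums_Suc_iff[of "\<lambda>n. real n * diffs c n * z ^ n"] by simp
  have b: "(\<lambda>n. diffs c n * z ^ n) sums pseries (diffs c) z" "(\<lambda>n. c n * z ^ n) sums pseries c z"
    unfolding pseries_def by (intro summable_sums s)+
  have "(\<lambda>n. 4 * (real n * diffs c n * z ^ n) + 4 * (diffs c n * z ^ n) + c n * z ^ n)
    sums (4 * (pseries (diffs (diffs c)) z * z) + 4 * pseries (diffs c) z + pseries c z)"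
    by (intro sums_add sums_mult a b)
  also have "(\<lambda>n. 4 * (real n * diffs c n * z ^ n) + 4 * (diffs c n * z ^ n) + c n * z ^ n)
    = (\<lambda>n. (4 * (real n + 1)\<^sup>2 * c (Suc n) + c n) * z ^ n)"
    by (auto simp: fun_eq_iff diffs_def power2_eq_square algebra_simps)
  finally show ?thesis by (simp add: sums_iff mult_ac)
qed

text \<open>
  An even entire function, its first and its second derivative vanish on bounded intervals to
  orders 2, 1 and 0 once the constant term is removed.
\<close>

lemma pseries_square_bounds:
  assumes c: "entire_series c"
  shows "\<exists>K\<ge>0. \<forall>x\<in>{0..b}. \<bar>pseries c (x\<^sup>2) - c 0\<bar> \<le> K * x\<^sup>2 \<and>
    \<bar>2 * x * pseries (diffs c) (x\<^sup>2)\<bar> \<le> K * x \<and>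
    \<bar>2 * pseries (diffs c) (x\<^sup>2) + 4 * x\<^sup>2 * pseries (diffs (diffs c)) (x\<^sup>2)\<bar> \<le> K"
proof -
  have cont: "continuous_on A (pseries c)" if "entire_series c" for A c
    using DERIV_pseries[OF that] by (meson DERIV_atLeastAtMost_imp_continuous_on DERIV_isCont continuous_at_imp_continuous_on)
  have bdd: "\<exists>K\<ge>0. \<forall>z\<in>{0..b\<^sup>2}. \<bar>pseries c z\<bar> \<le> K" if "entire_series c" for c
  proof -
    have "bounded (pseries c ` {0..b\<^sup>2})"
      by (intro compact_imp_bounded compact_continuous_image cont that) simp
    then obtain K where K: "\<forall>y\<in>pseries c ` {0..b\<^sup>2}. norm y \<le> K" unfolding bounded_iff by blast
    then show ?thesis by (intro exI[of _ "max K 0"]) auto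
  qed
  obtain K1 where K1: "0 \<le> K1" "\<And>z. z \<in> {0..b\<^sup>2} \<Longrightarrow> \<bar>pseries (diffs c) z\<bar> \<le> K1"
    using bdd[OF entire_series_diffs[OF c]] by blast
  obtain K2 where K2: "0 \<le> K2" "\<And>z. z \<in> {0..b\<^sup>2} \<Longrightarrow> \<bar>pseries (diffs (diffs c)) z\<bar> \<le> K2"
    using bdd[OF entire_series_diffs[OF entire_series_diffs[OF c]]] by blast
  let ?K = "2 * K1 + 4 * b\<^sup>2 * K2"
  have "\<bar>pseries c (x\<^sup>2) - c 0\<bar> \<le> ?K * x\<^sup>2 \<and> \<bar>2 * x * pseries (diffs c) (x\<^sup>2)\<bar> \<le> ?K * x \<and>
    \<bar>2 * pseries (diffs c) (x\<^sup>2) + 4 * x\<^sup>2 * pseries (diffs (diffs c)) (x\<^sup>2)\<bar> \<le> ?K"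
    if x: "x \<in> {0..b}" for x
  proof (intro conjI)
    have xx: "x\<^sup>2 \<in> {0..b\<^sup>2}" using x by (auto intro!: power_mono)
    have "norm (pseries c (x\<^sup>2) - pseries c 0) \<le> K1 * norm (x\<^sup>2 - 0)"
      by (rule field_differentiable_bound[of "{0..b\<^sup>2}", where f' = "pseries (diffs c)"])
        (use xx K1 DERIV_pseries[OF c] in \<open>auto intro: has_field_derivative_at_within\<close>)
    also have "\<dots> \<le> ?K * x\<^sup>2" using K1 K2 by (auto intro!: mult_right_mono)
    finally show "\<bar>pseries c (x\<^sup>2) - c 0\<bar> \<le> ?K * x\<^sup>2" by (simp add: pseries_0)
    have "\<bar>2 * x * pseries (diffs c) (x\<^sup>2)\<bar> = 2 * \<bar>pseries (diffs c) (x\<^sup>2)\<bar> * x" using x by (simp add: abs_mult)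
    also have "\<dots> \<le> ?K * x"
    proof (rule mult_right_mono)
      have "0 \<le> 4 * b\<^sup>2 * K2" using K2(1) by simp
      then show "2 * \<bar>pseries (diffs c) (x\<^sup>2)\<bar> \<le> ?K" using K1(2)[OF xx] by linarith
    qed (use x in auto)
    finally show "\<bar>2 * x * pseries (diffs c) (x\<^sup>2)\<bar> \<le> ?K * x" .
    have "\<bar>4 * x\<^sup>2 * pseries (diffs (diffs c)) (x\<^sup>2)\<bar> = 4 * x\<^sup>2 * \<bar>pseries (diffs (diffs c)) (x\<^sup>2)\<bar>"
      by (simp add: abs_mult)
    also have "\<dots> \<le> 4 * b\<^sup>2 * K2"
      using K2 xx by (intro mult_mono) auto
    finally show "\<bar>2 * pseries (diffs c) (x\<^sup>2) + 4 * x\<^sup>2 * pseries (diffs (diffs c)) (x\<^sup>2)\<bar> \<le> ?K"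
      using K1(2)[OF xx] by linarith
  qed
  moreover have "0 \<le> ?K" using K1 K2 by simp
  ultimately show ?thesis by blast
qed

definition coeff_J :: "nat \<Rightarrow> real" where "coeff_J n = (-1) ^ n / (4 ^ n * (fact n)\<^sup>2)"
text \<open>
  Coefficients of the power series in the second solution of Bessel's equation.
\<close>

definition coeff_S :: "nat \<Rightarrow> real" where "coeff_S n = coeff_J n * harm n"

lemma coeff_J_bound: "\<bar>coeff_J n\<bar> * (1 + real n) \<le> 1 / fact n"
proof -
  have "1 + real n \<le> 4 ^ n"
  proof (induction n)
    case (Suc n) then show ?case by simp
  qed simp
  moreover have "(1::real) \<le> fact n" by (rule fact_ge_1)
  ultimately have "(1 + real n) * 1 \<le> 4 ^ n * fact n" by (intro mult_mono) auto
  then have "(1 + real n) * 1 * fact n \<le> 4 ^ n * fact n * fact n" by (rule mult_right_mono) simp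
  then have "(1 + real n) * fact n \<le> 4 ^ n * (fact n)\<^sup>2" by (simp add: power2_eq_square mult.assoc)
  then show ?thesis
    by (simp add: coeff_J_def abs_mult power_abs field_simps)
qed

lemma entire_series_coeffs: "entire_series coeff_J" "entire_series coeff_S"
proof -
  have sm: "summable (\<lambda>n. c n * z ^ n)" if "\<And>n. \<bar>c n\<bar> \<le> 1 / fact n" for c :: "nat \<Rightarrow> real" and z
  proof (rule summable_comparison_test')
    show "summable (\<lambda>n. inverse (fact n) * \<bar>z\<bar> ^ n)" by (rule summable_exp)
    show "norm (c n * z ^ n) \<le> inverse (fact n) * \<bar>z\<bar> ^ n" if "n \<ge> 0" for n
      using mult_right_mono[OF \<open>\<And>n. \<bar>c n\<bar> \<le> 1 / fact n\<close>[of n], of "\<bar>z\<bar> ^ n"]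
      by (simp add: abs_mult power_abs inverse_eq_divide)
  qed
  have "\<bar>coeff_J n\<bar> \<le> 1 / fact n" for n
    using coeff_J_bound[of n] mult_left_mono[of 1 "1 + real n" "\<bar>coeff_J n\<bar>"] by linarith
  then show "entire_series coeff_J" unfolding entire_series_def using sm by blast
  have "harm n \<le> real n" for n
  proof (induction n)
    case (Suc n)
    have "inverse (real (Suc n)) \<le> 1" by (simp add: inverse_eq_divide)
    then show ?case using Suc unfolding harm_Suc by simp
  qed (simp add: harm_expand)
  then have "\<bar>coeff_S n\<bar> \<le> \<bar>coeff_J n\<bar> * (1 + real n)" for n
    using harm_nonneg[of n, where 'a = real] unfolding coeff_S_def abs_mult
    by (intro mult_left_mono) (auto intro: add_increasing)
  then have "\<bar>coeff_S n\<bar> \<le> 1 / fact n" for n using coeff_J_bound order.trans by blast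
  then show "entire_series coeff_S" unfolding entire_series_def using sm by blast
qed

lemma coeff_J_Suc: "4 * (real n + 1)\<^sup>2 * coeff_J (Suc n) = - coeff_J n"
proof -
  have "(fact (Suc n))\<^sup>2 = (real n + 1)\<^sup>2 * (fact n)\<^sup>2"
    by (simp add: power2_eq_square algebra_simps)
  then show ?thesis by (simp add: coeff_J_def del: fact_Suc)
qed

text \<open>
  \<open>J\<^sub>0\<close> with its first two derivatives as even and odd power series, and
  likewise the series \<open>serS\<close> in \<open>Y\<^sub>0\<close>.
\<close>

definition besJ where "besJ x = pseries coeff_J (x\<^sup>2)"
definition besJ' where "besJ' x = 2 * x * pseries (diffs coeff_J) (x\<^sup>2)"
definition besJ'' where "besJ'' x = 2 * pseries (diffs coeff_J) (x\<^sup>2) + 4 * x\<^sup>2 * pseries (diffs (diffs coeff_J)) (x\<^sup>2)"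
definition serS where "serS x = pseries coeff_S (x\<^sup>2)"
definition serS' where "serS' x = 2 * x * pseries (diffs coeff_S) (x\<^sup>2)"
definition serS'' where "serS'' x = 2 * pseries (diffs coeff_S) (x\<^sup>2) + 4 * x\<^sup>2 * pseries (diffs (diffs coeff_S)) (x\<^sup>2)"

lemma DERIV_J_S:
  "(besJ has_real_derivative besJ' x) (at x)" "(besJ' has_real_derivative besJ'' x) (at x)"
  "(serS has_real_derivative serS' x) (at x)" "(serS' has_real_derivative serS'' x) (at x)"
  unfolding besJ_def[abs_def] besJ'_def[abs_def] besJ''_def serS_def[abs_def] serS'_def[abs_def] serS''_def
  by (rule DERIV_pseries_square DERIV_pseries_square2 entire_series_coeffs)+

lemma bessel_J0_eq: "bessel_J0 x = besJ x"
  unfolding bessel_J0_def besJ_def pseries_def coeff_J_def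
  by (intro arg_cong[where f = suminf] ext) (simp add: power_divide)

abbreviation eul :: real where "eul \<equiv> euler_mascheroni"

definition lg :: "real \<Rightarrow> real" where "lg x = ln (x / 2) + eul"

text \<open>
  \<open>Y\<^sub>0\<close> and its first two derivatives; \<open>lg\<close> is the logarithmic
  factor.
\<close>

definition besY where "besY x = 2 / pi * (lg x * besJ x - serS x)"
definition besY' where "besY' x = 2 / pi * (besJ x / x + lg x * besJ' x - serS' x)"
definition besY'' where "besY'' x = 2 / pi * (- besJ x / x\<^sup>2 + 2 * besJ' x / x + lg x * besJ'' x - serS'' x)"

lemma bessel_Y0_eq: "bessel_Y0 x = besY x"
proof -
  have "(\<Sum>j. (-1) ^ j * harm j * (x\<^sup>2 / 4) ^ j / (fact j)\<^sup>2) = serS x"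
    unfolding serS_def pseries_def coeff_S_def coeff_J_def
    by (intro arg_cong[where f = suminf] ext) (simp add: power_divide)
  then show ?thesis by (simp add: bessel_Y0_def bessel_J0_eq besY_def lg_def)
qed

lemma DERIV_Y:
  assumes "x > 0"
  shows "(besY has_real_derivative besY' x) (at x)" "(besY' has_real_derivative besY'' x) (at x)"
proof -
  have l: "(lg has_real_derivative 1 / x) (at x)"
    unfolding lg_def[abs_def] using assms by (auto intro!: derivative_eq_intros)
  have a: "((\<lambda>x. besJ x / x) has_real_derivative besJ' x / x - besJ x / x\<^sup>2) (at x)"
    using DERIV_divide[OF DERIV_J_S(1) DERIV_ident, of x] assms
    by (simp add: diff_divide_distrib power2_eq_square)
  show "(besY has_real_derivative besY' x) (at x)"
    unfolding besY_def[abs_def] besY'_def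
    by (rule DERIV_cong[OF DERIV_cmult[OF DERIV_diff[OF DERIV_mult[OF l DERIV_J_S(1)] DERIV_J_S(3)]]]) simp
  show "(besY' has_real_derivative besY'' x) (at x)"
    unfolding besY'_def[abs_def] besY''_def
    by (rule DERIV_cong[OF DERIV_cmult[OF DERIV_diff[OF DERIV_add[OF a DERIV_mult[OF l DERIV_J_S(2)]]
          DERIV_J_S(4)]]]) (simp add: algebra_simps)
qed

lemma bessel_ode_J: "x > 0 \<Longrightarrow> besJ'' x = - besJ' x / x - besJ x"
  using pseries_bessel_operator[OF entire_series_coeffs(1), of "x\<^sup>2"]
  by (simp add: coeff_J_Suc besJ_def besJ'_def besJ''_def)

text \<open>
  The harmonic numbers produce the inhomogeneity \<open>2 J\<^sub>0'/x\<close>, which cancels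
  the cross term from differentiating \<open>lg * J\<^sub>0\<close>.
\<close>

lemma bessel_ode_S: "x > 0 \<Longrightarrow> serS'' x = 2 * besJ' x / x - serS' x / x - serS x"
proof -
  assume x: "x > 0"
  have "(4 * (real n + 1)\<^sup>2 * coeff_S (Suc n) + coeff_S n) = 4 * diffs coeff_J n" for n
  proof -
    have "4 * (real n + 1)\<^sup>2 * coeff_S (Suc n) = (4 * (real n + 1)\<^sup>2 * coeff_J (Suc n)) * harm (Suc n)"
      by (simp add: coeff_S_def)
    also have "\<dots> = - coeff_J n * harm n - coeff_J n * inverse (real (Suc n))"
      unfolding coeff_J_Suc harm_Suc by (simp only: algebra_simps)
    also have "coeff_J n * inverse (real (Suc n)) = - (4 * (real n + 1)\<^sup>2 * coeff_J (Suc n)) * inverse (real (Suc n))"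
      unfolding coeff_J_Suc by simp
    also have "- (4 * (real n + 1)\<^sup>2 * coeff_J (Suc n)) * inverse (real (Suc n))
        = - (4 * ((real n + 1) * coeff_J (Suc n)))"
      by (simp add: power2_eq_square field_simps)
    finally show ?thesis by (simp add: coeff_S_def diffs_def algebra_simps)
  qed
  then have "(\<Sum>n. (4 * (real n + 1)\<^sup>2 * coeff_S (Suc n) + coeff_S n) * (x\<^sup>2) ^ n)
      = 4 * pseries (diffs coeff_J) (x\<^sup>2)"
    using entire_series_diffs[OF entire_series_coeffs(1)]
    by (simp add: pseries_def entire_series_def mult.assoc suminf_mult)
  with pseries_bessel_operator[OF entire_series_coeffs(2), of "x\<^sup>2"] x show ?thesis
    by (simp add: serS_def serS'_def serS''_def besJ'_def)
qed

lemma bessel_ode_Y: "x > 0 \<Longrightarrow> besY'' x = - besY' x / x - besY x"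
proof -
  assume x: "x > 0"
  show ?thesis
    unfolding besY''_def besY'_def besY_def bessel_ode_J[OF x] bessel_ode_S[OF x]
    using x by (simp add: field_simps power2_eq_square)
qed

text \<open>
  The energy \<open>y^2 + y'^2\<close> has derivative \<open>- 2 y'^2 / x \<le> 0\<close>, so
  \<open>y\<close> and \<open>y'\<close>, and through the equation also \<open>y''\<close>, stay
  bounded on \<open>[1, \<infinity>)\<close>.
\<close>

lemma bessel_energy_bound:
  fixes y y1 y2 :: "real \<Rightarrow> real"
  assumes d: "\<And>x. x > 0 \<Longrightarrow> (y has_real_derivative y1 x) (at x)"
    "\<And>x. x > 0 \<Longrightarrow> (y1 has_real_derivative y2 x) (at x)"
    and ode: "\<And>x. x > 0 \<Longrightarrow> y2 x = - y1 x / x - y x"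
  shows "\<exists>K\<ge>0. \<forall>x\<ge>1. \<bar>y2 x\<bar> + \<bar>y1 x\<bar> / x \<le> K"
proof -
  define E where "E x = (y x)\<^sup>2 + (y1 x)\<^sup>2" for x
  define K where "K = sqrt (E 1)"
  have E: "E x \<le> E 1" if "x \<ge> 1" for x
  proof (rule DERIV_nonpos_imp_nonincreasing[OF that])
    fix t assume t: "1 \<le> t" "t \<le> x"
    then have "t > 0" by simp
    have "(E has_real_derivative 2 * y t * y1 t + 2 * y1 t * y2 t) (at t)"
      unfolding E_def[abs_def] using d[OF \<open>t > 0\<close>]
      by (auto intro!: derivative_eq_intros)
    moreover have "2 * y t * y1 t + 2 * y1 t * y2 t \<le> 0"
      unfolding ode[OF \<open>t > 0\<close>] using \<open>t > 0\<close> by (simp add: algebra_simps)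
    ultimately show "\<exists>e. (E has_real_derivative e) (at t) \<and> e \<le> 0" by blast
  qed
  have y: "\<bar>y x\<bar> \<le> K" "\<bar>y1 x\<bar> \<le> K" if "x \<ge> 1" for x
  proof -
    have "\<bar>y x\<bar> = sqrt ((y x)\<^sup>2)" "\<bar>y1 x\<bar> = sqrt ((y1 x)\<^sup>2)" by simp_all
    moreover have "(y x)\<^sup>2 \<le> E 1" "(y1 x)\<^sup>2 \<le> E 1"
      using E[OF that] zero_le_power2[of "y x"] zero_le_power2[of "y1 x"] unfolding E_def by linarith+
    ultimately show "\<bar>y x\<bar> \<le> K" "\<bar>y1 x\<bar> \<le> K" unfolding K_def by (simp_all only: real_sqrt_le_iff)
  qed
  have "\<bar>y2 x\<bar> + \<bar>y1 x\<bar> / x \<le> 3 * K" if x: "x \<ge> 1" for x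
  proof -
    have "\<bar>y1 x\<bar> / x \<le> \<bar>y1 x\<bar>" using x by (simp add: divide_le_eq mult_left_mono[of 1 x "\<bar>y1 x\<bar>", simplified])
    moreover have "\<bar>y2 x\<bar> \<le> \<bar>y1 x\<bar> / x + \<bar>y x\<bar>"
      using x abs_triangle_ineq4[of "- y1 x / x" "y x"] by (simp add: ode abs_divide)
    ultimately show ?thesis using y[OF x] by linarith
  qed
  moreover have "0 \<le> 3 * K" by (simp add: K_def E_def)
  ultimately show ?thesis by blast
qed

section \<open>Second-derivative bounds for radial kernels\<close>

lemma radial_C2_boundI:
  assumes "\<And>r. r \<in> {r0..r1} \<Longrightarrow> (g has_vector_derivative g' r) (at r)"
    "\<And>r. r \<in> {r0..r1} \<Longrightarrow> (g' has_vector_derivative g'' r) (at r)"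
    "\<And>r. r \<in> {r0..r1} \<Longrightarrow> norm (g'' r) + norm (g' r) / r \<le> B"
  shows "radial_C2_bound g r0 r1 B"
  unfolding radial_C2_bound_def using assms by blast

lemma radial_C2_bound_mono: "radial_C2_bound g r0 r1 B \<Longrightarrow> B \<le> B' \<Longrightarrow> radial_C2_bound g r0 r1 B'"
  unfolding radial_C2_bound_def using order.trans by blast

lemma radial_C2_bound_add:
  assumes f: "radial_C2_bound f r0 r1 A" and g: "radial_C2_bound g r0 r1 B" and r0: "0 < r0"
  shows "radial_C2_bound (\<lambda>r. f r + g r) r0 r1 (A + B)"
proof -
  obtain f' f'' where f: "\<And>r. r \<in> {r0..r1} \<Longrightarrow> (f has_vector_derivative f' r) (at r)"
    "\<And>r. r \<in> {r0..r1} \<Longrightarrow> (f' has_vector_derivative f'' r) (at r)"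
    "\<And>r. r \<in> {r0..r1} \<Longrightarrow> norm (f'' r) + norm (f' r) / r \<le> A"
    using f unfolding radial_C2_bound_def by blast
  obtain g' g'' where g: "\<And>r. r \<in> {r0..r1} \<Longrightarrow> (g has_vector_derivative g' r) (at r)"
    "\<And>r. r \<in> {r0..r1} \<Longrightarrow> (g' has_vector_derivative g'' r) (at r)"
    "\<And>r. r \<in> {r0..r1} \<Longrightarrow> norm (g'' r) + norm (g' r) / r \<le> B"
    using g unfolding radial_C2_bound_def by blast
  show ?thesis
  proof (rule radial_C2_boundI[where g' = "\<lambda>r. f' r + g' r" and g'' = "\<lambda>r. f'' r + g'' r"])
    fix r assume r: "r \<in> {r0..r1}"
    show "norm (f'' r + g'' r) + norm (f' r + g' r) / r \<le> A + B"
    proof -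
      have "norm (f' r + g' r) / r \<le> (norm (f' r) + norm (g' r)) / r"
        using r r0 by (intro divide_right_mono norm_triangle_ineq) auto
      then show ?thesis
        using f(3)[OF r] g(3)[OF r] norm_triangle_ineq[of "f'' r" "g'' r"] by (simp add: add_divide_distrib)
    qed
  qed (auto intro!: has_vector_derivative_add f g)
qed

lemma radial_C2_bound_affine:
  fixes f :: "real \<Rightarrow> 'b::real_normed_vector"
  assumes f: "radial_C2_bound f (k * r0) (k * r1) B" and r0: "0 < r0" and k: "0 < k"
  shows "radial_C2_bound (\<lambda>r. c *\<^sub>R f (k * r) + b) r0 r1 (\<bar>c\<bar> * k\<^sup>2 * B)"
proof -
  obtain f' f'' where f: "\<And>r. r \<in> {k * r0..k * r1} \<Longrightarrow> (f has_vector_derivative f' r) (at r)"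
    "\<And>r. r \<in> {k * r0..k * r1} \<Longrightarrow> (f' has_vector_derivative f'' r) (at r)"
    "\<And>r. r \<in> {k * r0..k * r1} \<Longrightarrow> norm (f'' r) + norm (f' r) / r \<le> B"
    using f unfolding radial_C2_bound_def by blast
  have chain: "((\<lambda>r. g (k * r)) has_vector_derivative k *\<^sub>R g') (at r)"
    if "(g has_vector_derivative g') (at (k * r))" for g :: "real \<Rightarrow> 'b" and g' r
  proof -
    have "((*) k has_vector_derivative k) (at r)"
      by (auto intro!: derivative_eq_intros simp: has_real_derivative_iff_has_vector_derivative[symmetric])
    from vector_diff_chain_at[OF this that] show ?thesis by (simp add: o_def)
  qed
  show ?thesis
  proof (rule radial_C2_boundI[where g' = "\<lambda>r. c *\<^sub>R (k *\<^sub>R f' (k * r))" and g'' = "\<lambda>r. c *\<^sub>R (k *\<^sub>R (k *\<^sub>R f'' (k * r)))"])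
    fix r assume r: "r \<in> {r0..r1}"
    have kr: "k * r \<in> {k * r0..k * r1}" using r k by auto
    have rpos: "r > 0" using r r0 by auto
    have "((\<lambda>r. c *\<^sub>R f (k * r) + b) has_vector_derivative c *\<^sub>R (k *\<^sub>R f' (k * r)) + 0) (at r)"
      by (intro has_vector_derivative_add bounded_linear.has_vector_derivative[OF bounded_linear_scaleR_right]
          chain f kr has_vector_derivative_const)
    then show "((\<lambda>r. c *\<^sub>R f (k * r) + b) has_vector_derivative c *\<^sub>R (k *\<^sub>R f' (k * r))) (at r)" by simp
    show "((\<lambda>r. c *\<^sub>R (k *\<^sub>R f' (k * r))) has_vector_derivative c *\<^sub>R (k *\<^sub>R (k *\<^sub>R f'' (k * r)))) (at r)"
      by (intro bounded_linear.has_vector_derivative[OF bounded_linear_scaleR_right] chain f kr)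
    have "norm (c *\<^sub>R (k *\<^sub>R (k *\<^sub>R f'' (k * r)))) + norm (c *\<^sub>R (k *\<^sub>R f' (k * r))) / r
        = \<bar>c\<bar> * k\<^sup>2 * (norm (f'' (k * r)) + norm (f' (k * r)) / (k * r))"
      using k rpos by (simp add: field_simps power2_eq_square abs_mult)
    also have "\<dots> \<le> \<bar>c\<bar> * k\<^sup>2 * B" by (intro mult_left_mono f kr) simp
    finally show "norm (c *\<^sub>R (k *\<^sub>R (k *\<^sub>R f'' (k * r)))) + norm (c *\<^sub>R (k *\<^sub>R f' (k * r))) / r \<le> \<bar>c\<bar> * k\<^sup>2 * B" .
  qed
qed

lemma radial_C2_bound_of_real:
  assumes "radial_C2_bound f r0 r1 B"
  shows "radial_C2_bound (\<lambda>r. complex_of_real (f r)) r0 r1 B"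
proof -
  obtain f' f'' where f: "\<And>r. r \<in> {r0..r1} \<Longrightarrow> (f has_vector_derivative f' r) (at r)"
    "\<And>r. r \<in> {r0..r1} \<Longrightarrow> (f' has_vector_derivative f'' r) (at r)"
    "\<And>r. r \<in> {r0..r1} \<Longrightarrow> norm (f'' r) + norm (f' r) / r \<le> B"
    using assms unfolding radial_C2_bound_def by blast
  show ?thesis
    by (rule radial_C2_boundI[where g' = "\<lambda>r. complex_of_real (f' r)" and g'' = "\<lambda>r. complex_of_real (f'' r)"])
      (use f in \<open>auto intro!: has_vector_derivative_of_real simp: has_real_derivative_iff_has_vector_derivative\<close>)
qed

lemma radial_C2_bound_ln: assumes "0 < r0" shows "radial_C2_bound ln r0 r1 (2 / r0\<^sup>2)"
proof (rule radial_C2_boundI[where g' = "\<lambda>r. 1 / r" and g'' = "\<lambda>r. - 1 / r\<^sup>2"])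
  fix r assume r: "r \<in> {r0..r1}"
  then have rp: "r > 0" using assms by simp
  show "(ln has_vector_derivative 1 / r) (at r)"
    unfolding has_real_derivative_iff_has_vector_derivative[symmetric]
    using rp by (auto intro!: derivative_eq_intros)
  show "((\<lambda>r. 1 / r) has_vector_derivative - 1 / r\<^sup>2) (at r)"
    unfolding has_real_derivative_iff_has_vector_derivative[symmetric]
    using rp by (auto intro!: derivative_eq_intros simp: power2_eq_square)
  have "norm (- 1 / r\<^sup>2) + norm (1 / r) / r = 2 / r\<^sup>2"
    using rp by (simp add: power2_eq_square)
  also have "\<dots> \<le> 2 / r0\<^sup>2" using r assms by (intro divide_left_mono power_mono) auto
  finally show "norm (- 1 / r\<^sup>2) + norm (1 / r) / r \<le> 2 / r0\<^sup>2" .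
qed

lemma radial_C2_bound_inverse: assumes "0 < r0" shows "radial_C2_bound inverse r0 r1 (3 / r0 ^ 3)"
proof (rule radial_C2_boundI[where g' = "\<lambda>r. - 1 / r\<^sup>2" and g'' = "\<lambda>r. 2 / r ^ 3"])
  fix r assume r: "r \<in> {r0..r1}"
  then have rp: "r > 0" using assms by simp
  show "(inverse has_vector_derivative - 1 / r\<^sup>2) (at r)"
    unfolding has_real_derivative_iff_has_vector_derivative[symmetric]
    using DERIV_inverse[of r UNIV] rp by (simp add: power2_eq_square divide_inverse)
  have "((\<lambda>r. - 1 / r\<^sup>2) has_real_derivative - (- 1 * (2 * r)) / (r\<^sup>2 * r\<^sup>2)) (at r)"
    using rp by (auto intro!: derivative_eq_intros)
  also have "- (- 1 * (2 * r)) / (r\<^sup>2 * r\<^sup>2) = 2 / r ^ 3"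
    using rp by (simp add: power2_eq_square power3_eq_cube)
  finally show "((\<lambda>r. - 1 / r\<^sup>2) has_vector_derivative 2 / r ^ 3) (at r)"
    by (simp add: has_real_derivative_iff_has_vector_derivative)
  have "norm (2 / r ^ 3) + norm (- 1 / r\<^sup>2) / r = 3 / r ^ 3"
    using rp by (simp add: power2_eq_square power3_eq_cube)
  also have "\<dots> \<le> 3 / r0 ^ 3" using r assms by (intro divide_left_mono power_mono) auto
  finally show "norm (2 / r ^ 3) + norm (- 1 / r\<^sup>2) / r \<le> 3 / r0 ^ 3" .
qed

text \<open>
  The regular part of the kernel in dimension two with unit wavenumber; its limit at 0 is
  \<open>\<i> / (4 pi)\<close>.
\<close>

definition Ereg :: "real \<Rightarrow> complex" where
  "Ereg t = (exp (\<i> * t) - 1) / (4 * pi * t)"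

lemma exp_i_remainders:
  fixes t :: real assumes "t > 0"
  shows "cmod (exp (\<i> * t) - 1) \<le> t" "cmod (exp (\<i> * t) - 1 - \<i> * t) \<le> t\<^sup>2"
    "cmod (exp (\<i> * t) - 1 - \<i> * t + t\<^sup>2 / 2) \<le> t ^ 3"
proof -
  note T = Taylor_exp[of "\<i> * t"]
  show "cmod (exp (\<i> * t) - 1) \<le> t" using T[of 0] assms by (simp add: norm_mult)
  show "cmod (exp (\<i> * t) - 1 - \<i> * t) \<le> t\<^sup>2"
    using T[of 1] assms by (simp add: norm_mult numeral_eq_Suc algebra_simps)
  have "(\<Sum>k\<le>2. (\<i> * complex_of_real t) ^ k / fact k) = 1 + \<i> * t - t\<^sup>2 / 2"
    by (simp add: numeral_eq_Suc power_mult_distrib)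
  then have eq: "exp (\<i> * t) - 1 - \<i> * t + t\<^sup>2 / 2 = exp (\<i> * t) - (\<Sum>k\<le>2. (\<i> * complex_of_real t) ^ k / fact k)"
    by simp
  have "cmod (exp (\<i> * t) - 1 - \<i> * t + t\<^sup>2 / 2) \<le> t ^ 3 / 2"
    unfolding eq using T[of 2] assms by (simp add: norm_mult numeral_3_eq_3)
  also have "\<dots> \<le> t ^ 3" using assms by simp
  finally show "cmod (exp (\<i> * t) - 1 - \<i> * t + t\<^sup>2 / 2) \<le> t ^ 3" .
qed

lemma pi_bound: "4 \<le> 4 * pi" "1 \<le> 2 * pi" using pi_gt3 by auto

lemma Ereg_diag: assumes "t > 0" shows "cmod (Ereg t - \<i> / (4 * pi)) \<le> t"
proof -
  have "Ereg t - \<i> / (4 * pi) = (exp (\<i> * t) - 1 - \<i> * t) / (4 * pi * t)"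
    using assms by (simp add: Ereg_def field_simps)
  then have "cmod (Ereg t - \<i> / (4 * pi)) = cmod (exp (\<i> * t) - 1 - \<i> * t) / (4 * pi * t)"
    using assms by (simp add: norm_divide norm_mult)
  also have "\<dots> \<le> t\<^sup>2 / (1 * t)"
    using assms exp_i_remainders(2)[OF assms] pi_bound by (intro frac_le mult_right_mono) auto
  finally show ?thesis using assms by (simp add: power2_eq_square)
qed

text \<open>
  In the numerators of the two derivatives all Taylor terms of the exponential of order less
  than 2, respectively 3, cancel.
\<close>

lemma radial_C2_bound_Ereg:
  assumes "0 < t0" shows "radial_C2_bound Ereg t0 t1 (1 + 1 / t0)"
proof -
  define E1 where "E1 t = (\<i> * t * exp (\<i> * t) - (exp (\<i> * t) - 1)) / (4 * pi * t\<^sup>2)" for t :: real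
  define E2 where "E2 t = (- t\<^sup>2 * exp (\<i> * t) - 2 * \<i> * t * exp (\<i> * t) + 2 * (exp (\<i> * t) - 1)) / (4 * pi * t ^ 3)"
    for t :: real
  show ?thesis
  proof (rule radial_C2_boundI[where g' = E1 and g'' = E2])
    fix t assume t: "t \<in> {t0..t1}"
    then have tp: "t > 0" using assms by simp
    let ?z = "complex_of_real t"
    have z: "?z \<noteq> 0" using tp by simp
    have "((\<lambda>z. (exp (\<i> * z) - 1) / (4 * pi * z)) has_field_derivative
        ((\<i> * exp (\<i> * ?z)) * (4 * pi * ?z) - (exp (\<i> * ?z) - 1) * (4 * pi)) / ((4 * pi * ?z) * (4 * pi * ?z))) (at ?z)"
      using z by (auto intro!: derivative_eq_intros)
    also have "((\<i> * exp (\<i> * ?z)) * (4 * pi * ?z) - (exp (\<i> * ?z) - 1) * (4 * pi)) / ((4 * pi * ?z) * (4 * pi * ?z)) = E1 t"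
      unfolding E1_def using z by (simp add: divide_simps power2_eq_square) (simp add: algebra_simps)
    finally have "((\<lambda>t. (exp (\<i> * complex_of_real t) - 1) / (4 * pi * complex_of_real t)) has_vector_derivative E1 t) (at t)"
      by (rule has_vector_derivative_real_field)
    then show "(Ereg has_vector_derivative E1 t) (at t)" by (simp add: Ereg_def[abs_def])
    have "((\<lambda>z. (\<i> * z * exp (\<i> * z) - (exp (\<i> * z) - 1)) / (4 * pi * z\<^sup>2)) has_field_derivative
        ((\<i> * exp (\<i> * ?z) + \<i> * ?z * (\<i> * exp (\<i> * ?z)) - \<i> * exp (\<i> * ?z)) * (4 * pi * ?z\<^sup>2)
         - (\<i> * ?z * exp (\<i> * ?z) - (exp (\<i> * ?z) - 1)) * (4 * pi * (2 * ?z))) / ((4 * pi * ?z\<^sup>2) * (4 * pi * ?z\<^sup>2))) (at ?z)"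
      using z by (auto intro!: derivative_eq_intros)
    also have "((\<i> * exp (\<i> * ?z) + \<i> * ?z * (\<i> * exp (\<i> * ?z)) - \<i> * exp (\<i> * ?z)) * (4 * pi * ?z\<^sup>2)
         - (\<i> * ?z * exp (\<i> * ?z) - (exp (\<i> * ?z) - 1)) * (4 * pi * (2 * ?z))) / ((4 * pi * ?z\<^sup>2) * (4 * pi * ?z\<^sup>2)) = E2 t"
      unfolding E2_def using z by (simp add: divide_simps power2_eq_square power3_eq_cube) (simp add: algebra_simps)
    finally have "((\<lambda>t. (\<i> * complex_of_real t * exp (\<i> * complex_of_real t) - (exp (\<i> * complex_of_real t) - 1)) / (4 * pi * (complex_of_real t)\<^sup>2))
        has_vector_derivative E2 t) (at t)"
      by (rule has_vector_derivative_real_field)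
    then show "(E1 has_vector_derivative E2 t) (at t)" by (simp add: E1_def[abs_def])
    \<comment> \<open>Rewriting the numerators through Taylor remainders removes the cancelling terms.\<close>
    define \<rho>1 where "\<rho>1 = exp (\<i> * t) - 1"
    define \<rho>2 where "\<rho>2 = exp (\<i> * t) - 1 - \<i> * t"
    define \<rho>3 where "\<rho>3 = exp (\<i> * t) - 1 - \<i> * t + t\<^sup>2 / 2"
    note rem = exp_i_remainders[OF tp, folded \<rho>1_def \<rho>2_def \<rho>3_def]
    have n1: "\<i> * t * exp (\<i> * t) - (exp (\<i> * t) - 1) = \<i> * t * \<rho>1 - \<rho>2"
      by (simp add: \<rho>1_def \<rho>2_def algebra_simps)
    have n2: "- t\<^sup>2 * exp (\<i> * t) - 2 * \<i> * t * exp (\<i> * t) + 2 * (exp (\<i> * t) - 1)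
        = - t\<^sup>2 * \<rho>1 - 2 * \<i> * t * \<rho>2 + 2 * \<rho>3"
      by (simp add: \<rho>1_def \<rho>2_def \<rho>3_def algebra_simps power2_eq_square)
    have "cmod (\<i> * t * \<rho>1 - \<rho>2) \<le> t * cmod \<rho>1 + cmod \<rho>2"
      using norm_triangle_ineq4[of "\<i> * t * \<rho>1" \<rho>2] tp by (simp add: norm_mult)
    also have "\<dots> \<le> t * t + t\<^sup>2" using rem tp by (intro add_mono mult_left_mono) auto
    finally have "cmod (\<i> * t * \<rho>1 - \<rho>2) / (4 * pi * t\<^sup>2) \<le> (t * t + t\<^sup>2) / (4 * pi * t\<^sup>2)"
      by (rule divide_right_mono) simp
    moreover have "cmod (E1 t) = cmod (\<i> * t * \<rho>1 - \<rho>2) / (4 * pi * t\<^sup>2)"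
      unfolding E1_def n1 using tp by (simp add: norm_divide norm_mult norm_power)
    ultimately have "cmod (E1 t) \<le> (2 * t\<^sup>2) / (4 * pi * t\<^sup>2)" by (simp only: power2_eq_square mult_2)
    also have "\<dots> \<le> 1" using tp pi_bound by (simp add: divide_le_eq)
    finally have e1: "cmod (E1 t) \<le> 1" .
    have "cmod (- t\<^sup>2 * \<rho>1 - 2 * \<i> * t * \<rho>2 + 2 * \<rho>3) \<le> t\<^sup>2 * cmod \<rho>1 + 2 * t * cmod \<rho>2 + 2 * cmod \<rho>3"
    proof -
      have "cmod (- t\<^sup>2 * \<rho>1 - 2 * \<i> * t * \<rho>2 + 2 * \<rho>3) \<le> cmod (- t\<^sup>2 * \<rho>1) + cmod (2 * \<i> * t * \<rho>2) + cmod (2 * \<rho>3)"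
        by (intro order.trans[OF norm_triangle_ineq] add_right_mono norm_triangle_ineq4)
      also have "\<dots> = t\<^sup>2 * cmod \<rho>1 + 2 * t * cmod \<rho>2 + 2 * cmod \<rho>3"
        using tp by (simp add: norm_mult norm_power)
      finally show ?thesis .
    qed
    also have "\<dots> \<le> t\<^sup>2 * t + 2 * t * t\<^sup>2 + 2 * t ^ 3"
      using rem tp by (intro add_mono mult_left_mono) auto
    also have "\<dots> = 5 * t ^ 3" by (simp add: power2_eq_square power3_eq_cube)
    finally have "cmod (- t\<^sup>2 * \<rho>1 - 2 * \<i> * t * \<rho>2 + 2 * \<rho>3) / (4 * pi * t ^ 3) \<le> 5 * t ^ 3 / (4 * pi * t ^ 3)"
      using tp by (intro divide_right_mono) auto
    moreover have "cmod (E2 t) = cmod (- t\<^sup>2 * \<rho>1 - 2 * \<i> * t * \<rho>2 + 2 * \<rho>3) / (4 * pi * t ^ 3)"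
      unfolding E2_def n2 using tp by (simp add: norm_divide norm_mult norm_power)
    ultimately have "cmod (E2 t) \<le> (5 * t ^ 3) / (4 * pi * t ^ 3)" by (simp only:)
    also have "\<dots> \<le> 1" using tp pi_gt3 by (simp add: divide_le_eq)
    finally have e2: "cmod (E2 t) \<le> 1" .
    have "cmod (E1 t) / t \<le> 1 / t0" using e1 t assms by (intro frac_le) auto
    then show "cmod (E2 t) + cmod (E1 t) / t \<le> 1 + 1 / t0" using e2 by linarith
  qed
qed

text \<open>
  The full kernel is the regular part plus \<open>1 / (4 pi r)\<close>.
\<close>

lemma radial_C2_bound_helmholtz3:
  assumes "0 < r0" "0 < k"
  shows "radial_C2_bound (\<lambda>r. k *\<^sub>R Ereg (k * r)) r0 r1 (k ^ 3 + k\<^sup>2 / r0)"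
    and "radial_C2_bound (\<lambda>r. exp (\<i> * complex_of_real (k * r)) / complex_of_real (4 * pi * r)) r0 r1
      (k ^ 3 + k\<^sup>2 / r0 + 3 / r0 ^ 3)"
proof -
  have "radial_C2_bound (\<lambda>r. k *\<^sub>R Ereg (k * r) + 0) r0 r1 (\<bar>k\<bar> * k\<^sup>2 * (1 + 1 / (k * r0)))"
    using assms by (intro radial_C2_bound_affine radial_C2_bound_Ereg) auto
  also have "\<bar>k\<bar> * k\<^sup>2 * (1 + 1 / (k * r0)) = k ^ 3 + k\<^sup>2 / r0"
    using assms by (simp add: field_simps power2_eq_square power3_eq_cube)
  finally show 1: "radial_C2_bound (\<lambda>r. k *\<^sub>R Ereg (k * r)) r0 r1 (k ^ 3 + k\<^sup>2 / r0)" by simp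
  have "radial_C2_bound (\<lambda>r. (1 / (4 * pi)) *\<^sub>R complex_of_real (inverse (1 * r)) + 0) r0 r1
      (\<bar>1 / (4 * pi)\<bar> * 1\<^sup>2 * (3 / (1 * r0) ^ 3))"
    using assms by (intro radial_C2_bound_affine radial_C2_bound_of_real radial_C2_bound_inverse) auto
  then have "radial_C2_bound (\<lambda>r. (1 / (4 * pi)) *\<^sub>R complex_of_real (inverse (1 * r)) + 0) r0 r1 (3 / r0 ^ 3)"
    by (rule radial_C2_bound_mono) (use assms pi_bound in \<open>simp add: field_simps\<close>)
  from radial_C2_bound_add[OF 1 this assms(1)]
  have 2: "radial_C2_bound (\<lambda>r. k *\<^sub>R Ereg (k * r) + ((1 / (4 * pi)) *\<^sub>R complex_of_real (inverse (1 * r)) + 0)) r0 r1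
      (k ^ 3 + k\<^sup>2 / r0 + 3 / r0 ^ 3)" .
  have eq: "k *\<^sub>R Ereg (k * r) + ((1 / (4 * pi)) *\<^sub>R complex_of_real (inverse (1 * r)) + 0)
      = exp (\<i> * complex_of_real (k * r)) / complex_of_real (4 * pi * r)" for r
    using assms by (cases "r = 0") (simp_all add: Ereg_def scaleR_conv_of_real field_simps)
  show "radial_C2_bound (\<lambda>r. exp (\<i> * complex_of_real (k * r)) / complex_of_real (4 * pi * r)) r0 r1
      (k ^ 3 + k\<^sup>2 / r0 + 3 / r0 ^ 3)"
    using 2 unfolding eq .
qed

section \<open>The kernels of the Helmholtz equation in one and two dimensions\<close>

lemma has_vector_derivative_Complex:
  assumes "(u has_real_derivative u') (at x)" "(v has_real_derivative v') (at x)"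
  shows "((\<lambda>x. Complex (u x) (v x)) has_vector_derivative Complex u' v') (at x)"
  unfolding Complex_eq
  using assms by (intro has_vector_derivative_add has_vector_derivative_of_real has_vector_derivative_mult_right)

text \<open>
  The kernel in dimension one with unit wavenumber and its first two derivatives.
\<close>

definition hk where "hk t = Complex (- besY t / 4) (besJ t / 4)"
definition hk' where "hk' t = Complex (- besY' t / 4) (besJ' t / 4)"
definition hk'' where "hk'' t = Complex (- besY'' t / 4) (besJ'' t / 4)"

lemma hk0_eq: "hk t = \<i> / 4 * hankel1_0 t"
  by (simp add: hk_def hankel1_0_def bessel_J0_eq bessel_Y0_eq complex_eq_iff)

lemma hk_derivs:
  assumes "t > 0"
  shows "(hk has_vector_derivative hk' t) (at t)" "(hk' has_vector_derivative hk'' t) (at t)"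
  unfolding hk_def[abs_def] hk'_def[abs_def] hk''_def
  using DERIV_Y[OF assms] DERIV_J_S[of t]
  by (auto intro!: has_vector_derivative_Complex DERIV_cdivide DERIV_minus)

text \<open>
  Adding \<open>ln t / (2 pi)\<close> removes the logarithmic singularity of the kernel;
  \<open>reg_diag\<close> is the limit at 0.
\<close>

definition reg where "reg t = hk t + complex_of_real (ln t / (2 * pi))"
definition reg' where "reg' t = hk' t + complex_of_real (1 / t / (2 * pi))"
definition reg'' where "reg'' t = hk'' t + complex_of_real (- 1 / t\<^sup>2 / (2 * pi))"
definition reg_diag :: complex where "reg_diag = Complex (- (eul - ln 2) / (2 * pi)) (1 / 4)"

lemma reg_derivs:
  assumes "t > 0"
  shows "(reg has_vector_derivative reg' t) (at t)" "(reg' has_vector_derivative reg'' t) (at t)"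
proof -
  have "((\<lambda>t. ln t / (2 * pi)) has_real_derivative 1 / t / (2 * pi)) (at t)"
    using assms by (auto intro!: derivative_eq_intros)
  then show "(reg has_vector_derivative reg' t) (at t)"
    unfolding reg_def[abs_def] reg'_def
    by (intro has_vector_derivative_add has_vector_derivative_of_real hk_derivs assms)
  have "((\<lambda>t. 1 / t) has_real_derivative - 1 / t\<^sup>2) (at t)"
    using assms by (auto intro!: derivative_eq_intros simp: power2_eq_square)
  then have "((\<lambda>t. 1 / t / (2 * pi)) has_real_derivative - 1 / t\<^sup>2 / (2 * pi)) (at t)"
    by (rule DERIV_cdivide)
  then show "(reg' has_vector_derivative reg'' t) (at t)"
    unfolding reg'_def[abs_def] reg''_def
    by (intro has_vector_derivative_add has_vector_derivative_of_real hk_derivs assms)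
qed

text \<open>
  Written with \<open>J\<^sub>0 - 1\<close>, which vanishes to second order, so that no negative
  power of \<open>t\<close> survives.
\<close>

lemma reg_formulas:
  assumes "t > 0"
  shows "reg t - reg_diag = Complex (- (ln t * (besJ t - 1) + (eul - ln 2) * (besJ t - 1) - serS t) / (2 * pi)) ((besJ t - 1) / 4)"
    "reg' t = Complex (- ((besJ t - 1) / t + lg t * besJ' t - serS' t) / (2 * pi)) (besJ' t / 4)"
    "reg'' t = Complex (- (- (besJ t - 1) / t\<^sup>2 + 2 * besJ' t / t + lg t * besJ'' t - serS'' t) / (2 * pi)) (besJ'' t / 4)"
  using assms
  by (simp_all add: reg_def reg'_def reg''_def reg_diag_def hk_def hk'_def hk''_def complex_eq_iff
      besY_def besY'_def besY''_def lg_def ln_div add_divide_distrib diff_divide_distrib algebra_simps)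

lemma cmod_Complex_le: "cmod (Complex (- a / (2 * pi)) (b / 4)) \<le> \<bar>a\<bar> + \<bar>b\<bar>"
proof -
  have "cmod (Complex (- a / (2 * pi)) (b / 4)) \<le> \<bar>- a / (2 * pi)\<bar> + \<bar>b / 4\<bar>"
    using cmod_le[of "Complex (- a / (2 * pi)) (b / 4)"] by simp
  also have "\<bar>- a / (2 * pi)\<bar> \<le> \<bar>a\<bar> / 1"
    unfolding abs_divide abs_minus_cancel using pi_bound by (intro frac_le) auto
  also have "\<bar>b / 4\<bar> \<le> \<bar>b\<bar>" by simp
  finally show ?thesis by simp
qed

lemma reg_bounds_aux:
  fixes b :: real
  assumes b: "b > 0"
  shows "\<exists>K\<ge>0. \<forall>t\<in>{0<..b}. cmod (reg'' t) + cmod (reg' t) / t \<le> K * (1 + \<bar>ln t\<bar>) \<and>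
    cmod (reg t - reg_diag) \<le> K * t\<^sup>2 * (1 + \<bar>ln t\<bar>)"
proof -
  obtain KJ where KJ: "KJ \<ge> 0" "\<And>x. x \<in> {0..b} \<Longrightarrow> \<bar>besJ x - 1\<bar> \<le> KJ * x\<^sup>2 \<and> \<bar>besJ' x\<bar> \<le> KJ * x \<and> \<bar>besJ'' x\<bar> \<le> KJ"
    using pseries_square_bounds[OF entire_series_coeffs(1), of b]
    unfolding besJ_def besJ'_def besJ''_def by (auto simp: coeff_J_def)
  obtain KS where KS: "KS \<ge> 0" "\<And>x. x \<in> {0..b} \<Longrightarrow> \<bar>serS x\<bar> \<le> KS * x\<^sup>2 \<and> \<bar>serS' x\<bar> \<le> KS * x \<and> \<bar>serS'' x\<bar> \<le> KS"
    using pseries_square_bounds[OF entire_series_coeffs(2), of b]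
    unfolding serS_def serS'_def serS''_def by (auto simp: coeff_S_def harm_expand)
  define K where "K = max KJ KS"
  define A where "A = \<bar>eul - ln 2\<bar>"
  have K0: "K \<ge> 0" and A0: "A \<ge> 0" using KJ by (auto simp: K_def A_def)
  let ?K = "K * (8 + 2 * A)"
  show ?thesis
  proof (intro exI[of _ ?K] conjI ballI)
    show "0 \<le> ?K" using K0 A0 by simp
    fix t assume "t \<in> {0<..b}"
    then have t: "t > 0" "t \<in> {0..b}" by auto
    define l where "l = \<bar>ln t\<bar>"
    have l0: "l \<ge> 0" by (simp add: l_def)
    have le: "KJ \<le> K" "KS \<le> K" by (auto simp: K_def)
    have J: "\<bar>besJ t - 1\<bar> \<le> K * t\<^sup>2" "\<bar>besJ' t\<bar> \<le> K * t" "\<bar>besJ'' t\<bar> \<le> K"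
      using KJ(2)[OF t(2)] le(1) mult_right_mono[OF le(1) zero_le_power2[of t]]
        mult_right_mono[OF le(1) less_imp_le[OF t(1)]] by linarith+
    have S: "\<bar>serS t\<bar> \<le> K * t\<^sup>2" "\<bar>serS' t\<bar> \<le> K * t" "\<bar>serS'' t\<bar> \<le> K"
      using KS(2)[OF t(2)] le(2) mult_right_mono[OF le(2) zero_le_power2[of t]]
        mult_right_mono[OF le(2) less_imp_le[OF t(1)]] by linarith+
    have lg: "\<bar>lg t\<bar> \<le> l + A"
    proof -
      have "lg t = ln t + (eul - ln 2)" using t by (simp add: lg_def ln_div)
      then show ?thesis unfolding l_def A_def by (metis abs_triangle_ineq)
    qed
    have m1: "\<bar>lg t * besJ' t\<bar> \<le> (l + A) * (K * t)" "\<bar>lg t * besJ'' t\<bar> \<le> (l + A) * K"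
      unfolding abs_mult using lg J l0 A0 by (auto intro!: mult_mono)
    have q1: "\<bar>(besJ t - 1) / t\<bar> \<le> K * t"
      using J(1) t(1) by (simp add: abs_divide pos_divide_le_eq power2_eq_square mult.assoc)
    have q2: "\<bar>- (besJ t - 1) / t\<^sup>2\<bar> \<le> K" "\<bar>2 * besJ' t / t\<bar> \<le> 2 * K"
      using J(1,2) t(1) by (simp_all add: abs_divide pos_divide_le_eq abs_minus_commute abs_mult)
    have "cmod (reg' t) \<le> \<bar>(besJ t - 1) / t + lg t * besJ' t - serS' t\<bar> + \<bar>besJ' t\<bar>"
      unfolding reg_formulas[OF t(1)] by (rule cmod_Complex_le)
    also have "\<dots> \<le> K * t + (l + A) * (K * t) + K * t + K * t"
      using q1 m1(1) S(2) J(2) by linarith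
    also have "\<dots> = K * (3 + A + l) * t" by (simp add: algebra_simps)
    finally have r1: "cmod (reg' t) / t \<le> K * (3 + A + l)" using t(1) by (simp add: pos_divide_le_eq)
    have "cmod (reg'' t) \<le> \<bar>- (besJ t - 1) / t\<^sup>2 + 2 * besJ' t / t + lg t * besJ'' t - serS'' t\<bar> + \<bar>besJ'' t\<bar>"
      unfolding reg_formulas[OF t(1)] by (rule cmod_Complex_le)
    also have "\<dots> \<le> K + 2 * K + (l + A) * K + K + K"
      using q2 m1(2) S(3) J(3) by linarith
    finally have r2: "cmod (reg'' t) \<le> K * (5 + A + l)" by (simp add: algebra_simps)
    have "cmod (reg'' t) + cmod (reg' t) / t \<le> K * (8 + 2 * A + 2 * l)"
      using r1 r2 by (simp add: algebra_simps)
    also have "\<dots> \<le> K * ((8 + 2 * A) * (1 + l))"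
      using K0 A0 l0 by (intro mult_left_mono) (auto simp: algebra_simps)
    finally show "cmod (reg'' t) + cmod (reg' t) / t \<le> ?K * (1 + \<bar>ln t\<bar>)" by (simp add: l_def mult.assoc)
    have "cmod (reg t - reg_diag) \<le> \<bar>ln t * (besJ t - 1) + (eul - ln 2) * (besJ t - 1) - serS t\<bar> + \<bar>besJ t - 1\<bar>"
      unfolding reg_formulas[OF t(1)] by (rule cmod_Complex_le)
    also have "\<dots> \<le> l * (K * t\<^sup>2) + A * (K * t\<^sup>2) + K * t\<^sup>2 + K * t\<^sup>2"
    proof -
      have "\<bar>ln t * (besJ t - 1)\<bar> \<le> l * (K * t\<^sup>2)" "\<bar>(eul - ln 2) * (besJ t - 1)\<bar> \<le> A * (K * t\<^sup>2)"
        unfolding abs_mult l_def A_def using J by (auto intro!: mult_left_mono)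
      then show ?thesis using S(1) J(1) by linarith
    qed
    also have "\<dots> = K * t\<^sup>2 * (2 + A + l)" by (simp add: algebra_simps)
    also have "\<dots> \<le> K * t\<^sup>2 * ((8 + 2 * A) * (1 + l))"
      using K0 A0 l0 by (intro mult_left_mono) (auto simp: algebra_simps)
    finally show "cmod (reg t - reg_diag) \<le> ?K * t\<^sup>2 * (1 + \<bar>ln t\<bar>)" by (simp add: l_def mult_ac)
  qed
qed

text \<open>
  The form with \<open>ln (b / t)\<close> is nonnegative and decreasing in \<open>t\<close>,
  which is what bounds on intervals of distances need.
\<close>

lemma reg_bounds:
  fixes b :: real
  assumes b: "b > 0"
  shows "\<exists>K\<ge>0. \<forall>t\<in>{0<..b}. cmod (reg'' t) + cmod (reg' t) / t \<le> K * (1 + ln (b / t)) \<and>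
    cmod (reg t - reg_diag) \<le> K * t\<^sup>2 * (1 + ln (b / t))"
proof -
  obtain K where K: "K \<ge> 0" "\<And>t. t \<in> {0<..b} \<Longrightarrow> cmod (reg'' t) + cmod (reg' t) / t \<le> K * (1 + \<bar>ln t\<bar>)"
    "\<And>t. t \<in> {0<..b} \<Longrightarrow> cmod (reg t - reg_diag) \<le> K * t\<^sup>2 * (1 + \<bar>ln t\<bar>)"
    using reg_bounds_aux[OF b] by blast
  show ?thesis
  proof (intro exI[of _ "K * (1 + \<bar>ln b\<bar>)"] conjI ballI)
    show "0 \<le> K * (1 + \<bar>ln b\<bar>)" using K by simp
    fix t assume t: "t \<in> {0<..b}"
    have "ln (b / t) \<ge> 0" using t b by (simp add: le_divide_eq)
    moreover have "\<bar>ln t\<bar> \<le> \<bar>ln b\<bar> + ln (b / t)"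
    proof -
      have "ln t = ln b - ln (b / t)" using t b by (simp add: ln_div)
      then show ?thesis using \<open>ln (b / t) \<ge> 0\<close> by linarith
    qed
    ultimately have *: "1 + \<bar>ln t\<bar> \<le> (1 + \<bar>ln b\<bar>) * (1 + ln (b / t))"
    proof -
      have "0 \<le> \<bar>ln b\<bar> * ln (b / t)" using \<open>ln (b / t) \<ge> 0\<close> by simp
      then show ?thesis using \<open>\<bar>ln t\<bar> \<le> \<bar>ln b\<bar> + ln (b / t)\<close> by (simp add: algebra_simps)
    qed
    show "cmod (reg'' t) + cmod (reg' t) / t \<le> K * (1 + \<bar>ln b\<bar>) * (1 + ln (b / t))"
      using K(2)[OF t] mult_left_mono[OF * K(1)] by (simp add: mult.assoc)
    have "0 \<le> K * t\<^sup>2" using K by simp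
    then show "cmod (reg t - reg_diag) \<le> K * (1 + \<bar>ln b\<bar>) * t\<^sup>2 * (1 + ln (b / t))"
      using K(3)[OF t] mult_left_mono[OF *, of "K * t\<^sup>2"] by (simp add: mult_ac)
  qed
qed

text \<open>
  Near 0 the logarithm contributes \<open>1 / t^2\<close> and the regular part less; beyond 1
  the energy bound applies to \<open>J\<^sub>0\<close> and \<open>Y\<^sub>0\<close> separately.
\<close>

lemma hk_bounds: "\<exists>K\<ge>0. \<forall>t>0. cmod (hk'' t) + cmod (hk' t) / t \<le> K * (1 + 1 / t\<^sup>2)"
proof -
  obtain K where K: "K \<ge> 0" "\<And>t. t \<in> {0<..1} \<Longrightarrow> cmod (reg'' t) + cmod (reg' t) / t \<le> K * (1 + ln (1 / t))"
    using reg_bounds[of 1] by auto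
  obtain KJ where KJ: "KJ \<ge> 0" "\<And>x. x \<ge> 1 \<Longrightarrow> \<bar>besJ'' x\<bar> + \<bar>besJ' x\<bar> / x \<le> KJ"
    using bessel_energy_bound[of besJ besJ' besJ''] DERIV_J_S bessel_ode_J by blast
  obtain KY where KY: "KY \<ge> 0" "\<And>x. x \<ge> 1 \<Longrightarrow> \<bar>besY'' x\<bar> + \<bar>besY' x\<bar> / x \<le> KY"
    using bessel_energy_bound[of besY besY' besY''] DERIV_Y bessel_ode_Y by blast
  have le: "cmod (Complex (- a / 4) (b / 4)) \<le> \<bar>a\<bar> + \<bar>b\<bar>" for a b
    using cmod_le[of "Complex (- a / 4) (b / 4)"] by (simp add: abs_divide)
  show ?thesis
  proof (intro exI[of _ "KJ + KY + 2 * K + 2"] conjI allI impI)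
    show "0 \<le> KJ + KY + 2 * K + 2" using K KJ KY by simp
    fix t :: real assume t: "t > 0"
    show "cmod (hk'' t) + cmod (hk' t) / t \<le> (KJ + KY + 2 * K + 2) * (1 + 1 / t\<^sup>2)"
    proof (cases "t \<ge> 1")
      case True
      have "cmod (hk' t) / t \<le> (\<bar>besY' t\<bar> + \<bar>besJ' t\<bar>) / t"
        unfolding hk'_def using t by (intro divide_right_mono le) auto
      moreover have "cmod (hk'' t) \<le> \<bar>besY'' t\<bar> + \<bar>besJ'' t\<bar>" unfolding hk''_def by (rule le)
      ultimately have "cmod (hk'' t) + cmod (hk' t) / t \<le> KJ + KY"
        using KJ(2)[OF True] KY(2)[OF True] by (simp add: add_divide_distrib)
      also have "\<dots> \<le> (KJ + KY + 2 * K + 2) * 1" using K by simp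
      also have "\<dots> \<le> (KJ + KY + 2 * K + 2) * (1 + 1 / t\<^sup>2)"
        using K KJ KY by (intro mult_left_mono) auto
      finally show ?thesis .
    next
      case False
      then have t1: "t \<in> {0<..1}" using t by simp
      have "ln (1 / t) \<le> 1 / t - 1" using t by (intro ln_le_minus_one) simp
      also have "1 / t \<le> 1 / t\<^sup>2" using t False by (intro divide_left_mono) (auto simp: power2_eq_square mult_le_cancel_left2)
      finally have "1 + ln (1 / t) \<le> 1 / t\<^sup>2" by simp
      then have "K * (1 + ln (1 / t)) \<le> K * (1 / t\<^sup>2)" using K(1) by (rule mult_left_mono)
      then have r: "cmod (reg'' t) + cmod (reg' t) / t \<le> K / t\<^sup>2" using K(2)[OF t1] by simp
      have a1: "cmod (hk' t) \<le> cmod (reg' t) + 1 / t"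
      proof -
        have "hk' t = reg' t - complex_of_real (1 / t / (2 * pi))" by (simp add: reg'_def)
        then have "cmod (hk' t) \<le> cmod (reg' t) + \<bar>1 / t / (2 * pi)\<bar>"
          using norm_triangle_ineq4[of "reg' t" "complex_of_real (1 / t / (2 * pi))"] by (simp only: norm_of_real)
        also have "\<bar>1 / t / (2 * pi)\<bar> \<le> 1 / t" using t pi_bound by (simp add: abs_divide divide_le_eq)
        finally show ?thesis by simp
      qed
      have a2: "cmod (hk'' t) \<le> cmod (reg'' t) + 1 / t\<^sup>2"
      proof -
        have "hk'' t = reg'' t - complex_of_real (- 1 / t\<^sup>2 / (2 * pi))" by (simp add: reg''_def)
        then have "cmod (hk'' t) \<le> cmod (reg'' t) + \<bar>- 1 / t\<^sup>2 / (2 * pi)\<bar>"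
          using norm_triangle_ineq4[of "reg'' t" "complex_of_real (- 1 / t\<^sup>2 / (2 * pi))"] by (simp only: norm_of_real)
        also have "\<bar>- 1 / t\<^sup>2 / (2 * pi)\<bar> \<le> 1 / t\<^sup>2" using t pi_bound by (simp add: abs_divide divide_le_eq)
        finally show ?thesis by simp
      qed
      have "cmod (hk' t) / t \<le> (cmod (reg' t) + 1 / t) / t" using a1 t by (intro divide_right_mono) auto
      also have "\<dots> = cmod (reg' t) / t + 1 / t\<^sup>2" using t by (simp add: add_divide_distrib power2_eq_square)
      finally have "cmod (hk'' t) + cmod (hk' t) / t \<le> K / t\<^sup>2 + 2 / t\<^sup>2" using a2 r by simp
      also have "\<dots> = (K + 2) * (1 / t\<^sup>2)" by (simp add: add_divide_distrib)
      also have "\<dots> \<le> (KJ + KY + 2 * K + 2) * (1 + 1 / t\<^sup>2)"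
        using K(1) KJ(1) KY(1) by (intro mult_mono) auto
      finally show ?thesis .
    qed
  qed
qed

lemma radial_C2_bound_hankel:
  "\<exists>K\<ge>0. \<forall>k r0 r1. 0 < k \<longrightarrow> 0 < r0 \<longrightarrow>
    radial_C2_bound (\<lambda>r. \<i> / 4 * hankel1_0 (k * r)) r0 r1 (K * (k\<^sup>2 + 1 / r0\<^sup>2))"
proof -
  obtain K where K: "K \<ge> 0" "\<And>t. t > 0 \<Longrightarrow> cmod (hk'' t) + cmod (hk' t) / t \<le> K * (1 + 1 / t\<^sup>2)"
    using hk_bounds by blast
  have "radial_C2_bound (\<lambda>r. \<i> / 4 * hankel1_0 (k * r)) r0 r1 (K * (k\<^sup>2 + 1 / r0\<^sup>2))"
    if k: "0 < k" and r0: "0 < r0" for k r0 r1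
  proof -
    have "radial_C2_bound hk (k * r0) (k * r1) (K * (1 + 1 / (k * r0)\<^sup>2))"
    proof (rule radial_C2_boundI[where g' = hk' and g'' = hk''])
      fix t assume t: "t \<in> {k * r0..k * r1}"
      have kr: "0 < k * r0" using k r0 by simp
      then have tp: "t > 0" using t by simp
      show "(hk has_vector_derivative hk' t) (at t)" "(hk' has_vector_derivative hk'' t) (at t)"
        using hk_derivs[OF tp] .
      have "(k * r0)\<^sup>2 \<le> t\<^sup>2" using t kr by (intro power_mono) auto
      moreover have "0 < (k * r0)\<^sup>2" using kr by (rule zero_less_power)
      ultimately have "1 / t\<^sup>2 \<le> 1 / (k * r0)\<^sup>2" by (intro frac_le) auto
      then have "K * (1 + 1 / t\<^sup>2) \<le> K * (1 + 1 / (k * r0)\<^sup>2)" using K(1) by (intro mult_left_mono) auto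
      then show "cmod (hk'' t) + cmod (hk' t) / t \<le> K * (1 + 1 / (k * r0)\<^sup>2)" using K(2)[OF tp] by simp
    qed
    from radial_C2_bound_affine[OF this r0 k, of 1 0]
    have "radial_C2_bound (\<lambda>r. hk (k * r)) r0 r1 (k\<^sup>2 * (K * (1 + 1 / (k * r0)\<^sup>2)))" by simp
    also have "k\<^sup>2 * (K * (1 + 1 / (k * r0)\<^sup>2)) = K * (k\<^sup>2 + 1 / r0\<^sup>2)"
      using k r0 by (simp add: field_simps)
    finally show ?thesis by (simp only: hk0_eq)
  qed
  then show ?thesis using K(1) by blast
qed

lemma radial_C2_bound_reg0:
  fixes b :: real
  assumes b: "b > 0"
  shows "\<exists>K\<ge>0. (\<forall>k r0 r1 c. 0 < k \<longrightarrow> 0 < r0 \<longrightarrow> k * r1 \<le> b \<longrightarrow>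
      radial_C2_bound (\<lambda>r. reg (k * r) + c) r0 r1 (K * k\<^sup>2 * (1 + ln (b / (k * r0))))) \<and>
    (\<forall>t\<in>{0<..b}. cmod (reg t - reg_diag) \<le> K * t\<^sup>2 * (1 + ln (b / t)))"
proof -
  obtain K where K: "K \<ge> 0" "\<And>t. t \<in> {0<..b} \<Longrightarrow> cmod (reg'' t) + cmod (reg' t) / t \<le> K * (1 + ln (b / t))"
    "\<And>t. t \<in> {0<..b} \<Longrightarrow> cmod (reg t - reg_diag) \<le> K * t\<^sup>2 * (1 + ln (b / t))"
    using reg_bounds[OF b] by blast
  have "radial_C2_bound (\<lambda>r. reg (k * r) + c) r0 r1 (K * k\<^sup>2 * (1 + ln (b / (k * r0))))"
    if k: "0 < k" and r0: "0 < r0" and r1: "k * r1 \<le> b" for k r0 r1 c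
  proof -
    have "radial_C2_bound reg (k * r0) (k * r1) (K * (1 + ln (b / (k * r0))))"
    proof (rule radial_C2_boundI[where g' = reg' and g'' = reg''])
      fix t assume t: "t \<in> {k * r0..k * r1}"
      have kr: "0 < k * r0" using k r0 by simp
      then have tp: "t > 0" using t by simp
      show "(reg has_vector_derivative reg' t) (at t)" "(reg' has_vector_derivative reg'' t) (at t)"
        using reg_derivs[OF tp] .
      have "b / t \<le> b / (k * r0)" using t kr b by (intro divide_left_mono) auto
      then have "ln (b / t) \<le> ln (b / (k * r0))" using b tp kr by simp
      then have "K * (1 + ln (b / t)) \<le> K * (1 + ln (b / (k * r0)))" using K(1) by (intro mult_left_mono) auto
      then show "cmod (reg'' t) + cmod (reg' t) / t \<le> K * (1 + ln (b / (k * r0)))"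
        using K(2)[of t] t tp r1 by simp
    qed
    from radial_C2_bound_affine[OF this r0 k, of 1 c] show ?thesis by (simp add: mult_ac)
  qed
  then show ?thesis using K by blast
qed

lemma Phi_dim1: "Phi k (x :: real^1) y = \<i> / 4 * hankel1_0 (k * dist x y)"
  by (simp add: Phi_def)

text \<open>
  Scaling by \<open>k\<close> turns \<open>ln |x - y|\<close> into \<open>ln (k |x - y|) - ln
  k\<close>, hence the additive constant.
\<close>

lemma Phi_star_dim1:
  assumes k: "k > 0"
  shows "Phi_star k (x :: real^1) y =
    (if x = y then reg_diag else reg (k * dist x y)) + complex_of_real (- ln k / (2 * pi))"
proof (cases "x = y")
  case True
  have "Re euler_mascheroni = eul" "Im euler_mascheroni = 0"
    using of_real_euler_mascheroni[where 'a = complex]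
    by (metis Re_complex_of_real, metis Im_complex_of_real)
  with True show ?thesis using k
    by (simp add: Phi_star_def reg_diag_def complex_eq_iff ln_div add_divide_distrib diff_divide_distrib)
next
  case False
  then have "ln (k * dist x y) = ln k + ln (dist x y)" using k by (simp add: ln_mult)
  with False show ?thesis
    by (simp add: Phi_star_def Phi_dim1 hk0_eq reg_def C_coeff_def Phi_log_pow_def add_divide_distrib)
qed

lemma Phi_dim2: "Phi k (x :: real^2) y = exp (\<i> * complex_of_real (k * dist x y)) / complex_of_real (4 * pi * dist x y)"
  by (simp add: Phi_def)

lemma Phi_star_dim2:
  assumes k: "k > 0"
  shows "Phi_star k (x :: real^2) y = (if x = y then \<i> * k / (4 * pi) else k *\<^sub>R Ereg (k * dist x y))"
  using k by (simp add: Phi_star_def Phi_dim2 C_coeff_def Phi_log_pow_def Ereg_def scaleR_conv_of_real field_simps)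

lemma bessel_measurable [measurable]:
  "bessel_J0 \<in> borel_measurable borel" "bessel_Y0 \<in> borel_measurable borel"
proof -
  have "continuous_on UNIV besJ" "continuous_on UNIV serS"
    by (intro continuous_at_imp_continuous_on ballI DERIV_isCont[OF DERIV_J_S(1)] DERIV_isCont[OF DERIV_J_S(3)])+
  then have [measurable]: "besJ \<in> borel_measurable borel" "serS \<in> borel_measurable borel"
    by (auto intro: borel_measurable_continuous_onI)
  have eq: "bessel_J0 = besJ" "bessel_Y0 = besY" by (auto simp: fun_eq_iff bessel_J0_eq bessel_Y0_eq)
  show "bessel_J0 \<in> borel_measurable borel" unfolding eq by measurable
  show "bessel_Y0 \<in> borel_measurable borel" unfolding eq besY_def[abs_def] lg_def by measurable
qed

lemma hankel_measurable [measurable]: "hankel1_0 \<in> borel_measurable borel"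
proof -
  have eq: "hankel1_0 = (\<lambda>x. complex_of_real (bessel_J0 x) + \<i> * complex_of_real (bessel_Y0 x))"
    by (simp add: fun_eq_iff hankel1_0_def complex_eq_iff)
  show ?thesis unfolding eq by measurable
qed

section \<open>Assembly of the error over one level, and the constants\<close>

text \<open>
  The sharper bounds \<open>2 - 2 q^n\<close> and \<open>2 - 2 (n + 1) q^n\<close> are what the
  inductions carry.
\<close>

lemma geometric_sums_half:
  fixes q :: real
  assumes q: "0 \<le> q" "q \<le> 1 / 2"
  shows "(\<Sum>j<n. q ^ j) \<le> 2" "(\<Sum>j<n. real j * q ^ j) \<le> 2"
proof -
  have qq: "2 * (q * q ^ n) \<le> q ^ n" for n
    using mult_right_mono[OF q(2), of "q ^ n"] q by simp
  have *: "(\<Sum>j<n. q ^ j) \<le> 2 - 2 * q ^ n" for n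
  proof (induction n)
    case (Suc n)
    then show ?case using qq[of n] by simp
  qed simp
  have **: "(\<Sum>j<n. real j * q ^ j) \<le> 2 - 2 * (real n + 1) * q ^ n" for n
  proof (induction n)
    case (Suc n)
    have "2 * (q * q ^ n) * (real n + 2) \<le> q ^ n * (real n + 2)"
      using qq by (intro mult_right_mono) auto
    then show ?case using Suc by (simp add: algebra_simps)
  qed simp
  show "(\<Sum>j<n. q ^ j) \<le> 2"
    using *[of n] zero_le_power[OF q(1), of n] by linarith
  have "0 \<le> 2 * (real n + 1) * q ^ n" using q by simp
  then show "(\<Sum>j<n. real j * q ^ j) \<le> 2" using **[of n] by linarith
qed

lemma geometric_sum_le:
  fixes q :: real
  assumes q: "0 \<le> q" "q < 1"
  shows "(\<Sum>j<n. q ^ j) \<le> 1 / (1 - q)"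
proof -
  have "(\<Sum>j<n. q ^ j) = (1 - q ^ n) / (1 - q)" using q by (simp add: sum_gp_strict)
  also have "\<dots> \<le> 1 / (1 - q)" using q by (intro divide_right_mono) auto
  finally show ?thesis .
qed

context hull_disjoint_ifs
begin

lemma I_integral_eq:
  fixes F :: "'a \<Rightarrow> 'a \<Rightarrow> complex"
  assumes F: "integrable P (kernel F)"
  shows "I_integral sim_dim \<Gamma> F = pair_integral [] [] (kernel F)"
proof -
  have m[measurable]: "kernel F \<in> borel_measurable P" using F by (rule borel_measurable_integrable)
  have inner: "(\<integral>y. F x y \<partial>nu) = (\<integral>y. indicator \<Gamma> y *\<^sub>R F x y \<partial>mu)" for x
  proof (rule integral_nu)
    have "(\<lambda>y. kernel F (x, y)) \<in> borel_measurable nu"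
      by (rule measurable_compose[OF measurable_Pair1' m]) simp
    then show "F x \<in> borel_measurable borel" by simp
  qed
  have "(\<lambda>x. \<integral>y. F x y \<partial>nu) \<in> borel_measurable nu"
    using nuP.integrable_fst'[OF F] by (auto dest: borel_measurable_integrable)
  then have "(\<integral>x. (\<integral>y. F x y \<partial>nu) \<partial>nu) = (\<integral>x. indicator \<Gamma> x *\<^sub>R (\<integral>y. F x y \<partial>nu) \<partial>mu)"
    by (intro integral_nu) simp
  moreover have "(\<integral>x. (\<integral>y. F x y \<partial>nu) \<partial>nu) = pair_integral [] [] (kernel F)"
    using nuP.integral_fst'[OF F] pair_integral_Nil[OF m] by simp
  ultimately show ?thesis
    unfolding I_integral_def set_lebesgue_integral_def inner by simp
qed

lemma diagonal_cell_error:
  fixes F :: "'a \<Rightarrow> 'a \<Rightarrow> 'b::{banach, second_countable_topology}"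
  assumes v: "set v \<subseteq> {1..M}" and F: "integrable P (kernel F)"
    and B: "\<And>x y. x \<in> cell v \<Longrightarrow> y \<in> cell v \<Longrightarrow> norm (F x y - F (bary v) (bary v)) \<le> B"
  shows "norm (pair_integral v v (kernel F) - (weight v)\<^sup>2 *\<^sub>R F (bary v) (bary v)) \<le> B * (weight v)\<^sup>2"
proof -
  let ?c = "F (bary v) (bary v)"
  have i: "integrable P (\<lambda>z. kernel F z - ?c)" using F by simp
  have "pair_integral v v (\<lambda>z. kernel F z - ?c) = pair_integral v v (kernel F) - pair_integral v v (\<lambda>_. ?c)"
    unfolding pair_integral_def scaleR_diff_right
    by (rule Bochner_Integration.integral_diff[OF integrable_cells[OF v v F] integrable_cells[OF v v]]) simp
  then have "pair_integral v v (kernel F) - (weight v)\<^sup>2 *\<^sub>R ?c = pair_integral v v (\<lambda>z. kernel F z - ?c)"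
    by (simp add: pair_integral_const[OF v v] weight_def power2_eq_square)
  also have "norm \<dots> \<le> B * (H / real M ^ length v) * (H / real M ^ length v)"
    by (rule pair_integral_bound[OF v v i]) (use B in simp)
  finally show ?thesis by (simp add: weight_def power2_eq_square)
qed

lemma sum_weight_sq: "(\<Sum>w\<in>words l. (weight w)\<^sup>2) = H\<^sup>2 / real M ^ l"
proof -
  have "(\<Sum>w\<in>words l. (weight w)\<^sup>2) = (\<Sum>w\<in>words l. (H / real M ^ l)\<^sup>2)"
    by (rule sum.cong) (auto simp: words_def weight_def)
  then show ?thesis using M_pos by (simp add: card_words power_divide power2_eq_square)
qed

text \<open>
  Summing over the cells of one level: the squared masses add up to \<open>H^2 / M^l\<close>,
  the products of masses to at most \<open>H^2\<close>.
\<close>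

lemma total_error:
  fixes F :: "'a \<times> 'a \<Rightarrow> 'b::{banach, second_countable_topology}"
  assumes F: "integrable P F"
    and diag: "\<And>w. w \<in> words l \<Longrightarrow> norm (pair_integral w w F - qd w) \<le> A * (weight w)\<^sup>2"
    and off: "\<And>w v. \<lbrakk>w \<in> words l; v \<in> words l; w \<noteq> v\<rbrakk> \<Longrightarrow>
      norm (pair_integral w v F - qo w v) \<le> B * (weight w * weight v)"
    and B: "0 \<le> B"
  shows "norm (pair_integral [] [] F - ((\<Sum>w\<in>words l. qd w) + (\<Sum>w\<in>words l. \<Sum>v\<in>words l - {w}. qo w v)))
    \<le> (A / real M ^ l + B) * H\<^sup>2"
proof -
  let ?L = "words l"
  let ?I = "\<lambda>w v. pair_integral w v F"
  have "pair_integral [] [] F = (\<Sum>w\<in>?L. \<Sum>v\<in>?L. ?I w v)"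
    using pair_integral_split[of "[]" "[]", OF _ _ F, of l l] by simp
  also have "\<dots> = (\<Sum>w\<in>?L. ?I w w + (\<Sum>v\<in>?L - {w}. ?I w v))"
    by (intro sum.cong refl sum.remove) auto
  finally have eq: "pair_integral [] [] F - ((\<Sum>w\<in>?L. qd w) + (\<Sum>w\<in>?L. \<Sum>v\<in>?L - {w}. qo w v))
      = (\<Sum>w\<in>?L. ?I w w - qd w) + (\<Sum>w\<in>?L. \<Sum>v\<in>?L - {w}. ?I w v - qo w v)"
    by (simp add: sum.distrib sum_subtractf)
  have "norm (pair_integral [] [] F - ((\<Sum>w\<in>?L. qd w) + (\<Sum>w\<in>?L. \<Sum>v\<in>?L - {w}. qo w v)))
      \<le> (\<Sum>w\<in>?L. A * (weight w)\<^sup>2) + (\<Sum>w\<in>?L. \<Sum>v\<in>?L - {w}. B * (weight w * weight v))"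
    unfolding eq
    by (intro order.trans[OF norm_triangle_ineq] add_mono order.trans[OF norm_sum] sum_mono diag off) auto
  also have "(\<Sum>w\<in>?L. \<Sum>v\<in>?L - {w}. B * (weight w * weight v)) \<le> (\<Sum>w\<in>?L. \<Sum>v\<in>?L. B * (weight w * weight v))"
    using B weight_nonneg by (intro sum_mono sum_mono2) auto
  also have "(\<Sum>w\<in>?L. \<Sum>v\<in>?L. B * (weight w * weight v)) = B * ((\<Sum>w\<in>?L. weight w) * (\<Sum>v\<in>?L. weight v))"
    unfolding sum_product by (simp add: sum_distrib_left)
  also have "(\<Sum>w\<in>?L. weight w) = H" using sum_weight_words[of "[]" l] by (simp add: weight_def)
  also have "(\<Sum>w\<in>?L. A * (weight w)\<^sup>2) = A / real M ^ l * H\<^sup>2"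
    unfolding sum_distrib_left[symmetric] sum_weight_sq by simp
  finally show ?thesis by (simp add: algebra_simps power2_eq_square)
qed

lemma kernel_dist_measurable:
  fixes g :: "real \<Rightarrow> 'b::topological_space"
  assumes [measurable]: "g \<in> borel_measurable borel"
  shows "kernel (\<lambda>x y. g (dist x y)) \<in> borel_measurable P"
proof -
  have "(\<lambda>z. dist (fst z) (snd z)) \<in> borel_measurable P" by measurable
  then show ?thesis by (rule measurable_compose) fact
qed

lemma dist_cells_singleton:
  assumes "m \<in> {1..M}" "m' \<in> {1..M}" "m \<noteq> m'" "x \<in> cell [m]" "y \<in> cell [m']"
  shows "R \<le> dist x y" "dist x y \<le> D"
proof -
  show "R \<le> dist x y"
    using hull_dist_ge[of "[]" m m' "[]" "[]" x y] assms word_map_hull_superset by auto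
  have "x \<in> \<Gamma>" "y \<in> \<Gamma>"
    using assms word_map_attractor_subset[of "[m]"] word_map_attractor_subset[of "[m']"] by auto
  then show "dist x y \<le> D" by (rule diameter_bounded_bound[OF compact_attractor(3)])
qed

lemma log_kernel_integrable: "integrable P (kernel (Phi_log_pow 0))"
proof -
  have eq: "kernel (Phi_log_pow 0) = kernel (\<lambda>x y::'a. ln (dist x y))" by (simp add: Phi_log_pow_def)
  have m: "kernel (\<lambda>x y::'a. ln (dist x y)) \<in> borel_measurable P"
    by (rule kernel_dist_measurable) measurable
  have "integrable P (kernel (\<lambda>x y. \<bar>ln (dist x y)\<bar>))"
  proof (rule singular_kernel_integrable[where \<alpha> = 1 and \<beta> = "\<bar>ln \<rho>\<bar>" and c = "\<bar>ln R\<bar> + \<bar>ln D\<bar>"])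
    show "kernel (\<lambda>x y::'a. \<bar>ln (dist x y)\<bar>) \<in> borel_measurable P"
      by (rule kernel_dist_measurable) measurable
    show "\<bar>ln (dist (s m x) (s m y))\<bar> \<le> 1 * \<bar>ln (dist x y)\<bar> + \<bar>ln \<rho>\<bar>" if "m \<in> {1..M}" "x \<noteq> y" for m x y
      using dist_word_map[of "[m]" x y] that rho_pos by (simp add: word_map_single ln_mult)
    show "\<bar>ln (dist x y)\<bar> \<le> \<bar>ln R\<bar> + \<bar>ln D\<bar>"
      if mm: "m \<in> {1..M}" "m' \<in> {1..M}" "m \<noteq> m'" "x \<in> cell [m]" "y \<in> cell [m']" for m m' x y
    proof -
      note d = dist_cells_singleton[OF mm]
      then have p: "0 < dist x y" using R_pos by linarith
      have "ln R \<le> ln (dist x y)" "ln (dist x y) \<le> ln D"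
        using d by (simp_all only: ln_le_cancel_iff[OF R_pos p] ln_le_cancel_iff[OF p D_pos])
      then show ?thesis by linarith
    qed
  qed (use real_M in auto)
  then show ?thesis unfolding eq using m by (simp add: integrable_abs_iff)
qed

lemma inverse_kernel_integrable:
  assumes Mr: "real M * \<rho> > 1"
  shows "integrable P (kernel (Phi_log_pow 1))"
proof -
  have eq: "kernel (Phi_log_pow 1) = kernel (\<lambda>x y::'a. inverse (dist x y))" by (simp add: Phi_log_pow_def)
  show ?thesis unfolding eq
  proof (rule singular_kernel_integrable[where \<alpha> = "1 / \<rho>" and \<beta> = 0 and c = "inverse R"])
    show "kernel (\<lambda>x y::'a. inverse (dist x y)) \<in> borel_measurable P"
      by (rule kernel_dist_measurable) measurable
    show "inverse (dist (s m x) (s m y)) \<le> 1 / \<rho> * inverse (dist x y) + 0" if "m \<in> {1..M}" "x \<noteq> y" for m x y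
      using dist_word_map[of "[m]" x y] that rho_pos by (simp add: word_map_single inverse_eq_divide)
    show "inverse (dist x y) \<le> inverse R"
      if mm: "m \<in> {1..M}" "m' \<in> {1..M}" "m \<noteq> m'" "x \<in> cell [m]" "y \<in> cell [m']" for m m' x y
      using dist_cells_singleton[OF mm] R_pos by (intro le_imp_inverse_le)
    show "1 \<le> 1 / \<rho>" "1 / \<rho> < real M" using rho_pos rho_less_1 Mr by (auto simp: field_simps)
  qed auto
qed

text \<open>
  Change of variables on a diagonal block.
\<close>

lemma kernel_self_similar:
  fixes F :: "'a \<Rightarrow> 'a \<Rightarrow> real"
  assumes w: "set w \<subseteq> {1..M}" and F: "integrable P (kernel F)"
    and scal: "\<And>x y. x \<noteq> y \<Longrightarrow> F (word_map w x) (word_map w y) = \<alpha> * F x y + \<beta>"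
  shows "pair_integral w w (kernel F) = 1 / real M ^ (2 * length w) * (\<alpha> * (\<integral>z. kernel F z \<partial>P) + \<beta> * H\<^sup>2)"
proof -
  note m = borel_measurable_integrable[OF F]
  have "(\<integral>z. kernel F (pair_map w z) \<partial>P) = (\<integral>z. \<alpha> * kernel F z + \<beta> \<partial>P)"
  proof (rule integral_cong_AE)
    show "(\<lambda>z. kernel F (pair_map w z)) \<in> borel_measurable P"
      by (rule measurable_compose[OF pair_map_measurable[OF w] m])
    show "(\<lambda>z. \<alpha> * kernel F z + \<beta>) \<in> borel_measurable P" using m by measurable
    show "AE z in P. kernel F (pair_map w z) = \<alpha> * kernel F z + \<beta>"
      using AE_P_off_diagonal by eventually_elim (simp add: pair_map_def scal)
  qed
  also have "\<dots> = (\<integral>z. \<alpha> * kernel F z \<partial>P) + (\<integral>z. \<beta> \<partial>P)"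
    using F by (intro Bochner_Integration.integral_add) auto
  also have "\<dots> = \<alpha> * (\<integral>z. kernel F z \<partial>P) + \<beta> * H\<^sup>2"
    unfolding integral_P_const by simp
  finally show ?thesis
    unfolding pair_integral_def integral_P_cell[OF w m] by simp
qed

lemma rho_powr_2: "\<rho> powr (2 * sim_dim) = 1 / (real M)\<^sup>2"
proof -
  have "\<rho> powr (2 * sim_dim) = \<rho> powr sim_dim * \<rho> powr sim_dim"
    using powr_add[of \<rho> sim_dim sim_dim] by (simp only: mult_2)
  then show ?thesis by (simp add: rho_powr_sim_dim power2_eq_square)
qed

text \<open>
  Here \<open>\<theta> = 1/M\<close>, so the factor \<open>(1 - 1/M)/(1 - \<theta>)\<close> is
  exactly 1.
\<close>

lemma log_rule_error:
  assumes w: "set w \<subseteq> {1..M}" and h: "h > 0"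
  shows "\<bar>pair_integral w w (kernel (Phi_log_pow 0)) - Q_sing M \<rho> s \<Gamma> sim_dim h w 0\<bar>
    \<le> 8 / (\<rho> ^ length w * R)\<^sup>2 * h\<^sup>2 * (weight w)\<^sup>2"
proof -
  let ?F = "Phi_log_pow 0 :: 'a \<Rightarrow> 'a \<Rightarrow> real"
  let ?I = "\<integral>z. kernel ?F z \<partial>P"
  let ?Q = "\<Sum>m\<in>{1..M}. \<Sum>m'\<in>{1..M} - {m}. Q h (w @ [m]) (w @ [m']) ?F"
  have self: "pair_integral v v (kernel ?F) = 1 / real M ^ (2 * length v) * (?I + real (length v) * ln \<rho> * H\<^sup>2)"
    if v: "set v \<subseteq> {1..M}" for v
  proof -
    have "?F (word_map v x) (word_map v y) = 1 * ?F x y + real (length v) * ln \<rho>" if "x \<noteq> y" for x y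
      using that rho_pos by (simp add: Phi_log_pow_def dist_word_map[OF v] ln_mult ln_realpow)
    from kernel_self_similar[OF v log_kernel_integrable this] show ?thesis by simp
  qed
  define p where "p = real M ^ length w"
  define Z where "Z = (weight w)\<^sup>2 * ln \<rho> / real M"
  have sum: "(\<Sum>m\<in>{1..M}. pair_integral (w @ [m]) (w @ [m]) (kernel ?F))
      = 1 / real M * pair_integral w w (kernel ?F) + Z"
  proof -
    have "(\<Sum>m\<in>{1..M}. pair_integral (w @ [m]) (w @ [m]) (kernel ?F))
        = (\<Sum>m\<in>{1..M}. 1 / real M ^ (2 * length w + 2) * (?I + (real (length w) + 1) * ln \<rho> * H\<^sup>2))"
      using w by (intro sum.cong refl) (subst self, auto simp: algebra_simps)
    also have "\<dots> = real M * (1 / (p * p * real M * real M) * (?I + (real (length w) + 1) * ln \<rho> * H\<^sup>2))"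
      by (simp add: p_def mult_2 power_add)
    also have "\<dots> = 1 / real M * (1 / (p * p) * (?I + real (length w) * ln \<rho> * H\<^sup>2)) + (H / p)\<^sup>2 * ln \<rho> / real M"
    proof -
      define X where "X = ?I"
      have "p \<noteq> 0" using M_pos by (simp add: p_def)
      then show ?thesis
        unfolding X_def[symmetric] using M_pos by (simp add: field_simps power2_eq_square)
    qed
    finally have "(\<Sum>m\<in>{1..M}. pair_integral (w @ [m]) (w @ [m]) (kernel ?F))
      = 1 / real M * (1 / (p * p) * (?I + real (length w) * ln \<rho> * H\<^sup>2)) + (H / p)\<^sup>2 * ln \<rho> / real M" .
    moreover have "real M ^ (2 * length w) = p * p" by (simp add: p_def mult_2 power_add)
    ultimately show ?thesis unfolding self[OF w] Z_def weight_def p_def[symmetric] by (simp only:)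
  qed
  have Qs: "Q_sing M \<rho> s \<Gamma> sim_dim h w 0 = (Z + ?Q) / (1 - 1 / real M)"
  proof -
    have "real M * \<rho> powr (2 * sim_dim) = 1 / real M" unfolding rho_powr_2 using M_pos by (simp add: power2_eq_square)
    moreover have "(\<Sum>m\<in>{1..M}. \<rho> powr (2 * sim_dim) * (Hd s \<Gamma> sim_dim w)\<^sup>2 * ln \<rho>) = Z"
      unfolding rho_powr_2 Z_def Hd_eq[OF w] weight_def using M_pos by (simp add: power2_eq_square mult_ac)
    ultimately show ?thesis unfolding Q_sing_def by (simp add: sum.distrib inverse_eq_divide)
  qed
  have bd: "radial_C2_bound ln (\<rho> ^ length w * R) (\<rho> ^ length w * D) (2 / (\<rho> ^ length w * R)\<^sup>2)"
    using rho_pos R_pos by (intro radial_C2_bound_ln) simp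
  have "\<bar>pair_integral w w (kernel ?F) - (Z + ?Q) / (1 - 1 / real M)\<bar>
    \<le> (1 - 1 / real M) / (1 - 1 / real M) * (4 * (2 / (\<rho> ^ length w * R)\<^sup>2) * h\<^sup>2 * (weight w)\<^sup>2)"
    by (rule singular_rule_error[OF w h log_kernel_integrable _ bd sum])
      (use real_M in \<open>auto simp: Phi_log_pow_def\<close>)
  then show ?thesis unfolding Qs using real_M by simp
qed

text \<open>
  Here \<open>\<theta> = 1/(M \<rho>)\<close>, which is less than 1 precisely when the dimension
  exceeds 1.
\<close>

lemma inverse_rule_error:
  assumes w: "set w \<subseteq> {1..M}" and h: "h > 0" and Mr: "real M * \<rho> > 1"
  shows "\<bar>pair_integral w w (kernel (Phi_log_pow 1)) - Q_sing M \<rho> s \<Gamma> sim_dim h w 1\<bar>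
    \<le> \<rho> * M / (\<rho> * M - 1) * (12 / (\<rho> ^ length w * R) ^ 3) * h\<^sup>2 * (weight w)\<^sup>2"
proof -
  let ?F = "Phi_log_pow 1 :: 'a \<Rightarrow> 'a \<Rightarrow> real"
  let ?I = "\<integral>z. kernel ?F z \<partial>P"
  let ?Q = "\<Sum>m\<in>{1..M}. \<Sum>m'\<in>{1..M} - {m}. Q h (w @ [m]) (w @ [m']) ?F"
  define \<theta> where "\<theta> = 1 / (real M * \<rho>)"
  have \<theta>1: "\<theta> < 1" using Mr by (simp add: \<theta>_def)
  have self: "pair_integral v v (kernel ?F) = 1 / real M ^ (2 * length v) * (1 / \<rho> ^ length v * ?I)"
    if v: "set v \<subseteq> {1..M}" for v
  proof -
    have "?F (word_map v x) (word_map v y) = 1 / \<rho> ^ length v * ?F x y + 0" if "x \<noteq> y" for x y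
      using that rho_pos by (simp add: Phi_log_pow_def dist_word_map[OF v] inverse_eq_divide)
    from kernel_self_similar[OF v inverse_kernel_integrable[OF Mr] this] show ?thesis by simp
  qed
  have sum: "(\<Sum>m\<in>{1..M}. pair_integral (w @ [m]) (w @ [m]) (kernel ?F))
      = \<theta> * pair_integral w w (kernel ?F) + 0"
  proof -
    have "(\<Sum>m\<in>{1..M}. pair_integral (w @ [m]) (w @ [m]) (kernel ?F))
        = (\<Sum>m\<in>{1..M}. 1 / real M ^ (2 * length w + 2) * (1 / \<rho> ^ (length w + 1) * ?I))"
      using w by (intro sum.cong refl) (subst self, auto)
    then show ?thesis
      unfolding self[OF w] \<theta>_def using M_pos rho_pos by (simp add: power2_eq_square)
  qed
  have Qs: "Q_sing M \<rho> s \<Gamma> sim_dim h w 1 = (0 + ?Q) / (1 - \<theta>)"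
  proof -
    have "\<rho> powr (2 * sim_dim - 1) = \<rho> powr (2 * sim_dim) / \<rho>"
      using rho_pos by (simp add: powr_diff)
    then have "real M * \<rho> powr (2 * sim_dim - 1) = \<theta>"
      unfolding rho_powr_2 \<theta>_def using M_pos rho_pos by (simp add: power2_eq_square)
    then show ?thesis unfolding Q_sing_def by (simp add: inverse_eq_divide)
  qed
  have bd: "radial_C2_bound inverse (\<rho> ^ length w * R) (\<rho> ^ length w * D) (3 / (\<rho> ^ length w * R) ^ 3)"
    using rho_pos R_pos by (intro radial_C2_bound_inverse) simp
  have "\<bar>pair_integral w w (kernel ?F) - (0 + ?Q) / (1 - \<theta>)\<bar>
    \<le> (1 - 1 / real M) / (1 - \<theta>) * (4 * (3 / (\<rho> ^ length w * R) ^ 3) * h\<^sup>2 * (weight w)\<^sup>2)"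
    by (rule singular_rule_error[OF w h inverse_kernel_integrable[OF Mr] _ bd sum \<theta>1])
      (use rho_pos R_pos in \<open>auto simp: Phi_log_pow_def\<close>)
  also have "\<dots> \<le> 1 / (1 - \<theta>) * (4 * (3 / (\<rho> ^ length w * R) ^ 3) * h\<^sup>2 * (weight w)\<^sup>2)"
    using \<theta>1 real_M rho_pos R_pos by (intro mult_right_mono divide_right_mono) auto
  also have "1 / (1 - \<theta>) = \<rho> * M / (\<rho> * M - 1)"
    unfolding \<theta>_def using Mr rho_pos M_pos by (simp add: field_simps)
  finally show ?thesis unfolding Qs by (simp add: mult_ac)
qed

lemma kernel_split:
  fixes F G :: "'a \<Rightarrow> 'a \<Rightarrow> complex" and L :: "'a \<Rightarrow> 'a \<Rightarrow> real"
  assumes F: "kernel F \<in> borel_measurable P" and L: "integrable P (kernel L)" and G: "integrable P (kernel G)"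
    and eq: "\<And>x y. x \<noteq> y \<Longrightarrow> F x y = complex_of_real (c * L x y) + G x y"
  shows "integrable P (kernel F)"
    and "set w \<subseteq> {1..M} \<Longrightarrow> pair_integral w w (kernel F)
      = complex_of_real (c * pair_integral w w (kernel L)) + pair_integral w w (kernel G)"
proof -
  let ?E = "\<lambda>z. complex_of_real (c * kernel L z) + kernel G z"
  have L': "integrable P (\<lambda>z. complex_of_real (c * kernel L z))"
    using L by (intro integrable_of_real) auto
  have E: "integrable P ?E" using L' G by (rule Bochner_Integration.integrable_add)
  have ae: "AE z in P. kernel F z = ?E z" using AE_P_off_diagonal by eventually_elim (rule eq)
  show "integrable P (kernel F)"
    using integrable_cong_AE[OF F borel_measurable_integrable[OF E] ae] E by simp
  assume w: "set w \<subseteq> {1..M}"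
  let ?I = "indicator (cell w \<times> cell w)"
  have m: "cell w \<times> cell w \<in> sets P" using w by (intro pair_measureI) auto
  have "pair_integral w w (kernel F) = (\<integral>z. ?I z *\<^sub>R ?E z \<partial>P)"
    unfolding pair_integral_def
  proof (rule integral_cong_AE)
    show "(\<lambda>z. ?I z *\<^sub>R kernel F z) \<in> borel_measurable P" "(\<lambda>z. ?I z *\<^sub>R ?E z) \<in> borel_measurable P"
      using m F borel_measurable_integrable[OF E]
      by (auto intro!: borel_measurable_scaleR borel_measurable_indicator)
    show "AE z in P. ?I z *\<^sub>R kernel F z = ?I z *\<^sub>R ?E z" using ae by eventually_elim simp
  qed
  also have "\<dots> = (\<integral>z. ?I z *\<^sub>R complex_of_real (c * kernel L z) \<partial>P) + (\<integral>z. ?I z *\<^sub>R kernel G z \<partial>P)"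
    unfolding scaleR_add_right
    by (rule Bochner_Integration.integral_add[OF integrable_cells[OF w w L'] integrable_cells[OF w w G]])
  also have "(\<integral>z. ?I z *\<^sub>R complex_of_real (c * kernel L z) \<partial>P) = (\<integral>z. complex_of_real (c * (?I z *\<^sub>R kernel L z)) \<partial>P)"
    by (intro Bochner_Integration.integral_cong refl) (simp add: scaleR_conv_of_real)
  also have "\<dots> = complex_of_real (\<integral>z. c * (?I z *\<^sub>R kernel L z) \<partial>P)"
    by (rule integral_of_real[OF integrable_mult_right[OF integrable_cells[OF w w L]]])
  also have "(\<integral>z. c * (?I z *\<^sub>R kernel L z) \<partial>P) = c * pair_integral w w (kernel L)"
    by (simp only: integral_mult_right_zero pair_integral_def)
  finally show "pair_integral w w (kernel F)
      = complex_of_real (c * pair_integral w w (kernel L)) + pair_integral w w (kernel G)"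
    unfolding pair_integral_def .
qed

text \<open>
  Both identities restate \<open>M \<rho>^d = 1\<close>.
\<close>

lemma kappa_eq: "\<rho> * M / (\<rho> * M - 1) = 1 / (1 - real M powr (1 / sim_dim - 1))"
  and inverse_rho_eq: "1 / \<rho> = real M powr (1 / sim_dim)"
proof -
  have "real M = (1 / \<rho>) powr sim_dim"
    using rho_powr_sim_dim rho_pos M_pos by (simp add: powr_divide)
  then show i: "1 / \<rho> = real M powr (1 / sim_dim)"
    using rho_pos sim_dim_pos by (simp add: powr_powr)
  have q: "real M powr (1 / sim_dim - 1) = 1 / (\<rho> * real M)"
  proof -
    have "real M powr (1 / sim_dim - 1) = real M powr (1 / sim_dim) / real M"
      using M_pos by (simp add: powr_diff)
    also have "\<dots> = 1 / \<rho> / real M" by (simp only: i)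
    finally show ?thesis by simp
  qed
  show "\<rho> * M / (\<rho> * M - 1) = 1 / (1 - real M powr (1 / sim_dim - 1))"
    unfolding q using rho_pos M_pos by (cases "\<rho> * M = 1") (auto simp: field_simps)
qed

lemma c_rho_eq_c_M: "c_rho n M \<rho> sim_dim R kD c = c_M n M sim_dim R kD c"
proof -
  have p: "1 / \<rho> ^ (n + 1) = real M powr ((real n + 1) / sim_dim)"
  proof -
    have "1 / \<rho> ^ (n + 1) = (1 / \<rho>) ^ (n + 1)" by (simp add: power_divide)
    also have "\<dots> = (real M powr (1 / sim_dim)) ^ (n + 1)" by (simp only: inverse_rho_eq)
    also have "\<dots> = real M powr ((real n + 1) / sim_dim)"
    proof -
      have "(real M powr (1 / sim_dim)) ^ (n + 1) = (real M powr (1 / sim_dim)) powr real (n + 1)"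
        using M_pos by (intro powr_realpow[symmetric]) simp
      then show ?thesis by (simp add: powr_powr add.commute)
    qed
    finally show ?thesis .
  qed
  have "(\<rho> * M / (\<rho> * M - 1)) ^ (n - 1) / (\<rho> ^ (n + 1) * X)
      = real M powr ((real n + 1) / sim_dim) / ((1 - real M powr (1 / sim_dim - 1)) ^ (n - 1) * X)" for X
  proof -
    have "(\<rho> * M / (\<rho> * M - 1)) ^ (n - 1) / (\<rho> ^ (n + 1) * X)
      = (1 / \<rho> ^ (n + 1)) * (\<rho> * M / (\<rho> * M - 1)) ^ (n - 1) / X" by simp
    then show ?thesis unfolding p kappa_eq by (simp add: power_one_over)
  qed
  then show ?thesis unfolding c_rho_def c_M_def by (simp only:)
qed

text \<open>
  There are \<open>M^l\<close> cells, where \<open>l\<close> is the level of \<open>h\<close>,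
  and the previous level has \<open>\<rho>^(l-1) D > h\<close> (for \<open>l = 0\<close> the
  hypothesis \<open>h \<le> D\<close> takes its place); raising \<open>M\<close> to the power
  \<open>- 2 / d\<close> gives \<open>\<rho>^2\<close>.
\<close>

lemma card_L_index_bound:
  assumes h: "h > 0" "h \<le> D"
  shows "h\<^sup>2 \<le> D\<^sup>2 * (real (card (L_index M s \<Gamma> h [])) / real M) powr (- 2 / sim_dim)"
proof -
  have c: "real (card (L_index M s \<Gamma> h [])) = real M ^ level h"
    by (simp add: L_index_eq_words[OF h(1)] card_words)
  have Mr: "real M powr (- 2 / sim_dim) = \<rho>\<^sup>2"
  proof -
    have "real M powr (- 2 / sim_dim) = (real M powr (1 / sim_dim)) powr (- 2)"
      by (simp add: powr_powr)
    also have "\<dots> = (1 / \<rho>) powr (- 2)" by (simp only: inverse_rho_eq)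
    also have "\<dots> = \<rho>\<^sup>2" using rho_pos by (simp add: powr_minus powr_numeral power_divide)
    finally show ?thesis .
  qed
  have e: "(real M ^ level h / real M) powr (- 2 / sim_dim) = (\<rho> ^ level h / \<rho>)\<^sup>2"
  proof -
    have "(real M ^ level h / real M) powr (- 2 / sim_dim)
        = (real M powr (- 2 / sim_dim)) ^ level h / real M powr (- 2 / sim_dim)"
      using M_pos by (simp add: powr_divide power_powr)
    also have "\<dots> = (\<rho> ^ level h / \<rho>)\<^sup>2"
      unfolding Mr by (simp add: power_divide flip: power_mult) (simp add: mult.commute)
    finally show ?thesis .
  qed
  have "h \<le> \<rho> ^ level h / \<rho> * D"
  proof (cases "level h")
    case 0
    have "h \<le> 1 * D" using h by simp
    also have "1 * D \<le> 1 / \<rho> * D" using rho_pos rho_less_1 D_pos by (intro mult_right_mono) auto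
    finally show ?thesis using 0 by simp
  next
    case (Suc n)
    then have "\<not> \<rho> ^ n * D \<le> h" using level_le_iff[OF h(1), of n] by simp
    then show ?thesis using Suc rho_pos by simp
  qed
  then have "h\<^sup>2 \<le> (\<rho> ^ level h / \<rho> * D)\<^sup>2" using h by (intro power_mono) auto
  then show ?thesis unfolding c e by (simp only: power_mult_distrib mult_ac)
qed

end

section \<open>The rule in dimension one\<close>

text \<open>
  Adds the wavenumber \<open>k\<close>, the mesh width \<open>h\<close> and the oscillation
  constant \<open>c\<close> in the range where the rule is used.
\<close>

locale helmholtz_ifs = hull_disjoint_ifs M s \<Gamma> \<rho> R
  for M and s :: "nat \<Rightarrow> real^'n \<Rightarrow> real^'n" and \<Gamma> \<rho> R +
  fixes k h c :: real
  assumes k_pos: "k > 0" and h_pos: "h > 0" and c_pos: "c > 0"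
    and h_le: "if k * D \<le> c then h \<le> D else h \<le> c / k"
    and dim_le: "sim_dim \<le> real CARD('n)"
begin

lemma h_le_D: "h \<le> D"
proof (cases "k * D \<le> c")
  case False
  then have "h \<le> c / k" "c / k < D" using h_le k_pos by (auto simp: field_simps)
  then show ?thesis by simp
qed (use h_le in simp)

lemma Q_subtraction_words:
  "Q_subtraction M \<rho> s \<Gamma> sim_dim k c h =
    (if k * D \<le> c then Q_diag M \<rho> s \<Gamma> sim_dim k h []
     else (\<Sum>w\<in>words (level (c / k)). Q_diag M \<rho> s \<Gamma> sim_dim k h w)
       + (\<Sum>w\<in>words (level (c / k)). \<Sum>v\<in>words (level (c / k)) - {w}. Q h w v (Phi k)))"
  using L_index_eq_words[of "c / k" "[]"] c_pos k_pos by (simp add: Q_subtraction_def Let_def)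

text \<open>
  The level at which the oscillatory case cuts the attractor.  By minimality its cells are not
  much smaller than \<open>c / k\<close>, which bounds their number and their mutual distances.
\<close>

lemma oscillation_level:
  assumes "\<not> k * D \<le> c"
  defines "l \<equiv> level (c / k)"
  shows "0 < l" "k * (\<rho> ^ l * D) \<le> c" "c < k * (\<rho> ^ (l - 1) * D)"
    "1 / real M ^ l \<le> (1 + c) ^ CARD('n) / (k * D) powr sim_dim"
    "1 / (\<rho> ^ (l - 1) * R) \<le> k * D / R / c" "1 / (\<rho> ^ l * R) \<le> k * D / R / c / \<rho>"
proof -
  have ck: "c / k > 0" using c_pos k_pos by simp
  have "\<not> level (c / k) \<le> 0" using assms k_pos level_le_iff[OF ck, of 0] by (simp add: le_divide_eq mult.commute)
  then show l0: "0 < l" by (simp add: l_def)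
  have "\<rho> ^ l * D \<le> c / k" unfolding l_def by (rule level[OF ck])
  then show le: "k * (\<rho> ^ l * D) \<le> c" using k_pos by (simp add: field_simps)
  have "\<not> level (c / k) \<le> l - 1" using l0 by (simp add: l_def)
  then show lt: "c < k * (\<rho> ^ (l - 1) * D)"
    using k_pos by (simp add: level_le_iff[OF ck] field_simps)
  have kD: "k * D > 0" using k_pos D_pos by simp
  have "\<rho> ^ l \<le> c / (k * D)" using le kD by (simp add: pos_le_divide_eq mult_ac)
  then have "1 / real M ^ l \<le> (c / (k * D)) powr sim_dim"
    unfolding rho_power_sim_dim[symmetric] using rho_pos sim_dim_pos by (intro powr_mono2) auto
  also have "\<dots> = c powr sim_dim / (k * D) powr sim_dim"
    using c_pos kD by (simp add: powr_divide)
  also have "\<dots> \<le> (1 + c) ^ CARD('n) / (k * D) powr sim_dim"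
  proof (rule divide_right_mono)
    have "c powr sim_dim \<le> (1 + c) powr sim_dim" using c_pos sim_dim_pos by (intro powr_mono2) auto
    also have "\<dots> \<le> (1 + c) powr real CARD('n)" using c_pos dim_le by (intro powr_mono) auto
    also have "\<dots> = (1 + c) ^ CARD('n)" using c_pos by (intro powr_realpow) simp
    finally show "c powr sim_dim \<le> (1 + c) ^ CARD('n)" .
  qed simp
  finally show "1 / real M ^ l \<le> (1 + c) ^ CARD('n) / (k * D) powr sim_dim" .
  have rl: "\<rho> ^ l = \<rho> * \<rho> ^ (l - 1)" using l0 by (cases l) auto
  have Rl: "0 < \<rho> ^ (l - 1) * R" using rho_pos R_pos by simp
  show i0: "1 / (\<rho> ^ (l - 1) * R) \<le> k * D / R / c"
  proof -
    have "c * R \<le> (k * D) * (\<rho> ^ (l - 1) * R)"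
      using mult_right_mono[OF less_imp_le[OF lt], of R] R_pos by (simp add: mult_ac)
    then have "c * R / (c * R * (\<rho> ^ (l - 1) * R)) \<le> (k * D) * (\<rho> ^ (l - 1) * R) / (c * R * (\<rho> ^ (l - 1) * R))"
      using Rl c_pos R_pos by (intro divide_right_mono) auto
    then show ?thesis using Rl c_pos R_pos rho_pos by (simp add: mult_ac)
  qed
  show "1 / (\<rho> ^ l * R) \<le> k * D / R / c / \<rho>"
    unfolding rl using divide_right_mono[OF i0, of \<rho>] rho_pos by (simp add: mult_ac)
qed

lemma dist_attractor_le: "x \<in> \<Gamma> \<Longrightarrow> y \<in> \<Gamma> \<Longrightarrow> dist x y \<le> D"
  by (rule diameter_bounded_bound[OF compact_attractor(3)])

lemma integrable_bounded_kernel: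
  fixes F :: "real^'n \<Rightarrow> real^'n \<Rightarrow> complex"
  assumes "kernel F \<in> borel_measurable P" "\<And>x y. x \<in> \<Gamma> \<Longrightarrow> y \<in> \<Gamma> \<Longrightarrow> cmod (F x y) \<le> B"
  shows "integrable P (kernel F)"
proof (rule P.integrable_const_bound[OF _ assms(1), where B = B])
  show "AE z in P. cmod (kernel F z) \<le> B"
    using AE_P_attractor by eventually_elim (auto intro: assms(2))
qed

lemma sibling_dist:
  assumes v: "set v \<subseteq> {1..M}" and m: "m \<in> {1..M}" "m' \<in> {1..M}" "m \<noteq> m'"
    and x: "x \<in> hull_cell (v @ [m])" and y: "y \<in> hull_cell (v @ [m'])"
  shows "dist x y \<in> {\<rho> ^ length v * R..\<rho> ^ length v * D}"
proof -
  have "x \<in> hull_cell v" "y \<in> hull_cell v"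
    using x y word_map_append_hull_subset[OF v, of "[m]"] word_map_append_hull_subset[OF v, of "[m']"] m by auto
  then show ?thesis using hull_dist_ge[OF v m, of "[]" "[]" x y] x y dist_hull_cell_le[OF v] by simp
qed

lemma far_cells_dist:
  assumes "w \<in> words l" "v \<in> words l" "w \<noteq> v" "x \<in> hull_cell w" "y \<in> hull_cell v"
  shows "dist x y \<in> {\<rho> ^ (l - 1) * R..D}"
proof -
  have "x \<in> convex hull \<Gamma>" "y \<in> convex hull \<Gamma>"
    using assms word_map_append_hull_subset[of "[]" w] word_map_append_hull_subset[of "[]" v]
    by (auto simp: words_def)
  then show ?thesis using hull_dist_ge_same_length[OF assms] dist_hull_le by simp
qed

end

text \<open>
  The summands come from the diagonal blocks and from the separated blocks for large
  wavenumbers, and from the case of small wavenumbers.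
\<close>

definition error_const_1 :: "real \<Rightarrow> real \<Rightarrow> real \<Rightarrow> real" where
  "error_const_1 c K K' = (8 / c\<^sup>2 + 24 * K) * (1 + c) + 4 * K' * (1 + 1 / c\<^sup>2) + 8 + 24 * K * c\<^sup>2"

text \<open>
  The constants \<open>K\<close> and \<open>K'\<close> bound the derivatives of the regular part
  on \<open>(0, c]\<close> and of the whole kernel; they depend on \<open>c\<close> only and are
  parameters because they are obtained once, before the system is given.
\<close>

locale helmholtz_ifs_1 = helmholtz_ifs M s \<Gamma> \<rho> R k h c
  for M and s :: "nat \<Rightarrow> real^1 \<Rightarrow> real^1" and \<Gamma> \<rho> R k h c +
  fixes K K' :: real
  assumes K: "K \<ge> 0" and K': "K' \<ge> 0"
    and reg_C2: "\<And>k r0 r1 a. 0 < k \<Longrightarrow> 0 < r0 \<Longrightarrow> k * r1 \<le> c \<Longrightarrow>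
      radial_C2_bound (\<lambda>r. reg (k * r) + a) r0 r1 (K * k\<^sup>2 * (1 + ln (c / (k * r0))))"
    and reg_modulus: "\<And>t. t \<in> {0<..c} \<Longrightarrow> cmod (reg t - reg_diag) \<le> K * t\<^sup>2 * (1 + ln (c / t))"
    and hankel_C2: "\<And>k r0 r1. 0 < k \<Longrightarrow> 0 < r0 \<Longrightarrow>
      radial_C2_bound (\<lambda>r. \<i> / 4 * hankel1_0 (k * r)) r0 r1 (K' * (k\<^sup>2 + 1 / r0\<^sup>2))"
begin

text \<open>
  Replaces the monotonicity of \<open>t^2 (1 + ln (b / t))\<close> up to a constant.
\<close>

lemma t_sq_ln_mono:
  fixes t \<tau> :: real
  assumes "0 < t" "t \<le> \<tau>" "\<tau> \<le> b"
  shows "t\<^sup>2 * (1 + ln (b / t)) \<le> \<tau>\<^sup>2 * (2 + ln (b / \<tau>))"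
proof -
  have "ln (b / t) = ln (b / \<tau>) + ln (\<tau> / t)" using assms by (simp add: ln_div)
  also have "ln (\<tau> / t) \<le> \<tau> / t" using ln_le_minus_one[of "\<tau> / t"] assms by simp
  finally have "t\<^sup>2 * (1 + ln (b / t)) \<le> t\<^sup>2 * (1 + ln (b / \<tau>) + \<tau> / t)" by (intro mult_left_mono) auto
  also have "\<dots> = t\<^sup>2 * (1 + ln (b / \<tau>)) + t * \<tau>" using assms by (simp add: field_simps power2_eq_square)
  also have "\<dots> \<le> \<tau>\<^sup>2 * (1 + ln (b / \<tau>)) + \<tau> * \<tau>"
    using assms by (intro add_mono mult_right_mono power_mono) (auto simp: le_divide_eq)
  finally show ?thesis by (simp add: power2_eq_square algebra_simps)
qed

lemma star_measurable: "kernel (Phi_star k) \<in> borel_measurable P"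
proof -
  have [measurable]: "reg \<in> borel_measurable borel" unfolding reg_def[abs_def] hk0_eq by measurable
  have "kernel (\<lambda>x y. (if dist x y = 0 then reg_diag else reg (k * dist x y)) + complex_of_real (- ln k / (2 * pi)))
      \<in> borel_measurable P"
    by (intro kernel_dist_measurable[of "\<lambda>r. (if r = 0 then reg_diag else reg (k * r)) + complex_of_real (- ln k / (2 * pi))"]) measurable
  then show ?thesis by (simp add: Phi_star_dim1[OF k_pos])
qed

lemma star_integrable: "integrable P (kernel (Phi_star k))"
proof -
  have kD: "k * D > 0" using k_pos D_pos by simp
  obtain K0 where K0: "K0 \<ge> 0" "\<And>t. t \<in> {0<..k * D} \<Longrightarrow> cmod (reg t - reg_diag) \<le> K0 * t\<^sup>2 * (1 + ln (k * D / t))"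
    using reg_bounds[OF kD] by blast
  show ?thesis
  proof (rule integrable_bounded_kernel[OF star_measurable])
    fix x y assume xy: "x \<in> \<Gamma>" "y \<in> \<Gamma>"
    show "cmod (Phi_star k x y) \<le> K0 * ((k * D)\<^sup>2 * 2) + cmod reg_diag + \<bar>- ln k / (2 * pi)\<bar>"
    proof (cases "x = y")
      case False
      let ?t = "k * dist x y"
      have t: "?t \<in> {0<..k * D}" using False dist_attractor_le[OF xy] k_pos by auto
      have "cmod (reg ?t - reg_diag) \<le> K0 * (?t\<^sup>2 * (1 + ln (k * D / ?t)))"
        using K0(2)[OF t] by (simp add: mult.assoc)
      also have "?t\<^sup>2 * (1 + ln (k * D / ?t)) \<le> (k * D)\<^sup>2 * (2 + ln (k * D / (k * D)))"
        using t by (intro t_sq_ln_mono) auto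
      finally have "cmod (reg ?t - reg_diag) \<le> K0 * ((k * D)\<^sup>2 * (2 + ln (k * D / (k * D))))"
        using K0(1) by (simp only: mult_left_mono)
      moreover have "k * D / (k * D) = 1" using k_pos D_pos by simp
      ultimately have "cmod (reg ?t - reg_diag) \<le> K0 * ((k * D)\<^sup>2 * 2)" by (simp only: ln_one add_0_right)
      moreover have "cmod (Phi_star k x y) \<le> cmod (reg ?t - reg_diag) + cmod reg_diag + \<bar>- ln k / (2 * pi)\<bar>"
      proof -
        have "Phi_star k x y = (reg ?t - reg_diag) + reg_diag + complex_of_real (- ln k / (2 * pi))"
          using False by (simp add: Phi_star_dim1[OF k_pos])
        also have "cmod \<dots> \<le> cmod (reg ?t - reg_diag) + cmod reg_diag + cmod (complex_of_real (- ln k / (2 * pi)))"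
          by (intro order.trans[OF norm_triangle_ineq] add_right_mono norm_triangle_ineq)
        finally show ?thesis by (simp only: norm_of_real)
      qed
      ultimately show ?thesis by linarith
    next
      case True
      have "cmod (Phi_star k x y) \<le> cmod reg_diag + cmod (complex_of_real (- ln k / (2 * pi)))"
        using True by (simp only: Phi_star_dim1[OF k_pos] if_True norm_triangle_ineq refl)
      moreover have "0 \<le> K0 * ((k * D)\<^sup>2 * 2)" using K0(1) by simp
      ultimately show ?thesis by (simp only: norm_of_real)
    qed
  qed
qed

lemma Phi_measurable: "kernel (Phi k) \<in> borel_measurable P"
proof -
  have "kernel (\<lambda>x y. \<i> / 4 * hankel1_0 (k * dist x y)) \<in> borel_measurable P"
    by (intro kernel_dist_measurable[of "\<lambda>r. \<i> / 4 * hankel1_0 (k * r)"]) measurable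
  then show ?thesis by (simp add: Phi_dim1)
qed

lemma Phi_decomposition:
  "x \<noteq> y \<Longrightarrow> Phi k (x :: real^1) y = complex_of_real (C_coeff CARD(1) * Phi_log_pow 0 x y) + Phi_star k x y"
  by (simp add: Phi_star_def)

lemma Phi_integrable: "integrable P (kernel (Phi k))"
  by (rule kernel_split(1)[OF Phi_measurable log_kernel_integrable star_integrable Phi_decomposition])

lemma Phi_split:
  assumes "set w \<subseteq> {1..M}"
  shows "pair_integral w w (kernel (Phi k)) = complex_of_real (C_coeff CARD(1) * pair_integral w w (kernel (Phi_log_pow 0)))
    + pair_integral w w (kernel (Phi_star k))"
  by (rule kernel_split(2)[OF Phi_measurable log_kernel_integrable star_integrable Phi_decomposition assms])

text \<open>
  At level \<open>j\<close> below the cell the logarithm in the second-derivative bound is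
  \<open>X + j ln (1/\<rho>)\<close>.  Against the weights \<open>M^-j \<le> 2^-j\<close> this
  sums to a multiple of \<open>1 + X + ln (1/\<rho>)\<close>, uniformly in the depth.
\<close>

lemma star_word_error:
  assumes w: "set w \<subseteq> {1..M}" and small: "k * (\<rho> ^ length w * D) \<le> c"
  shows "cmod (pair_integral w w (kernel (Phi_star k)) - Q h w w (Phi_star k))
    \<le> 8 * K * k\<^sup>2 * h\<^sup>2 * (1 + ln (c / (k * (\<rho> ^ length w * R))) + ln (1 / \<rho>)) * (weight w)\<^sup>2"
proof -
  define X where "X = ln (c / (k * (\<rho> ^ length w * R)))"
  define lam where "lam = ln (1 / \<rho>)"
  have lam0: "lam \<ge> 0" using rho_pos rho_less_1 by (simp add: lam_def)
  have kRw: "0 < k * (\<rho> ^ length w * R)" using k_pos rho_pos R_pos by simp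
  have "k * (\<rho> ^ length w * R) \<le> k * (\<rho> ^ length w * D)"
    using k_pos rho_pos R_le_D by (intro mult_left_mono) auto
  then have "k * (\<rho> ^ length w * R) \<le> c" using small by simp
  then have X0: "X \<ge> 0" unfolding X_def using kRw by (simp add: le_divide_eq)
  have small': "k * (\<rho> ^ j * D) \<le> c" if "length w \<le> j" for j
  proof -
    have "k * (\<rho> ^ j * D) \<le> k * (\<rho> ^ length w * D)"
      using that k_pos rho_pos rho_less_1 D_pos by (intro mult_left_mono mult_right_mono power_decreasing) auto
    then show ?thesis using small by simp
  qed
  have lnX: "ln (c / (k * (\<rho> ^ j * R))) = X + real (j - length w) * lam" if lwj: "length w \<le> j" for j
  proof -
    obtain i where i: "j = length w + i" using le_Suc_ex[OF lwj] by blast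
    define a where "a = c / (k * (\<rho> ^ length w * R))"
    have a: "a > 0" unfolding a_def using c_pos kRw by simp
    have "c / (k * (\<rho> ^ j * R)) = a * (1 / \<rho>) ^ i"
      by (simp add: i a_def power_add power_divide)
    then have "ln (c / (k * (\<rho> ^ j * R))) = ln a + ln ((1 / \<rho>) ^ i)"
      using a rho_pos by (simp only: ln_mult_pos zero_less_power zero_less_divide_1_iff)
    then show ?thesis using rho_pos by (simp add: i X_def a_def lam_def ln_realpow)
  qed
  define b where "b j = 4 * (K * k\<^sup>2 * (1 + (X + real (j - length w) * lam))) * h\<^sup>2" for j
  define l where "l = level h - length w"
  define \<beta> where "\<beta> = K * (k\<^sup>2 * h\<^sup>2) * (2 + (X + real l * lam))"
  have main: "cmod (pair_integral w w (kernel (Phi_star k)) - Q h w w (Phi_star k)) \<le>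
    (weight w)\<^sup>2 * ((\<Sum>j<level h - length w. b (length w + j) / real M ^ j)
      + \<beta> / real M ^ (level h - length w))"
  proof (rule diagonal_error[OF h_pos star_integrable _ _ _ w])
    show "0 \<le> b j" for j using K X0 lam0 by (simp add: b_def)
  next
    fix v m m' assume v: "set v \<subseteq> {1..M}" "length w \<le> length v" and m: "m \<in> {1..M}" "m' \<in> {1..M}" "m \<noteq> m'"
    have vm: "set (v @ [m]) \<subseteq> {1..M}" "set (v @ [m']) \<subseteq> {1..M}" using v m by auto
    have bd: "radial_C2_bound (\<lambda>r. reg (k * r) + complex_of_real (- ln k / (2 * pi))) (\<rho> ^ length v * R) (\<rho> ^ length v * D)
      (K * k\<^sup>2 * (1 + ln (c / (k * (\<rho> ^ length v * R)))))"
      using k_pos rho_pos R_pos small'[OF v(2)] by (intro reg_C2) auto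
    have "norm (pair_integral (v @ [m]) (v @ [m']) (kernel (Phi_star k)) - Q h (v @ [m]) (v @ [m']) (Phi_star k))
      \<le> 4 * (K * k\<^sup>2 * (1 + ln (c / (k * (\<rho> ^ length v * R))))) * h\<^sup>2 * (weight (v @ [m]) * weight (v @ [m']))"
      by (rule off_diagonal_error[OF vm h_pos star_integrable _ bd _ sibling_dist[OF v(1) m]])
        (use rho_pos R_pos in \<open>auto simp: Phi_star_dim1[OF k_pos]\<close>)
    then show "norm (pair_integral (v @ [m]) (v @ [m']) (kernel (Phi_star k)) - Q h (v @ [m]) (v @ [m']) (Phi_star k))
      \<le> b (length v) * (weight (v @ [m]) * weight (v @ [m']))"
      unfolding lnX[OF v(2)] b_def .
  next
    fix v assume v: "set v \<subseteq> {1..M}" "length v = length w + (level h - length w)"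
    have lw: "length w \<le> length v" and ll: "length v - length w = l" using v(2) by (auto simp: l_def)
    let ?\<tau> = "k * (\<rho> ^ length v * D)"
    have \<tau>: "0 < ?\<tau>" "?\<tau> \<le> c" using small'[OF lw] k_pos rho_pos D_pos by auto
    have "level h \<le> length v" using v(2) by simp
    then have \<tau>h: "?\<tau> \<le> k * h" using k_pos by (simp add: level_le_iff[OF h_pos])
    have "k * (\<rho> ^ length v * R) \<le> ?\<tau>" using k_pos rho_pos R_le_D by (intro mult_left_mono) auto
    moreover have "0 < k * (\<rho> ^ length v * R)" using k_pos rho_pos R_pos by simp
    ultimately have "c / ?\<tau> \<le> c / (k * (\<rho> ^ length v * R))" using c_pos by (intro divide_left_mono) auto
    then have "ln (c / ?\<tau>) \<le> ln (c / (k * (\<rho> ^ length v * R)))" using c_pos \<tau> by (intro ln_mono) auto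
    then have ln\<tau>: "ln (c / ?\<tau>) \<le> X + real l * lam" unfolding lnX[OF lw] ll .
    have ln0: "0 \<le> ln (c / ?\<tau>)" using \<tau> by (simp add: le_divide_eq)
    show "norm (pair_integral v v (kernel (Phi_star k)) - (weight v)\<^sup>2 *\<^sub>R Phi_star k (bary v) (bary v)) \<le> \<beta> * (weight v)\<^sup>2"
    proof (rule diagonal_cell_error[OF v(1) star_integrable])
      fix x y assume xy: "x \<in> cell v" "y \<in> cell v"
      show "norm (Phi_star k x y - Phi_star k (bary v) (bary v)) \<le> \<beta>"
      proof (cases "x = y")
        case True
        then show ?thesis using K X0 lam0 by (simp add: Phi_star_dim1[OF k_pos] \<beta>_def)
      next
        case False
        let ?t = "k * dist x y"
        have "dist x y \<le> \<rho> ^ length v * D"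
          by (rule dist_hull_cell_le[OF v(1) word_map_hull_superset[OF xy(1)] word_map_hull_superset[OF xy(2)]])
        then have t: "0 < ?t" "?t \<le> ?\<tau>" using False k_pos by auto
        have "norm (Phi_star k x y - Phi_star k (bary v) (bary v)) = cmod (reg ?t - reg_diag)"
          using False by (simp add: Phi_star_dim1[OF k_pos])
        also have "\<dots> \<le> K * (?t\<^sup>2 * (1 + ln (c / ?t)))"
          using reg_modulus[of ?t] t \<tau> by (simp add: mult.assoc)
        also have "\<dots> \<le> K * (?\<tau>\<^sup>2 * (2 + ln (c / ?\<tau>)))"
          using t_sq_ln_mono[OF t \<tau>(2)] K by (rule mult_left_mono)
        also have "\<dots> \<le> K * ((k * h)\<^sup>2 * (2 + (X + real l * lam)))"
        proof -
          have "?\<tau>\<^sup>2 \<le> (k * h)\<^sup>2" using power_mono[OF \<tau>h, of 2] \<tau> by simp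
          then show ?thesis using K ln\<tau> ln0 by (intro mult_left_mono mult_mono) auto
        qed
        finally show ?thesis by (simp add: \<beta>_def power_mult_distrib mult.assoc)
      qed
    qed
  qed
  have "(\<Sum>j<l. b (length w + j) / real M ^ j) + \<beta> / real M ^ l
    \<le> 4 * K * k\<^sup>2 * h\<^sup>2 * (\<Sum>j<Suc l. (1 + X + real j * lam) / real M ^ j)"
  proof -
    have b_eq: "b (length w + j) / real M ^ j = 4 * K * k\<^sup>2 * h\<^sup>2 * ((1 + X + real j * lam) / real M ^ j)" for j
      by (simp add: b_def)
    have \<beta>_le: "\<beta> / real M ^ l \<le> 4 * K * k\<^sup>2 * h\<^sup>2 * ((1 + X + real l * lam) / real M ^ l)"
    proof -
      define u where "u = 1 + X + real l * lam"
      have "0 \<le> X + real l * lam" using X0 lam0 by simp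
      then have "2 + (X + real l * lam) \<le> 4 * u" unfolding u_def by argo
      then have "\<beta> \<le> K * (k\<^sup>2 * h\<^sup>2) * (4 * u)"
        unfolding \<beta>_def using K by (intro mult_left_mono) auto
      then have "\<beta> / real M ^ l \<le> K * (k\<^sup>2 * h\<^sup>2) * (4 * u) / real M ^ l"
        by (rule divide_right_mono) simp
      then show ?thesis unfolding u_def[symmetric] by (simp add: mult_ac)
    qed
    show ?thesis
      unfolding sum.lessThan_Suc distrib_left[of _ "sum _ _"] sum_distrib_left b_eq
      using \<beta>_le by (rule add_left_mono)
  qed
  also have "\<dots> \<le> 4 * K * k\<^sup>2 * h\<^sup>2 * ((1 + X) * 2 + lam * 2)"
  proof (rule mult_left_mono)
    note g = geometric_sums_half[of "1 / real M" "Suc l"]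
    have "(\<Sum>j<Suc l. (1 + X + real j * lam) / real M ^ j)
        = (1 + X) * (\<Sum>j<Suc l. (1 / real M) ^ j) + lam * (\<Sum>j<Suc l. real j * (1 / real M) ^ j)"
      unfolding sum_distrib_left sum.distrib[symmetric]
      by (rule sum.cong) (auto simp: power_divide add_divide_distrib)
    also have "\<dots> \<le> (1 + X) * 2 + lam * 2"
      using g real_M X0 lam0 by (intro add_mono mult_left_mono) (auto simp: field_simps)
    finally show "(\<Sum>j<Suc l. (1 + X + real j * lam) / real M ^ j) \<le> (1 + X) * 2 + lam * 2" .
  qed (use K in simp)
  finally have "(\<Sum>j<l. b (length w + j) / real M ^ j) + \<beta> / real M ^ l \<le> 8 * K * k\<^sup>2 * h\<^sup>2 * (1 + X + lam)"
    by (simp add: algebra_simps)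
  from mult_left_mono[OF this, of "(weight w)\<^sup>2"] main show ?thesis
    unfolding X_def[symmetric] lam_def[symmetric] l_def[symmetric] by (simp add: mult_ac)
qed

text \<open>
  The coefficient of the singular part is at most 1 in modulus; the error is the sum of those of
  the singular and of the regular part.
\<close>

lemma word_error:
  assumes w: "set w \<subseteq> {1..M}" and small: "k * (\<rho> ^ length w * D) \<le> c"
  shows "cmod (pair_integral w w (kernel (Phi k)) - Q_diag M \<rho> s \<Gamma> sim_dim k h w)
    \<le> h\<^sup>2 * (8 / (\<rho> ^ length w * R)\<^sup>2 + 8 * K * k\<^sup>2 * (1 + ln (c / (k * (\<rho> ^ length w * R))) + ln (1 / \<rho>)))
      * (weight w)\<^sup>2"
proof -
  let ?L = "pair_integral w w (kernel (Phi_log_pow 0))" and ?S = "pair_integral w w (kernel (Phi_star k))"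
  let ?C = "C_coeff CARD(1)"
  have C: "\<bar>?C\<bar> \<le> 1" using pi_bound by (simp add: C_coeff_def)
  have eq: "pair_integral w w (kernel (Phi k)) - Q_diag M \<rho> s \<Gamma> sim_dim k h w
    = complex_of_real (?C * (?L - Q_sing M \<rho> s \<Gamma> sim_dim h w 0)) + (?S - Q h w w (Phi_star k))"
    unfolding Phi_split[OF w] Q_diag_def by (simp add: algebra_simps)
  have "cmod (pair_integral w w (kernel (Phi k)) - Q_diag M \<rho> s \<Gamma> sim_dim k h w) \<le> \<bar>?C\<bar> * \<bar>?L - Q_sing M \<rho> s \<Gamma> sim_dim h w 0\<bar> + cmod (?S - Q h w w (Phi_star k))"
    unfolding eq by (rule order.trans[OF norm_triangle_ineq]) (simp only: norm_of_real abs_mult order.refl)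
  also have "\<dots> \<le> 1 * (8 / (\<rho> ^ length w * R)\<^sup>2 * h\<^sup>2 * (weight w)\<^sup>2)
    + 8 * K * k\<^sup>2 * h\<^sup>2 * (1 + ln (c / (k * (\<rho> ^ length w * R))) + ln (1 / \<rho>)) * (weight w)\<^sup>2"
    by (intro add_mono mult_mono C log_rule_error w h_pos star_word_error small) auto
  also have "\<dots> = h\<^sup>2 * (8 / (\<rho> ^ length w * R)\<^sup>2 + 8 * K * k\<^sup>2 * (1 + ln (c / (k * (\<rho> ^ length w * R))) + ln (1 / \<rho>)))
      * (weight w)\<^sup>2"
    by (simp add: algebra_simps)
  finally show ?thesis .
qed

abbreviation error_const :: real where "error_const \<equiv> error_const_1 c K K'"

text \<open>
  With \<open>k \<le> c / D \<le> c / R\<close> every logarithm is absorbed into powers of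
  \<open>R\<close> and \<open>\<rho>\<close> through \<open>ln x \<le> x\<close>.
\<close>

lemma quadrature_error_small_wavenumber:
  assumes "k * D \<le> c"
  shows "cmod (pair_integral [] [] (kernel (Phi k)) - Q_diag M \<rho> s \<Gamma> sim_dim k h [])
    \<le> error_const * (1 / (\<rho>\<^sup>2 * R\<^sup>2)) * h\<^sup>2 * H\<^sup>2"
proof -
  have kR: "0 < k * R" "k * R \<le> c"
    using assms k_pos R_pos R_le_D order.trans[OF mult_left_mono[OF R_le_D, of k]] by auto
  have k2: "k\<^sup>2 \<le> c\<^sup>2 / R\<^sup>2"
  proof -
    have "(k * R)\<^sup>2 \<le> c\<^sup>2" using kR by (intro power_mono) auto
    then show ?thesis using R_pos by (simp add: pos_le_divide_eq power_mult_distrib)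
  qed
  have rr: "1 \<le> 1 / \<rho>\<^sup>2" "1 / \<rho> \<le> 1 / \<rho>\<^sup>2"
  proof -
    have "\<rho> * \<rho> \<le> \<rho> * 1" using rho_pos rho_less_1 by (intro mult_left_mono) auto
    then have r: "\<rho>\<^sup>2 \<le> \<rho>" "\<rho>\<^sup>2 \<le> 1" using rho_less_1 by (auto simp: power2_eq_square)
    then show "1 \<le> 1 / \<rho>\<^sup>2" "1 / \<rho> \<le> 1 / \<rho>\<^sup>2" using rho_pos by (simp_all add: frac_le)
  qed
  have l1: "k\<^sup>2 * ln (c / (k * R)) \<le> c\<^sup>2 / R\<^sup>2"
  proof -
    have "ln (c / (k * R)) \<le> c / (k * R)" using ln_le_minus_one[of "c / (k * R)"] kR c_pos by simp
    then have "k\<^sup>2 * ln (c / (k * R)) \<le> k\<^sup>2 * (c / (k * R))" by (intro mult_left_mono) auto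
    also have "\<dots> = (k * R) * c / R\<^sup>2" using k_pos R_pos by (simp add: power2_eq_square)
    also have "\<dots> \<le> c * c / R\<^sup>2" using kR c_pos by (intro divide_right_mono mult_right_mono) auto
    finally show ?thesis by (simp add: power2_eq_square)
  qed
  have l2: "k\<^sup>2 * ln (1 / \<rho>) \<le> c\<^sup>2 / R\<^sup>2 * (1 / \<rho>\<^sup>2)"
  proof -
    have "ln (1 / \<rho>) \<le> 1 / \<rho>" using ln_le_minus_one[of "1 / \<rho>"] rho_pos by simp
    then show ?thesis using k2 rr rho_pos rho_less_1 by (intro mult_mono) auto
  qed
  let ?E = "8 / R\<^sup>2 + 8 * K * k\<^sup>2 * (1 + ln (c / (k * R)) + ln (1 / \<rho>))"
  have "?E \<le> (8 + 24 * K * c\<^sup>2) * (1 / (\<rho>\<^sup>2 * R\<^sup>2))"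
  proof -
    define Y where "Y = 1 / (\<rho>\<^sup>2 * R\<^sup>2)"
    have besY': "1 / R\<^sup>2 \<le> Y"
      using mult_right_mono[OF rr(1), of "1 / R\<^sup>2"] by (simp add: Y_def)
    have besY'': "c\<^sup>2 / R\<^sup>2 \<le> c\<^sup>2 * Y" using mult_left_mono[OF besY', of "c\<^sup>2"] by simp
    have "k\<^sup>2 * (1 + ln (c / (k * R)) + ln (1 / \<rho>)) \<le> 3 * (c\<^sup>2 * Y)"
    proof -
      have "c\<^sup>2 / R\<^sup>2 * (1 / \<rho>\<^sup>2) = c\<^sup>2 * Y" by (simp add: Y_def mult.commute)
      then have "k\<^sup>2 * ln (1 / \<rho>) \<le> c\<^sup>2 * Y" using l2 by (simp only:)
      from add_mono[OF add_mono[OF order.trans[OF k2 besY''] order.trans[OF l1 besY'']] this]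
      show ?thesis by (simp add: distrib_left mult_ac)
    qed
    then have "8 * K * (k\<^sup>2 * (1 + ln (c / (k * R)) + ln (1 / \<rho>))) \<le> 8 * K * (3 * (c\<^sup>2 * Y))"
      using K by (intro mult_left_mono) auto
    moreover have "8 * (1 / R\<^sup>2) \<le> 8 * Y" using besY' by simp
    ultimately
    have le: "8 * (1 / R\<^sup>2) + 8 * K * (k\<^sup>2 * (1 + ln (c / (k * R)) + ln (1 / \<rho>))) \<le> 8 * Y + 8 * K * (3 * (c\<^sup>2 * Y))"
      by (intro add_mono)
    have "?E = 8 * (1 / R\<^sup>2) + 8 * K * (k\<^sup>2 * (1 + ln (c / (k * R)) + ln (1 / \<rho>)))"
      by (simp only: mult.assoc times_divide_eq_right mult_1_right)
    also note le
    also have "8 * Y + 8 * K * (3 * (c\<^sup>2 * Y)) = 8 * Y + 24 * K * c\<^sup>2 * Y" by simp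
    finally have "?E \<le> 8 * Y + 24 * K * c\<^sup>2 * Y" .
    then show ?thesis unfolding Y_def[symmetric] by (simp only: distrib_right)
  qed
  also have "\<dots> \<le> error_const * (1 / (\<rho>\<^sup>2 * R\<^sup>2))"
    unfolding error_const_1_def using K K' c_pos by (intro mult_right_mono) auto
  finally have E: "?E \<le> error_const * (1 / (\<rho>\<^sup>2 * R\<^sup>2))" .
  have "cmod (pair_integral [] [] (kernel (Phi k)) - Q_diag M \<rho> s \<Gamma> sim_dim k h []) \<le> h\<^sup>2 * ?E * H\<^sup>2"
    using word_error[of "[]"] assms by (simp add: weight_def)
  also have "\<dots> \<le> h\<^sup>2 * (error_const * (1 / (\<rho>\<^sup>2 * R\<^sup>2))) * H\<^sup>2"
    using E by (intro mult_right_mono mult_left_mono) auto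
  finally show ?thesis by (simp only: mult_ac)
qed

text \<open>
  The subcells of a cell of level \<open>l\<close> are separated by \<open>\<rho>^l R\<close>,
  at least \<open>c \<rho> R / (k D)\<close>; with \<open>Y = D / (\<rho> R) \<ge> 1\<close> all
  logarithmic terms are below \<open>3 Y^2\<close> and \<open>k^2 Y^2\<close> is the required
  \<open>(k D / R)^2 / \<rho>^2\<close>.
\<close>

lemma quadrature_error_large_wavenumber:
  assumes large: "\<not> k * D \<le> c"
  defines "L \<equiv> words (level (c / k))"
  shows "cmod (pair_integral [] [] (kernel (Phi k)) - ((\<Sum>w\<in>L. Q_diag M \<rho> s \<Gamma> sim_dim k h w)
      + (\<Sum>w\<in>L. \<Sum>v\<in>L - {w}. Q h w v (Phi k))))
    \<le> error_const * ((1 + 1 / (\<rho>\<^sup>2 * (k * D) powr sim_dim)) * (k * D / R)\<^sup>2) * h\<^sup>2 * H\<^sup>2"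
proof -
  define l where "l = level (c / k)"
  note ol = oscillation_level[OF large, folded l_def]
  define Z where "Z = (k * D / R)\<^sup>2"
  define W where "W = 1 / (k * D) powr sim_dim"
  have kD: "k * D > 0" using k_pos D_pos by simp
  have Z0: "Z \<ge> 0" and W0: "W \<ge> 0" by (auto simp: Z_def W_def)
  have Rl: "0 < \<rho> ^ l * R" "0 < \<rho> ^ (l - 1) * R" using rho_pos R_pos by auto
  note i0 = ol(5) and il = ol(6)
  have i0s: "1 / (\<rho> ^ (l - 1) * R)\<^sup>2 \<le> Z / c\<^sup>2"
    using power_mono[OF i0, of 2] Rl by (simp add: power_divide Z_def power_mult_distrib)
  have ils: "1 / (\<rho> ^ l * R)\<^sup>2 \<le> Z / \<rho>\<^sup>2 / c\<^sup>2"
    using power_mono[OF il, of 2] Rl by (simp add: power_divide Z_def power_mult_distrib mult_ac)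
  \<comment> \<open>\<open>Y\<close> dominates 1, \<open>1 / \<rho>\<close> and the argument of the logarithm.\<close>
  define Y where "Y = D / (\<rho> * R)"
  have DR: "1 \<le> D / R" using R_le_D R_pos by simp
  have DY: "D / R \<le> Y"
    unfolding Y_def using rho_pos rho_less_1 R_pos D_pos by (intro divide_left_mono) auto
  have rY: "1 / \<rho> \<le> Y"
    using mult_right_mono[OF DR, of "1 / \<rho>"] rho_pos by (simp add: Y_def mult.commute)
  have besY': "1 \<le> Y" using DR DY by simp
  have k2: "k\<^sup>2 * Y\<^sup>2 = Z / \<rho>\<^sup>2" by (simp add: Y_def Z_def power_divide power_mult_distrib mult_ac)
  have lnY: "1 + ln (c / (k * (\<rho> ^ l * R))) + ln (1 / \<rho>) \<le> 3 * Y\<^sup>2"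
  proof -
    have "c / (k * (\<rho> ^ l * R)) \<le> Y"
    proof -
      have "c / (k * (\<rho> ^ l * R)) = c / k * (1 / (\<rho> ^ l * R))" by simp
      also have "\<dots> \<le> c / k * (k * D / R / c / \<rho>)" using il c_pos k_pos by (intro mult_left_mono) auto
      also have "\<dots> = Y" using c_pos k_pos by (simp add: Y_def mult_ac)
      finally show ?thesis .
    qed
    moreover have "ln (c / (k * (\<rho> ^ l * R))) \<le> c / (k * (\<rho> ^ l * R))"
      using ln_le_minus_one[of "c / (k * (\<rho> ^ l * R))"] c_pos k_pos Rl by simp
    moreover have "ln (1 / \<rho>) \<le> 1 / \<rho>" using ln_le_minus_one[of "1 / \<rho>"] rho_pos by simp
    moreover have "Y \<le> Y\<^sup>2" using besY' by (simp add: power2_eq_square)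
    ultimately show ?thesis using besY' rY by linarith
  qed
  define A where "A = h\<^sup>2 * (8 / (\<rho> ^ l * R)\<^sup>2 + 8 * K * k\<^sup>2 * (1 + ln (c / (k * (\<rho> ^ l * R))) + ln (1 / \<rho>)))"
  define B where "B = 4 * (K' * (k\<^sup>2 + 1 / (\<rho> ^ (l - 1) * R)\<^sup>2)) * h\<^sup>2"
  have B0: "B \<ge> 0" using K' by (simp add: B_def)
  have A_le: "A \<le> h\<^sup>2 * ((8 / c\<^sup>2 + 24 * K) * (Z / \<rho>\<^sup>2))"
  proof -
    have "8 * K * k\<^sup>2 * (1 + ln (c / (k * (\<rho> ^ l * R))) + ln (1 / \<rho>)) \<le> 8 * K * k\<^sup>2 * (3 * Y\<^sup>2)"
      using lnY K by (intro mult_left_mono) auto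
    also have "\<dots> = 24 * K * (Z / \<rho>\<^sup>2)" unfolding k2[symmetric] by simp
    finally have "8 / (\<rho> ^ l * R)\<^sup>2 + 8 * K * k\<^sup>2 * (1 + ln (c / (k * (\<rho> ^ l * R))) + ln (1 / \<rho>))
      \<le> 8 * (Z / \<rho>\<^sup>2 / c\<^sup>2) + 24 * K * (Z / \<rho>\<^sup>2)" using ils by simp
    also have "\<dots> = (8 / c\<^sup>2 + 24 * K) * (Z / \<rho>\<^sup>2)" by (simp add: algebra_simps)
    finally show ?thesis unfolding A_def by (intro mult_left_mono) auto
  qed
  have "A / real M ^ l \<le> h\<^sup>2 * ((8 / c\<^sup>2 + 24 * K) * (Z / \<rho>\<^sup>2)) * ((1 + c) * W)"
  proof -
    have "A / real M ^ l \<le> h\<^sup>2 * ((8 / c\<^sup>2 + 24 * K) * (Z / \<rho>\<^sup>2)) * (1 / real M ^ l)"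
      using divide_right_mono[OF A_le, of "real M ^ l"] by simp
    also have "\<dots> \<le> h\<^sup>2 * ((8 / c\<^sup>2 + 24 * K) * (Z / \<rho>\<^sup>2)) * ((1 + c) * W)"
      using ol(4) K Z0 by (intro mult_left_mono) (auto simp: W_def)
    finally show ?thesis .
  qed
  also have "\<dots> = h\<^sup>2 * Z * (((8 / c\<^sup>2 + 24 * K) * (1 + c)) * (W / \<rho>\<^sup>2))" by simp
  finally have 1: "A / real M ^ l \<le> h\<^sup>2 * Z * (((8 / c\<^sup>2 + 24 * K) * (1 + c)) * (W / \<rho>\<^sup>2))" .
  have "k\<^sup>2 \<le> Z"
    unfolding Z_def using mult_left_mono[OF DR, of k] k_pos by (intro power_mono) auto
  then have "K' * (k\<^sup>2 + 1 / (\<rho> ^ (l - 1) * R)\<^sup>2) \<le> K' * (Z + Z / c\<^sup>2)"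
    using i0s K' by (intro mult_left_mono add_mono) auto
  then have "B \<le> 4 * (K' * (Z + Z / c\<^sup>2)) * h\<^sup>2"
    unfolding B_def by (simp add: mult_right_mono)
  also have "\<dots> = h\<^sup>2 * Z * (4 * K' * (1 + 1 / c\<^sup>2))" by (simp add: algebra_simps)
  finally have 2: "B \<le> h\<^sup>2 * Z * (4 * K' * (1 + 1 / c\<^sup>2))" .
  have "A / real M ^ l + B \<le> h\<^sup>2 * Z * (((8 / c\<^sup>2 + 24 * K) * (1 + c)) * (W / \<rho>\<^sup>2) + 4 * K' * (1 + 1 / c\<^sup>2))"
    using 1 2 by (simp only: distrib_left)
  also have "\<dots> \<le> h\<^sup>2 * Z * (error_const * (W / \<rho>\<^sup>2) + error_const * 1)"
  proof (intro mult_left_mono add_mono mult_right_mono)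
    show "(8 / c\<^sup>2 + 24 * K) * (1 + c) \<le> error_const" unfolding error_const_1_def using K K' c_pos by simp
    have "0 \<le> (8 / c\<^sup>2 + 24 * K) * (1 + c)" "0 \<le> 24 * K * c\<^sup>2" using K c_pos by auto
    moreover have "b \<le> a + b + 8 + e" if "0 \<le> a" "0 \<le> e" for a b e :: real using that by simp
    ultimately show "4 * K' * (1 + 1 / c\<^sup>2) \<le> error_const * 1"
      unfolding error_const_1_def mult_1_right by blast
  qed (use Z0 W0 in auto)
  finally have AB: "A / real M ^ l + B \<le> error_const * ((1 + W / \<rho>\<^sup>2) * Z) * h\<^sup>2"
    by (simp add: algebra_simps)
  have "cmod (pair_integral [] [] (kernel (Phi k)) - ((\<Sum>w\<in>L. Q_diag M \<rho> s \<Gamma> sim_dim k h w)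
      + (\<Sum>w\<in>L. \<Sum>v\<in>L - {w}. Q h w v (Phi k)))) \<le> (A / real M ^ l + B) * H\<^sup>2"
    unfolding L_def l_def[symmetric]
  proof (rule total_error[OF Phi_integrable _ _ B0])
    fix w assume "w \<in> words l"
    then have w: "set w \<subseteq> {1..M}" "length w = l" by (auto simp: words_def)
    show "cmod (pair_integral w w (kernel (Phi k)) - Q_diag M \<rho> s \<Gamma> sim_dim k h w) \<le> A * (weight w)\<^sup>2"
      using word_error[OF w(1)] ol(2) w(2) unfolding A_def by simp
  next
    fix w v assume wv: "w \<in> words l" "v \<in> words l" "w \<noteq> v"
    then have sw: "set w \<subseteq> {1..M}" "set v \<subseteq> {1..M}" by (auto simp: words_def)
    show "cmod (pair_integral w v (kernel (Phi k)) - Q h w v (Phi k)) \<le> B * (weight w * weight v)"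
      unfolding B_def
      by (rule off_diagonal_error[OF sw h_pos Phi_integrable _ hankel_C2[OF k_pos Rl(2)] Rl(2) far_cells_dist[OF wv]])
        (auto simp: Phi_dim1)
  qed
  also have "\<dots> \<le> error_const * ((1 + W / \<rho>\<^sup>2) * Z) * h\<^sup>2 * H\<^sup>2"
    using AB by (rule mult_right_mono) simp
  also have "W / \<rho>\<^sup>2 = 1 / (\<rho>\<^sup>2 * (k * D) powr sim_dim)" by (simp add: W_def)
  finally show ?thesis unfolding Z_def .
qed

lemma quadrature_error:
  "cmod (I_integral sim_dim \<Gamma> (Phi k) - Q_subtraction M \<rho> s \<Gamma> sim_dim k c h)
    \<le> error_const * c_rho 1 M \<rho> sim_dim R (k * D) c * h\<^sup>2 * H\<^sup>2"
  unfolding I_integral_eq[OF Phi_integrable] Q_subtraction_words c_rho_def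
  using quadrature_error_small_wavenumber quadrature_error_large_wavenumber by (cases "k * D \<le> c") (simp_all add: numeral_2_eq_2)

end

section \<open>The rule in dimension two\<close>

definition error_const_2 :: "real \<Rightarrow> real" where
  "error_const_2 c = (12 + 8 * c ^ 3 + 5 * c\<^sup>2) * (1 + (1 + c)\<^sup>2 / c ^ 3) + 4 * (1 + 1 / c + 3 / c ^ 3)"

locale helmholtz_ifs_2 = helmholtz_ifs M s \<Gamma> \<rho> R k h c
  for M and s :: "nat \<Rightarrow> real^2 \<Rightarrow> real^2" and \<Gamma> \<rho> R k h c +
  assumes dim_gt_1: "sim_dim > 1"
begin

lemma M_rho_gt_1: "real M * \<rho> > 1"
proof -
  have "\<rho> powr sim_dim < \<rho> powr 1" using dim_gt_1 rho_pos rho_less_1 by (intro powr_less_mono') auto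
  then have "real M * \<rho> powr sim_dim < real M * \<rho>"
    using M_pos rho_pos by (intro mult_strict_left_mono) auto
  then show ?thesis by (simp add: M_rho_sim_dim)
qed

definition \<kappa> :: real where "\<kappa> = \<rho> * M / (\<rho> * M - 1)"

lemma kappa_ge_1: "\<kappa> \<ge> 1"
  unfolding \<kappa>_def using M_rho_gt_1 by (simp add: mult.commute le_divide_eq)

lemma star_measurable: "kernel (Phi_star k) \<in> borel_measurable P"
proof -
  have [measurable]: "Ereg \<in> borel_measurable borel" unfolding Ereg_def[abs_def] by measurable
  have "kernel (\<lambda>x y. (if dist x y = 0 then \<i> * k / (4 * pi) else k *\<^sub>R Ereg (k * dist x y))) \<in> borel_measurable P"
    by (intro kernel_dist_measurable[of "\<lambda>r. (if r = 0 then \<i> * k / (4 * pi) else k *\<^sub>R Ereg (k * r))"]) measurable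
  then show ?thesis by (simp add: Phi_star_dim2[OF k_pos])
qed

lemma star_modulus: "cmod (Phi_star k (x :: real^2) y - \<i> * k / (4 * pi)) \<le> k\<^sup>2 * dist x y"
proof (cases "x = y")
  case True
  then show ?thesis by (simp add: Phi_star_dim2[OF k_pos])
next
  case False
  have "Phi_star k x y - \<i> * k / (4 * pi) = k *\<^sub>R (Ereg (k * dist x y) - \<i> / (4 * pi))"
    using False by (simp add: Phi_star_dim2[OF k_pos] scaleR_conv_of_real algebra_simps)
  then have "cmod (Phi_star k x y - \<i> * k / (4 * pi)) = k * cmod (Ereg (k * dist x y) - \<i> / (4 * pi))"
    using k_pos by simp
  also have "\<dots> \<le> k * (k * dist x y)"
    using k_pos False by (intro mult_left_mono Ereg_diag) auto
  finally show ?thesis by (simp add: power2_eq_square)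
qed

lemma star_integrable: "integrable P (kernel (Phi_star k))"
proof (rule integrable_bounded_kernel[OF star_measurable])
  fix x y assume xy: "x \<in> \<Gamma>" "y \<in> \<Gamma>"
  have "cmod (Phi_star k x y) \<le> cmod (Phi_star k x y - \<i> * k / (4 * pi)) + cmod (\<i> * k / (4 * pi))"
    using norm_triangle_ineq[of "Phi_star k x y - \<i> * k / (4 * pi)" "\<i> * k / (4 * pi)"] by simp
  also have "\<dots> \<le> k\<^sup>2 * D + cmod (\<i> * k / (4 * pi))"
    using star_modulus[of x y] mult_left_mono[OF dist_attractor_le[OF xy], of "k\<^sup>2"] by simp
  finally show "cmod (Phi_star k x y) \<le> k\<^sup>2 * D + cmod (\<i> * k / (4 * pi))" .
qed

lemma Phi_measurable: "kernel (Phi k) \<in> borel_measurable P"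
proof -
  have "kernel (\<lambda>x y. exp (\<i> * complex_of_real (k * dist x y)) / complex_of_real (4 * pi * dist x y)) \<in> borel_measurable P"
    by (intro kernel_dist_measurable[of "\<lambda>r. exp (\<i> * complex_of_real (k * r)) / complex_of_real (4 * pi * r)"]) measurable
  then show ?thesis by (simp add: Phi_dim2)
qed

lemma Phi_decomposition:
  "x \<noteq> y \<Longrightarrow> Phi k (x :: real^2) y = complex_of_real (C_coeff CARD(2) * Phi_log_pow 1 x y) + Phi_star k x y"
  by (simp add: Phi_star_def)

lemma Phi_integrable: "integrable P (kernel (Phi k))"
  by (rule kernel_split(1)[OF Phi_measurable inverse_kernel_integrable[OF M_rho_gt_1] star_integrable Phi_decomposition])

lemma Phi_split:
  assumes "set w \<subseteq> {1..M}"
  shows "pair_integral w w (kernel (Phi k)) = complex_of_real (C_coeff CARD(2) * pair_integral w w (kernel (Phi_log_pow 1)))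
    + pair_integral w w (kernel (Phi_star k))"
  by (rule kernel_split(2)[OF Phi_measurable inverse_kernel_integrable[OF M_rho_gt_1] star_integrable Phi_decomposition assms])

text \<open>
  At level \<open>j\<close> below the cell the second derivatives are \<open>k^3 + k^2 /
  (\<rho>^j r)\<close>.  The weights \<open>M^-j\<close> turn the second term into a geometric
  series with ratio \<open>1 / (M \<rho>) < 1\<close>, the origin of \<open>\<kappa>\<close>.
  The last diagonal cells contribute their diameter only to first order, and the missing factor
  \<open>h\<close> comes from \<open>M^-l \<le> \<rho>^l\<close>.
\<close>

lemma star_word_error:
  assumes w: "set w \<subseteq> {1..M}" and small: "k * (\<rho> ^ length w * D) \<le> c"
  defines "r \<equiv> \<rho> ^ length w * R"
  shows "cmod (pair_integral w w (kernel (Phi_star k)) - Q h w w (Phi_star k))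
    \<le> h\<^sup>2 * \<kappa> * (8 * c ^ 3 + 5 * c\<^sup>2) / r ^ 3 * (weight w)\<^sup>2"
proof -
  have r0: "r > 0" using rho_pos R_pos by (simp add: r_def)
  define b where "b j = 4 * (k ^ 3 + k\<^sup>2 / (\<rho> ^ j * R)) * h\<^sup>2" for j
  define l where "l = level h - length w"
  define \<beta> where "\<beta> = k\<^sup>2 * (\<rho> ^ (length w + l) * D)"
  have main: "cmod (pair_integral w w (kernel (Phi_star k)) - Q h w w (Phi_star k)) \<le>
    (weight w)\<^sup>2 * ((\<Sum>j<level h - length w. b (length w + j) / real M ^ j)
      + \<beta> / real M ^ (level h - length w))"
  proof (rule diagonal_error[OF h_pos star_integrable _ _ _ w])
    show "0 \<le> b j" for j using k_pos rho_pos R_pos by (simp add: b_def)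
  next
    fix v m m' assume v: "set v \<subseteq> {1..M}" and m: "m \<in> {1..M}" "m' \<in> {1..M}" "m \<noteq> m'"
    have vm: "set (v @ [m]) \<subseteq> {1..M}" "set (v @ [m']) \<subseteq> {1..M}" using v m by auto
    have rv: "0 < \<rho> ^ length v * R" using rho_pos R_pos by simp
    show "norm (pair_integral (v @ [m]) (v @ [m']) (kernel (Phi_star k)) - Q h (v @ [m]) (v @ [m']) (Phi_star k))
      \<le> b (length v) * (weight (v @ [m]) * weight (v @ [m']))"
      unfolding b_def
      by (rule off_diagonal_error[OF vm h_pos star_integrable _ radial_C2_bound_helmholtz3(1)[OF rv k_pos] rv sibling_dist[OF v m]])
        (auto simp: Phi_star_dim2[OF k_pos])
  next
    fix v assume v: "set v \<subseteq> {1..M}" "length v = length w + (level h - length w)"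
    show "norm (pair_integral v v (kernel (Phi_star k)) - (weight v)\<^sup>2 *\<^sub>R Phi_star k (bary v) (bary v)) \<le> \<beta> * (weight v)\<^sup>2"
    proof (rule diagonal_cell_error[OF v(1) star_integrable])
      fix x y assume xy: "x \<in> cell v" "y \<in> cell v"
      have "Phi_star k (bary v) (bary v) = \<i> * k / (4 * pi)" by (simp add: Phi_star_dim2[OF k_pos])
      then have "norm (Phi_star k x y - Phi_star k (bary v) (bary v)) \<le> k\<^sup>2 * dist x y"
        using star_modulus[of x y] by simp
      also have "dist x y \<le> \<rho> ^ length v * D"
        by (rule dist_hull_cell_le[OF v(1) word_map_hull_superset[OF xy(1)] word_map_hull_superset[OF xy(2)]])
      finally show "norm (Phi_star k x y - Phi_star k (bary v) (bary v)) \<le> \<beta>"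
        by (simp add: \<beta>_def v(2) l_def mult_left_mono)
    qed
  qed
  have s1: "(\<Sum>j<l. b (length w + j) / real M ^ j) \<le> 4 * h\<^sup>2 * (2 * k ^ 3 + k\<^sup>2 / r * \<kappa>)"
  proof -
    have "b (length w + j) / real M ^ j = 4 * h\<^sup>2 * (k ^ 3 * (1 / real M) ^ j + k\<^sup>2 / r * (1 / (real M * \<rho>)) ^ j)" for j
    proof -
      have alg: "4 * (a + e) * hh / m = 4 * hh * (a * (1 / m) + e / m)" for a e hh m :: real
        by (simp add: add_divide_distrib algebra_simps)
      have "k\<^sup>2 / (\<rho> ^ (length w + j) * R) / real M ^ j = k\<^sup>2 / r * (1 / (real M * \<rho>)) ^ j"
        by (simp add: r_def power_add power_divide power_mult_distrib mult_ac)
      moreover have "(1 / real M) ^ j = 1 / real M ^ j" by (simp add: power_divide)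
      ultimately show ?thesis unfolding b_def alg by (simp only:)
    qed
    then have "(\<Sum>j<l. b (length w + j) / real M ^ j)
        = 4 * h\<^sup>2 * (\<Sum>j<l. k ^ 3 * (1 / real M) ^ j + k\<^sup>2 / r * (1 / (real M * \<rho>)) ^ j)"
      by (simp only: sum_distrib_left)
    also have "\<dots> = 4 * h\<^sup>2 * (k ^ 3 * (\<Sum>j<l. (1 / real M) ^ j) + k\<^sup>2 / r * (\<Sum>j<l. (1 / (real M * \<rho>)) ^ j))"
      by (simp only: sum.distrib sum_distrib_left)
    also have "\<dots> \<le> 4 * h\<^sup>2 * (k ^ 3 * 2 + k\<^sup>2 / r * \<kappa>)"
    proof (intro mult_left_mono add_mono)
      show "(\<Sum>j<l. (1 / real M) ^ j) \<le> 2" using real_M by (intro geometric_sums_half) (auto simp: field_simps)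
      have "(\<Sum>j<l. (1 / (real M * \<rho>)) ^ j) \<le> 1 / (1 - 1 / (real M * \<rho>))"
        using M_rho_gt_1 by (intro geometric_sum_le) auto
      also have "\<dots> = \<kappa>" unfolding \<kappa>_def using M_rho_gt_1 rho_pos M_pos by (simp add: field_simps)
      finally show "(\<Sum>j<l. (1 / (real M * \<rho>)) ^ j) \<le> \<kappa>" .
    qed (use k_pos r0 in auto)
    finally show ?thesis by (simp add: mult.commute)
  qed
  have s2: "\<beta> / real M ^ l \<le> h\<^sup>2 * (k\<^sup>2 / r)"
  proof -
    let ?\<delta> = "\<rho> ^ (length w + l) * D"
    have \<delta>: "?\<delta> \<le> h" "0 < ?\<delta>"
      using level_le_iff[OF h_pos, of "length w + l"] rho_pos D_pos by (auto simp: l_def)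
    have "1 / real M \<le> \<rho>" using M_rho_gt_1 M_pos by (simp add: field_simps)
    then have "1 / real M ^ l \<le> \<rho> ^ l" using power_mono[of "1 / real M" \<rho> l] by (simp add: power_divide)
    then have "?\<delta> * (1 / real M ^ l) \<le> ?\<delta> * \<rho> ^ l" using \<delta> by (intro mult_left_mono) auto
    also have "\<dots> = ?\<delta>\<^sup>2 / (\<rho> ^ length w * D)"
      using rho_pos D_pos by (simp add: power_add power2_eq_square)
    also have "\<dots> \<le> h\<^sup>2 / r"
    proof (rule frac_le)
      show "?\<delta>\<^sup>2 \<le> h\<^sup>2" using \<delta> by (intro power_mono) auto
      show "r \<le> \<rho> ^ length w * D" unfolding r_def using R_le_D rho_pos by (intro mult_left_mono) auto
    qed (use r0 in auto)
    finally have "k\<^sup>2 * (?\<delta> * (1 / real M ^ l)) \<le> k\<^sup>2 * (h\<^sup>2 / r)" by (intro mult_left_mono) auto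
    then show ?thesis by (simp add: \<beta>_def mult_ac)
  qed
  have krc: "k * r \<le> c"
  proof -
    have "k * r \<le> k * (\<rho> ^ length w * D)" unfolding r_def using k_pos rho_pos R_le_D by (intro mult_left_mono) auto
    then show ?thesis using small by simp
  qed
  have k3: "k ^ 3 \<le> c ^ 3 / r ^ 3"
  proof -
    have "(k * r) ^ 3 \<le> c ^ 3" using krc k_pos r0 by (intro power_mono) auto
    then show ?thesis using r0 by (simp add: pos_le_divide_eq power_mult_distrib)
  qed
  have k2: "k\<^sup>2 / r \<le> c\<^sup>2 / r ^ 3"
  proof -
    have "(k * r)\<^sup>2 \<le> c\<^sup>2" using krc k_pos r0 by (intro power_mono) auto
    then have "(k * r)\<^sup>2 / r ^ 3 \<le> c\<^sup>2 / r ^ 3" using r0 by (intro divide_right_mono) auto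
    moreover have "(k * r)\<^sup>2 / r ^ 3 = k\<^sup>2 / r" using r0 by (simp add: power2_eq_square power3_eq_cube)
    ultimately show ?thesis by simp
  qed
  have "(\<Sum>j<l. b (length w + j) / real M ^ j) + \<beta> / real M ^ l
    \<le> 4 * h\<^sup>2 * (2 * k ^ 3 + k\<^sup>2 / r * \<kappa>) + h\<^sup>2 * (k\<^sup>2 / r)"
    using s1 s2 by (rule add_mono)
  also have "\<dots> \<le> 4 * h\<^sup>2 * (2 * (c ^ 3 / r ^ 3) * \<kappa> + c\<^sup>2 / r ^ 3 * \<kappa>) + h\<^sup>2 * (c\<^sup>2 / r ^ 3 * \<kappa>)"
  proof (intro add_mono mult_left_mono)
    have "2 * k ^ 3 * 1 \<le> 2 * (c ^ 3 / r ^ 3) * \<kappa>"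
      using k3 kappa_ge_1 c_pos r0 k_pos by (intro mult_mono) auto
    then show "2 * k ^ 3 \<le> 2 * (c ^ 3 / r ^ 3) * \<kappa>" by simp
    show "k\<^sup>2 / r * \<kappa> \<le> c\<^sup>2 / r ^ 3 * \<kappa>" using k2 kappa_ge_1 by (intro mult_right_mono) auto
    have "k\<^sup>2 / r * 1 \<le> c\<^sup>2 / r ^ 3 * \<kappa>"
      using k2 kappa_ge_1 c_pos r0 by (intro mult_mono) auto
    then show "k\<^sup>2 / r \<le> c\<^sup>2 / r ^ 3 * \<kappa>" by simp
  qed auto
  also have "\<dots> = h\<^sup>2 * \<kappa> * (8 * c ^ 3 + 5 * c\<^sup>2) / r ^ 3"
    by (simp add: add_divide_distrib algebra_simps)
  finally have "(\<Sum>j<l. b (length w + j) / real M ^ j) + \<beta> / real M ^ l \<le> h\<^sup>2 * \<kappa> * (8 * c ^ 3 + 5 * c\<^sup>2) / r ^ 3" .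
  from mult_left_mono[OF this, of "(weight w)\<^sup>2"] main show ?thesis
    unfolding l_def[symmetric] by (simp add: mult.commute)
qed

lemma word_error:
  assumes w: "set w \<subseteq> {1..M}" and small: "k * (\<rho> ^ length w * D) \<le> c"
  shows "cmod (pair_integral w w (kernel (Phi k)) - Q_diag M \<rho> s \<Gamma> sim_dim k h w)
    \<le> h\<^sup>2 * \<kappa> * (12 + 8 * c ^ 3 + 5 * c\<^sup>2) / (\<rho> ^ length w * R) ^ 3 * (weight w)\<^sup>2"
proof -
  let ?L = "pair_integral w w (kernel (Phi_log_pow 1))" and ?S = "pair_integral w w (kernel (Phi_star k))"
  let ?C = "C_coeff CARD(2)"
  define q where "q = (\<rho> ^ length w * R) ^ 3"
  have C: "\<bar>?C\<bar> \<le> 1" using pi_bound by (simp add: C_coeff_def)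
  have eq: "pair_integral w w (kernel (Phi k)) - Q_diag M \<rho> s \<Gamma> sim_dim k h w
    = complex_of_real (?C * (?L - Q_sing M \<rho> s \<Gamma> sim_dim h w 1)) + (?S - Q h w w (Phi_star k))"
    unfolding Phi_split[OF w] Q_diag_def by (simp add: algebra_simps)
  have "cmod (pair_integral w w (kernel (Phi k)) - Q_diag M \<rho> s \<Gamma> sim_dim k h w)
    \<le> \<bar>?C\<bar> * \<bar>?L - Q_sing M \<rho> s \<Gamma> sim_dim h w 1\<bar> + cmod (?S - Q h w w (Phi_star k))"
    unfolding eq by (rule order.trans[OF norm_triangle_ineq]) (simp only: norm_of_real abs_mult order.refl)
  also have "\<dots> \<le> 1 * (\<kappa> * (12 / q) * h\<^sup>2 * (weight w)\<^sup>2)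
    + h\<^sup>2 * \<kappa> * (8 * c ^ 3 + 5 * c\<^sup>2) / q * (weight w)\<^sup>2"
    unfolding \<kappa>_def q_def
    by (intro add_mono mult_mono C inverse_rule_error w h_pos M_rho_gt_1 star_word_error[unfolded \<kappa>_def] small) auto
  also have "\<dots> = h\<^sup>2 * \<kappa> * (12 + 8 * c ^ 3 + 5 * c\<^sup>2) / q * (weight w)\<^sup>2"
    by (simp add: add_divide_distrib algebra_simps)
  finally show ?thesis unfolding q_def .
qed

lemma quadrature_error_small_wavenumber:
  assumes "k * D \<le> c"
  shows "cmod (pair_integral [] [] (kernel (Phi k)) - Q_diag M \<rho> s \<Gamma> sim_dim k h [])
    \<le> error_const_2 c * (\<kappa> / (\<rho> ^ 3 * R ^ 3)) * h\<^sup>2 * H\<^sup>2"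
proof -
  let ?K = "12 + 8 * c ^ 3 + 5 * c\<^sup>2"
  have K: "0 \<le> ?K" "?K \<le> error_const_2 c"
  proof -
    show K0: "0 \<le> ?K" using c_pos by simp
    have "?K * 1 \<le> ?K * (1 + (1 + c)\<^sup>2 / c ^ 3)" using K0 c_pos by (intro mult_left_mono) auto
    moreover have "0 \<le> 4 * (1 + 1 / c + 3 / c ^ 3)" using c_pos by simp
    moreover have "p \<le> q + b" if "p * 1 \<le> q" "0 \<le> b" for p q b :: real using that by simp
    ultimately show "?K \<le> error_const_2 c" unfolding error_const_2_def by blast
  qed
  have "cmod (pair_integral [] [] (kernel (Phi k)) - Q_diag M \<rho> s \<Gamma> sim_dim k h [])
    \<le> h\<^sup>2 * \<kappa> * ?K / R ^ 3 * H\<^sup>2"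
    using word_error[of "[]"] assms by (simp add: weight_def)
  also have "\<dots> = ?K * (\<kappa> / (1 * R ^ 3)) * h\<^sup>2 * H\<^sup>2" by simp
  also have "\<dots> \<le> error_const_2 c * (\<kappa> / (\<rho> ^ 3 * R ^ 3)) * h\<^sup>2 * H\<^sup>2"
    using K kappa_ge_1 rho_pos rho_less_1 R_pos
    by (intro mult_right_mono mult_mono divide_left_mono) (auto simp: power_le_one)
  finally show ?thesis .
qed

text \<open>
  As in dimension one, without logarithms: all three terms of the kernel's second-derivative
  bound are below multiples of \<open>(k D / R)^3\<close> at distances at least \<open>c R / (k
  D)\<close>.
\<close>

lemma quadrature_error_large_wavenumber:
  assumes large: "\<not> k * D \<le> c"
  defines "L \<equiv> words (level (c / k))"
  shows "cmod (pair_integral [] [] (kernel (Phi k)) - ((\<Sum>w\<in>L. Q_diag M \<rho> s \<Gamma> sim_dim k h w)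
      + (\<Sum>w\<in>L. \<Sum>v\<in>L - {w}. Q h w v (Phi k))))
    \<le> error_const_2 c * ((1 + \<kappa> / (\<rho> ^ 3 * (k * D) powr sim_dim)) * (k * D / R) ^ 3) * h\<^sup>2 * H\<^sup>2"
proof -
  let ?K = "12 + 8 * c ^ 3 + 5 * c\<^sup>2"
  have K0: "0 \<le> ?K" using c_pos by simp
  define l where "l = level (c / k)"
  note ol = oscillation_level[OF large, folded l_def]
  define Z where "Z = (k * D / R) ^ 3"
  define W where "W = 1 / (k * D) powr sim_dim"
  have kD: "k * D > 0" using k_pos D_pos by simp
  have Z0: "Z \<ge> 0" and W0: "W \<ge> 0" using kD R_pos by (auto simp: Z_def W_def)
  have Rl: "0 < \<rho> ^ l * R" "0 < \<rho> ^ (l - 1) * R" using rho_pos R_pos by auto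
  note i0 = ol(5) and il = ol(6)
  have i0s: "1 / (\<rho> ^ (l - 1) * R) ^ 3 \<le> Z / c ^ 3"
    using power_mono[OF i0, of 3] Rl by (simp add: power_divide Z_def power_mult_distrib)
  have ils: "1 / (\<rho> ^ l * R) ^ 3 \<le> Z / \<rho> ^ 3 / c ^ 3"
    using power_mono[OF il, of 3] Rl by (simp add: power_divide Z_def power_mult_distrib mult_ac)
  have DR: "1 \<le> D / R" using R_le_D R_pos by simp
  define x where "x = k * D / R"
  have kx: "k \<le> x" unfolding x_def using mult_left_mono[OF DR, of k] k_pos by simp
  have x0: "0 \<le> x" using kx k_pos by simp
  have Zx: "Z = x ^ 3" by (simp add: Z_def x_def)
  define A where "A = h\<^sup>2 * \<kappa> * ?K / (\<rho> ^ l * R) ^ 3"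
  define B where "B = 4 * (k ^ 3 + k\<^sup>2 / (\<rho> ^ (l - 1) * R) + 3 / (\<rho> ^ (l - 1) * R) ^ 3) * h\<^sup>2"
  have B0: "B \<ge> 0" unfolding B_def using k_pos Rl by simp
  have "A / real M ^ l = h\<^sup>2 * \<kappa> * ?K * (1 / (\<rho> ^ l * R) ^ 3) * (1 / real M ^ l)" by (simp add: A_def)
  also have "\<dots> \<le> h\<^sup>2 * \<kappa> * ?K * (Z / \<rho> ^ 3 / c ^ 3) * ((1 + c)\<^sup>2 * W)"
  proof (rule mult_mono)
    show "h\<^sup>2 * \<kappa> * ?K * (1 / (\<rho> ^ l * R) ^ 3) \<le> h\<^sup>2 * \<kappa> * ?K * (Z / \<rho> ^ 3 / c ^ 3)"
      using ils kappa_ge_1 K0 by (intro mult_left_mono) auto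
    show "1 / real M ^ l \<le> (1 + c)\<^sup>2 * W" using ol(4) by (simp add: W_def)
  qed (use kappa_ge_1 K0 Z0 rho_pos c_pos in auto)
  also have "\<dots> = h\<^sup>2 * Z * (?K * ((1 + c)\<^sup>2 / c ^ 3) * (\<kappa> * W / \<rho> ^ 3))" by (simp add: mult_ac)
  finally have 1: "A / real M ^ l \<le> h\<^sup>2 * Z * (?K * ((1 + c)\<^sup>2 / c ^ 3) * (\<kappa> * W / \<rho> ^ 3))" .
  have "k ^ 3 + k\<^sup>2 / (\<rho> ^ (l - 1) * R) + 3 / (\<rho> ^ (l - 1) * R) ^ 3 \<le> Z + Z / c + 3 * (Z / c ^ 3)"
  proof (intro add_mono)
    show "k ^ 3 \<le> Z" unfolding Zx using kx k_pos by (intro power_mono) auto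
    have "k\<^sup>2 * (1 / (\<rho> ^ (l - 1) * R)) \<le> x\<^sup>2 * (x / c)"
      using kx k_pos i0 Rl c_pos x0 by (intro mult_mono power_mono) (auto simp: x_def)
    then show "k\<^sup>2 / (\<rho> ^ (l - 1) * R) \<le> Z / c" by (simp add: Zx power2_eq_square power3_eq_cube mult.assoc)
    show "3 / (\<rho> ^ (l - 1) * R) ^ 3 \<le> 3 * (Z / c ^ 3)" using i0s by simp
  qed
  then have "B \<le> 4 * (Z + Z / c + 3 * (Z / c ^ 3)) * h\<^sup>2"
    unfolding B_def by (intro mult_right_mono mult_left_mono) auto
  also have "\<dots> = h\<^sup>2 * Z * (4 * (1 + 1 / c + 3 / c ^ 3))" by (simp add: algebra_simps)
  finally have 2: "B \<le> h\<^sup>2 * Z * (4 * (1 + 1 / c + 3 / c ^ 3))" .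
  have "A / real M ^ l + B \<le> h\<^sup>2 * Z * (?K * ((1 + c)\<^sup>2 / c ^ 3) * (\<kappa> * W / \<rho> ^ 3) + 4 * (1 + 1 / c + 3 / c ^ 3))"
    using 1 2 by (simp only: distrib_left)
  also have "\<dots> \<le> h\<^sup>2 * Z * (error_const_2 c * (\<kappa> * W / \<rho> ^ 3) + error_const_2 c * 1)"
  proof (intro mult_left_mono add_mono mult_right_mono)
    have nn: "0 \<le> ?K * ((1 + c)\<^sup>2 / c ^ 3)" "0 \<le> 4 * (1 + 1 / c + 3 / c ^ 3)" using K0 c_pos by auto
    have e: "error_const_2 c = ?K + ?K * ((1 + c)\<^sup>2 / c ^ 3) + 4 * (1 + 1 / c + 3 / c ^ 3)"
      unfolding error_const_2_def by (simp only: distrib_left mult_1_right)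
    have ineq: "p \<le> a + p + b" if "0 \<le> a" "0 \<le> b" for a b p :: real using that by simp
    show "?K * ((1 + c)\<^sup>2 / c ^ 3) \<le> error_const_2 c" unfolding e by (rule ineq[OF K0 nn(2)])
    have ineq2: "p \<le> a + b + p" if "0 \<le> a" "0 \<le> b" for a b p :: real using that by simp
    show "4 * (1 + 1 / c + 3 / c ^ 3) \<le> error_const_2 c * 1"
      unfolding e mult_1_right by (rule ineq2[OF K0 nn(1)])
  qed (use Z0 W0 kappa_ge_1 rho_pos in auto)
  finally have AB: "A / real M ^ l + B \<le> error_const_2 c * ((1 + \<kappa> * W / \<rho> ^ 3) * Z) * h\<^sup>2"
    by (simp add: algebra_simps)
  have "cmod (pair_integral [] [] (kernel (Phi k)) - ((\<Sum>w\<in>L. Q_diag M \<rho> s \<Gamma> sim_dim k h w)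
      + (\<Sum>w\<in>L. \<Sum>v\<in>L - {w}. Q h w v (Phi k)))) \<le> (A / real M ^ l + B) * H\<^sup>2"
    unfolding L_def l_def[symmetric]
  proof (rule total_error[OF Phi_integrable _ _ B0])
    fix w assume "w \<in> words l"
    then have w: "set w \<subseteq> {1..M}" "length w = l" by (auto simp: words_def)
    show "cmod (pair_integral w w (kernel (Phi k)) - Q_diag M \<rho> s \<Gamma> sim_dim k h w) \<le> A * (weight w)\<^sup>2"
      using word_error[OF w(1)] ol(2) w(2) unfolding A_def by simp
  next
    fix w v assume wv: "w \<in> words l" "v \<in> words l" "w \<noteq> v"
    then have sw: "set w \<subseteq> {1..M}" "set v \<subseteq> {1..M}" by (auto simp: words_def)
    show "cmod (pair_integral w v (kernel (Phi k)) - Q h w v (Phi k)) \<le> B * (weight w * weight v)"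
      unfolding B_def
      by (rule off_diagonal_error[OF sw h_pos Phi_integrable _ radial_C2_bound_helmholtz3(2)[OF Rl(2) k_pos] Rl(2) far_cells_dist[OF wv]])
        (auto simp: Phi_dim2)
  qed
  also have "\<dots> \<le> error_const_2 c * ((1 + \<kappa> * W / \<rho> ^ 3) * Z) * h\<^sup>2 * H\<^sup>2"
    using AB by (rule mult_right_mono) simp
  also have "\<kappa> * W / \<rho> ^ 3 = \<kappa> / (\<rho> ^ 3 * (k * D) powr sim_dim)" by (simp add: W_def)
  finally show ?thesis unfolding Z_def .
qed

lemma quadrature_error:
  "cmod (I_integral sim_dim \<Gamma> (Phi k) - Q_subtraction M \<rho> s \<Gamma> sim_dim k c h)
    \<le> error_const_2 c * c_rho 2 M \<rho> sim_dim R (k * D) c * h\<^sup>2 * H\<^sup>2"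
  unfolding I_integral_eq[OF Phi_integrable] Q_subtraction_words c_rho_def
  using quadrature_error_small_wavenumber quadrature_error_large_wavenumber
  by (cases "k * D \<le> c") (simp_all add: \<kappa>_def numeral_3_eq_3 numeral_2_eq_2)

end

section \<open>From the geometric hypotheses to the error bound\<close>

lemma similarity_ifs_linear:
  assumes "similarity_ifs M r s" "homogeneous_ifs M r \<rho>" "m \<in> {1..M}"
  shows "\<exists>A b. orthogonal_matrix (A :: real^'n^'n) \<and> s m = (\<lambda>x. \<rho> *\<^sub>R (A *v x) + b)"
  using assms unfolding similarity_ifs_def homogeneous_ifs_def by (metis ext)

lemma hull_disjoint_ifsI:
  fixes s :: "nat \<Rightarrow> real^'n \<Rightarrow> real^'n"
  assumes ifs: "similarity_ifs M r s" "homogeneous_ifs M r \<rho>" "is_attractor M s \<Gamma>"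
    and R: "R = hull_separation M s \<Gamma>" "R > 0"
  shows "hull_disjoint_ifs M s \<Gamma> \<rho> R"
proof
  show M: "2 \<le> M" using ifs(1) by (simp add: similarity_ifs_def)
  have "1 \<in> {1..M}" using M by simp
  then have "0 < r 1" "r 1 < 1" "r 1 = \<rho>"
    using ifs(1,2) unfolding similarity_ifs_def homogeneous_ifs_def by blast+
  then show "0 < \<rho>" "\<rho> < 1" by auto
  show "is_attractor M s \<Gamma>" "R > 0" by fact+
next
  fix m assume m: "m \<in> {1..M}"
  have "1 \<in> {1..M}" using m by simp
  then have \<rho>: "0 < \<rho>" using ifs(1,2) unfolding similarity_ifs_def homogeneous_ifs_def by metis
  obtain A b where A: "orthogonal_matrix (A :: real^'n^'n)" "s m = (\<lambda>x. \<rho> *\<^sub>R (A *v x) + b)"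
    using similarity_ifs_linear[OF ifs(1,2) m] by blast
  have "orthogonal_transformation ((*v) A)"
    using A(1) by (simp add: orthogonal_transformation_matrix)
  then have "linear ((*v) A)" "\<And>x. norm (A *v x) = norm x"
    by (auto simp: orthogonal_transformation_norm orthogonal_transformation_linear)
  then show "\<exists>f b. linear f \<and> (\<forall>x. norm (f x) = \<rho> * norm x) \<and> s m = (\<lambda>x. f x + b)"
    using \<rho> A(2) by (intro exI[of _ "\<lambda>x. \<rho> *\<^sub>R (A *v x)"] exI[of _ b]) (auto intro: linear_compose_scale_right)
next
  fix m m' x y
  assume m: "m \<in> {1..M}" "m' \<in> {1..M}" "m \<noteq> m'" and xy: "x \<in> convex hull \<Gamma>" "y \<in> convex hull \<Gamma>"
  let ?f = "\<lambda>(m, m'). setdist (s m ` (convex hull \<Gamma>)) (s m' ` (convex hull \<Gamma>))"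
  let ?S = "{setdist (s m ` (convex hull \<Gamma>)) (s m' ` (convex hull \<Gamma>)) | m m'.
            m \<in> {1..M} \<and> m' \<in> {1..M} \<and> m \<noteq> m'}"
  have "?S \<subseteq> ?f ` ({1..M} \<times> {1..M})" by auto
  then have "finite ?S" by (rule finite_subset) auto
  then have "R \<le> setdist (s m ` (convex hull \<Gamma>)) (s m' ` (convex hull \<Gamma>))"
    unfolding R(1) hull_separation_def using m by (intro Min_le) auto
  also have "\<dots> \<le> dist (s m x) (s m' y)" using xy by (intro setdist_le_dist) auto
  finally show "R \<le> dist (s m x) (s m' y)" .
qed

text \<open>
  The images of the open set are disjoint subsets of it, each with \<open>\<rho>^n\<close> times
  its volume.
\<close>

lemma open_set_condition_volume:
  fixes s :: "nat \<Rightarrow> real^'n::{finite,wellorder} \<Rightarrow> real^'n::_"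
  assumes ifs: "similarity_ifs M r s" "homogeneous_ifs M r \<rho>" and osc: "open_set_condition M s" and \<rho>: "\<rho> > 0"
  shows "real M * \<rho> ^ CARD('n) \<le> 1"
proof -
  obtain O' where *: "O' \<noteq> {} \<and> bounded O' \<and> open O' \<and> (\<Union>m\<in>{1..M}. s m ` O') \<subseteq> O' \<and>
       (\<forall>m\<in>{1..M}. \<forall>m'\<in>{1..M}. m \<noteq> m' \<longrightarrow> s m ` O' \<inter> s m' ` O' = {})"
    using osc unfolding open_set_condition_def ..
  then have O': "O' \<noteq> {}" "bounded O'" "open O'" "(\<Union>m\<in>{1..M}. s m ` O') \<subseteq> O'"
    "\<And>m m'. m \<in> {1..M} \<Longrightarrow> m' \<in> {1..M} \<Longrightarrow> m \<noteq> m' \<Longrightarrow> s m ` O' \<inter> s m' ` O' = {}"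
    by simp_all
  have lO: "O' \<in> lmeasurable" using O' by (intro lmeasurable_open)
  have vol: "s m ` O' \<in> lmeasurable \<and> measure lebesgue (s m ` O') = \<rho> ^ CARD('n) * measure lebesgue O'"
    if m: "m \<in> {1..M}" for m
  proof -
    obtain A b where A: "orthogonal_matrix A" "s m = (\<lambda>x. \<rho> *\<^sub>R (A *v x) + b)"
      using similarity_ifs_linear[OF ifs m] by blast
    define f where "f x = \<rho> *\<^sub>R (A *v x)" for x
    have lf: "linear f" unfolding f_def by (intro linear_compose_scale_right) simp
    have img: "s m ` O' = (+) b ` f ` O'" by (auto simp: A(2) f_def add.commute image_image)
    have "det (matrix f) = \<rho> ^ CARD('n) * det A"
    proof -
      have "matrix f = matrix ((*\<^sub>R) \<rho> \<circ> (*v) A)" by (simp add: f_def[abs_def] o_def)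
      also have "\<dots> = matrix ((*\<^sub>R) \<rho>) ** matrix ((*v) A)" by (intro matrix_compose) auto
      finally show ?thesis by (simp add: det_mul)
    qed
    moreover have "\<bar>det A\<bar> = 1" using det_orthogonal_matrix[OF A(1)] by auto
    ultimately have "\<bar>det (matrix f)\<bar> = \<rho> ^ CARD('n)" using \<rho> by (simp add: abs_mult)
    then show ?thesis
      unfolding img measure_translation using measure_linear_image[OF lf lO] measurable_linear_image[OF lf lO]
      by (simp add: measurable_translation)
  qed
  have pos: "measure lebesgue O' > 0"
    using open_not_negligible[OF O'(3,1)] lO by (simp add: negligible_iff_measure zero_less_measure_iff)
  have "real M * \<rho> ^ CARD('n) * measure lebesgue O' = (\<Sum>m\<in>{1..M}. measure lebesgue (s m ` O'))"
    using vol by simp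
  also have "\<dots> = measure lebesgue (\<Union>m\<in>{1..M}. s m ` O')"
    using vol O'(5) by (intro measure_UNION'[symmetric]) (auto simp: pairwise_def disjnt_def)
  also have "\<dots> \<le> measure lebesgue O'"
    using vol O'(4) lO by (intro measure_mono_fmeasurable fmeasurableD fmeasurable.finite_UN) auto
  finally show ?thesis using pos by simp
qed

text \<open>
  With \<open>M \<rho>^n \<le> 1\<close>, an exponent above \<open>n\<close> would make \<open>M
  \<rho>^d\<close> less than 1.
\<close>

lemma (in hull_disjoint_ifs) sim_dim_le:
  assumes "real M * \<rho> ^ n \<le> 1" shows "sim_dim \<le> real n"
proof (rule ccontr)
  assume "\<not> sim_dim \<le> real n"
  then have "\<rho> powr sim_dim < \<rho> powr real n" using rho_pos rho_less_1 by (intro powr_less_mono') auto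
  then have "real M * \<rho> powr sim_dim < real M * \<rho> powr real n"
    using M_pos by (intro mult_strict_left_mono) auto
  then show False using assms rho_pos by (simp add: M_rho_sim_dim powr_realpow)
qed

text \<open>
  Enlarging the constant is harmless because the factor \<open>c'\<close> is nonnegative; in
  dimension two this uses \<open>\<rho> M > 1\<close>.
\<close>

lemma (in hull_disjoint_ifs) error_bounds:
  assumes err: "E \<le> C0 * c_rho n M \<rho> sim_dim R (k * D) c * h\<^sup>2 * H\<^sup>2"
    and C: "C0 \<le> C" "0 \<le> C" and h: "0 < h" "h \<le> D" and k: "0 < k"
    and n: "n = 1 \<or> 1 < \<rho> * M"
  shows "c_rho n M \<rho> sim_dim R (k * D) c = c_M n M sim_dim R (k * D) c \<and>
    E \<le> C * c_rho n M \<rho> sim_dim R (k * D) c * h\<^sup>2 * H\<^sup>2 \<and>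
    C * c_rho n M \<rho> sim_dim R (k * D) c * h\<^sup>2 * H\<^sup>2
      \<le> C * c_rho n M \<rho> sim_dim R (k * D) c * (D * H)\<^sup>2
        * (real (card (L_index M s \<Gamma> h [])) / real M) powr (- 2 / sim_dim)"
proof (intro conjI)
  let ?c = "c_rho n M \<rho> sim_dim R (k * D) c"
  show "?c = c_M n M sim_dim R (k * D) c" by (rule c_rho_eq_c_M)
  have "0 \<le> (\<rho> * M / (\<rho> * M - 1)) ^ (n - 1)" using n by (cases "n = 1") auto
  then have c0: "0 \<le> ?c"
    unfolding c_rho_def using rho_pos R_pos D_pos k by auto
  have "C0 * ?c * h\<^sup>2 * H\<^sup>2 \<le> C * ?c * h\<^sup>2 * H\<^sup>2"
    using C c0 by (intro mult_right_mono) auto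
  with err show "E \<le> C * ?c * h\<^sup>2 * H\<^sup>2" by (rule order.trans)
  let ?N = "(real (card (L_index M s \<Gamma> h [])) / real M) powr (- 2 / sim_dim)"
  have "C * ?c * h\<^sup>2 * H\<^sup>2 \<le> C * ?c * (D\<^sup>2 * ?N) * H\<^sup>2"
    using card_L_index_bound[OF h] C c0 by (intro mult_right_mono mult_left_mono) auto
  also have "\<dots> = C * ?c * (D * H)\<^sup>2 * ?N" by (simp only: power_mult_distrib mult_ac)
  finally show "C * ?c * h\<^sup>2 * H\<^sup>2 \<le> C * ?c * (D * H)\<^sup>2 * ?N" .
qed

theorem theorem5p7:
  fixes c_osc :: real
  assumes "c_osc > 0"
  shows "\<exists>C>0.
         (\<forall>M r (s :: nat \<Rightarrow> real^1 \<Rightarrow> real^1) \<Gamma> d \<rho> R k h N c'.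
           similarity_ifs M r s \<and> is_attractor M s \<Gamma> \<and> open_set_condition M s \<and>
           d = hausdorff_dim \<Gamma> \<and> d > real 1 - 1 \<and>
           homogeneous_ifs M r \<rho> \<and>
           R = hull_separation M s \<Gamma> \<and> R > 0 \<and>
           k > 0 \<and> h > 0 \<and>
           (if k * diameter \<Gamma> \<le> c_osc then h \<le> diameter \<Gamma> else h \<le> c_osc / k) \<and>
           N = card (L_index M s \<Gamma> h []) \<and>
           c' = c_rho 1 M \<rho> d R (k * diameter \<Gamma>) c_osc \<longrightarrow>
           c' = c_M 1 M d R (k * diameter \<Gamma>) c_osc \<and>
           cmod (I_integral d \<Gamma> (Phi k) - Q_subtraction M \<rho> s \<Gamma> d k c_osc h)
             \<le> C * c' * h\<^sup>2 * (measure (hausdorff_measure d) \<Gamma>)\<^sup>2 \<and>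
           C * c' * h\<^sup>2 * (measure (hausdorff_measure d) \<Gamma>)\<^sup>2
             \<le> C * c' * (diameter \<Gamma> * measure (hausdorff_measure d) \<Gamma>)\<^sup>2
                 * (real N / real M) powr (- 2 / d)) \<and>
         (\<forall>M r (s :: nat \<Rightarrow> real^2 \<Rightarrow> real^2) \<Gamma> d \<rho> R k h N c'.
           similarity_ifs M r s \<and> is_attractor M s \<Gamma> \<and> open_set_condition M s \<and>
           d = hausdorff_dim \<Gamma> \<and> d > real 2 - 1 \<and>
           homogeneous_ifs M r \<rho> \<and>
           R = hull_separation M s \<Gamma> \<and> R > 0 \<and>
           k > 0 \<and> h > 0 \<and>
           (if k * diameter \<Gamma> \<le> c_osc then h \<le> diameter \<Gamma> else h \<le> c_osc / k) \<and>
           N = card (L_index M s \<Gamma> h []) \<and>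
           c' = c_rho 2 M \<rho> d R (k * diameter \<Gamma>) c_osc \<longrightarrow>
           c' = c_M 2 M d R (k * diameter \<Gamma>) c_osc \<and>
           cmod (I_integral d \<Gamma> (Phi k) - Q_subtraction M \<rho> s \<Gamma> d k c_osc h)
             \<le> C * c' * h\<^sup>2 * (measure (hausdorff_measure d) \<Gamma>)\<^sup>2 \<and>
           C * c' * h\<^sup>2 * (measure (hausdorff_measure d) \<Gamma>)\<^sup>2
             \<le> C * c' * (diameter \<Gamma> * measure (hausdorff_measure d) \<Gamma>)\<^sup>2
                 * (real N / real M) powr (- 2 / d))"
proof -
  let ?c = c_osc
  obtain K where K: "K \<ge> 0"
    "\<And>k r0 r1 a. 0 < k \<Longrightarrow> 0 < r0 \<Longrightarrow> k * r1 \<le> ?c \<Longrightarrow>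
      radial_C2_bound (\<lambda>r. reg (k * r) + a) r0 r1 (K * k\<^sup>2 * (1 + ln (?c / (k * r0))))"
    "\<And>t. t \<in> {0<..?c} \<Longrightarrow> cmod (reg t - reg_diag) \<le> K * t\<^sup>2 * (1 + ln (?c / t))"
    using radial_C2_bound_reg0[OF assms] by blast
  obtain K' where K': "K' \<ge> 0" "\<And>k r0 r1. 0 < k \<Longrightarrow> 0 < r0 \<Longrightarrow>
      radial_C2_bound (\<lambda>r. \<i> / 4 * hankel1_0 (k * r)) r0 r1 (K' * (k\<^sup>2 + 1 / r0\<^sup>2))"
    using radial_C2_bound_hankel by blast
  define C where "C = error_const_1 ?c K K' + error_const_2 ?c"
  have "0 \<le> (8 / ?c\<^sup>2 + 24 * K) * (1 + ?c)" "0 \<le> 4 * K' * (1 + 1 / ?c\<^sup>2)" "0 \<le> 24 * K * ?c\<^sup>2"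
    using K(1) K'(1) assms by auto
  moreover have "0 \<le> (12 + 8 * ?c ^ 3 + 5 * ?c\<^sup>2) * (1 + (1 + ?c)\<^sup>2 / ?c ^ 3)" "0 < 4 * (1 + 1 / ?c + 3 / ?c ^ 3)"
    using assms by (auto intro!: add_pos_nonneg mult_nonneg_nonneg)
  moreover have "0 < x + y + 8 + z" if "0 \<le> x" "0 \<le> y" "0 \<le> z" for x y z :: real using that by simp
  moreover have "0 < x + y" if "0 \<le> x" "0 < y" for x y :: real using that by simp
  ultimately have pos: "0 < error_const_1 ?c K K'" "0 < error_const_2 ?c"
    unfolding error_const_1_def error_const_2_def by (simp_all only:)
  then have C: "0 < C" "error_const_1 ?c K K' \<le> C" "error_const_2 ?c \<le> C" by (auto simp: C_def)
  show ?thesis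
  proof (intro exI[of _ C] conjI allI impI; (elim conjE)?)
    show "C > 0" by (rule C(1))
  next
    fix M r \<Gamma> d \<rho> R k h N c' and s :: "nat \<Rightarrow> real^1 \<Rightarrow> real^1"
    assume ifs: "similarity_ifs M r s" "is_attractor M s \<Gamma>" "open_set_condition M s"
      and d: "d = hausdorff_dim \<Gamma>" and hom: "homogeneous_ifs M r \<rho>"
      and R: "R = hull_separation M s \<Gamma>" "R > 0" and k: "k > 0" and h: "h > 0"
      and h_le: "if k * diameter \<Gamma> \<le> ?c then h \<le> diameter \<Gamma> else h \<le> ?c / k"
      and N: "N = card (L_index M s \<Gamma> h [])"
      and c': "c' = c_rho 1 M \<rho> d R (k * diameter \<Gamma>) ?c"
    interpret hull_disjoint_ifs M s \<Gamma> \<rho> R by (rule hull_disjoint_ifsI[OF ifs(1) hom ifs(2) R])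
    have dim: "sim_dim \<le> real CARD(1)"
      using open_set_condition_volume[OF ifs(1) hom ifs(3) rho_pos] by (rule sim_dim_le)
    interpret H: helmholtz_ifs_1 M s \<Gamma> \<rho> R k h ?c K K'
      by unfold_locales (use k h assms h_le dim K K' in auto)
    have d: "d = sim_dim" unfolding d by (rule hausdorff_dim_attractor)
    from error_bounds[OF H.quadrature_error C(2) _ h H.h_le_D k] C(1)
    show "c' = c_M 1 M d R (k * diameter \<Gamma>) ?c"
      "cmod (I_integral d \<Gamma> (Phi k) - Q_subtraction M \<rho> s \<Gamma> d k ?c h)
        \<le> C * c' * h\<^sup>2 * (measure (hausdorff_measure d) \<Gamma>)\<^sup>2"
      "C * c' * h\<^sup>2 * (measure (hausdorff_measure d) \<Gamma>)\<^sup>2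
        \<le> C * c' * (diameter \<Gamma> * measure (hausdorff_measure d) \<Gamma>)\<^sup>2 * (real N / real M) powr (- 2 / d)"
      unfolding c' d N by auto
  next
    fix M r \<Gamma> d \<rho> R k h N c' and s :: "nat \<Rightarrow> real^2 \<Rightarrow> real^2"
    assume ifs: "similarity_ifs M r s" "is_attractor M s \<Gamma>" "open_set_condition M s"
      and d: "d = hausdorff_dim \<Gamma>" and d1: "d > real 2 - 1" and hom: "homogeneous_ifs M r \<rho>"
      and R: "R = hull_separation M s \<Gamma>" "R > 0" and k: "k > 0" and h: "h > 0"
      and h_le: "if k * diameter \<Gamma> \<le> ?c then h \<le> diameter \<Gamma> else h \<le> ?c / k"
      and N: "N = card (L_index M s \<Gamma> h [])"
      and c': "c' = c_rho 2 M \<rho> d R (k * diameter \<Gamma>) ?c"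
    interpret hull_disjoint_ifs M s \<Gamma> \<rho> R by (rule hull_disjoint_ifsI[OF ifs(1) hom ifs(2) R])
    have dim: "sim_dim \<le> real CARD(2)"
      using open_set_condition_volume[OF ifs(1) hom ifs(3) rho_pos] by (rule sim_dim_le)
    have d: "d = sim_dim" unfolding d by (rule hausdorff_dim_attractor)
    have "sim_dim > 1" using d1 d by simp
    interpret H: helmholtz_ifs_2 M s \<Gamma> \<rho> R k h ?c
      by unfold_locales (use k h assms h_le dim \<open>sim_dim > 1\<close> in auto)
    have "1 < \<rho> * real M" using H.M_rho_gt_1 by (simp add: mult.commute)
    with error_bounds[OF H.quadrature_error C(3) _ h H.h_le_D k] C(1)
    show "c' = c_M 2 M d R (k * diameter \<Gamma>) ?c"
      "cmod (I_integral d \<Gamma> (Phi k) - Q_subtraction M \<rho> s \<Gamma> d k ?c h)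
        \<le> C * c' * h\<^sup>2 * (measure (hausdorff_measure d) \<Gamma>)\<^sup>2"
      "C * c' * h\<^sup>2 * (measure (hausdorff_measure d) \<Gamma>)\<^sup>2
        \<le> C * c' * (diameter \<Gamma> * measure (hausdorff_measure d) \<Gamma>)\<^sup>2 * (real N / real M) powr (- 2 / d)"
      unfolding c' d N by auto
  qed
qed

end
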